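(* Let $m\ge 1$ and let $\omega$ be any translation-invariant symplectic structure on $M:=\mathbb{Z}^{2m}\backslash\mathbb{R}^{2m}$. Then every translation-invariant Riemannian metric $h$ on $M$ lies in a continuous family $\{h_t\}_t$ of mutually nonisometric flat metrics on $M$ such that $(M,h_t,\omega)$ is classically equivalent to $(M,h,\omega)$ for all $t$. Moreover, if $\omega$ represents an integer cohomology class, then these $(M,h_t,\omega)$ are also quantum equivalent to $(M,h,\omega)$ for all $t$.
   Context: A metric or $2$-form on $M=\mathbb{Z}^{2m}\backslash\mathbb{R}^{2m}$ is translation-invariant if its pullback to $\mathbb{R}^{2m}$ is invariant under all translations; it is then identified with a bilinear form on $\mathbb{R}^{2m}$. "Flat metric on $M$" means translation-invariant Riemannian metric. A continuous family $\{h_t\}_t$ means that $h_t$ depends continuously on a parameter $t$ ranging over (at least) a nondegenerate interval, and "mutually nonisometric" means that $(M,h_s)$ and $(M,h_t)$ are not isometric as Riemannian manifolds for $s\ne t$. Classical equivalence. For a Riemannian manifold $(M,h)$ and a nondegenerate closed $2$-form $\omega$ on $M$, let $\pi:T^*M\to M$ be the projection, $\lambda$ the canonical $1$-form on $T^*M$, $\omega_0=-d\lambda$, $\Omega=\omega_0+\pi^*\omega$, and $H:T^*M\to\mathbb{R}$, $H(q,\xi)=\frac12 h_q(\xi,\xi)$ (with the inner product induced by $h$ on cotangent vectors). The tuples $(M_1,h_1,\omega_1)$ and $(M_2,h_2,\omega_2)$ are classically equivalent if there is a symplectomorphism $\Phi:(T^*M_1,\Omega_1)\to(T^*M_2,\Omega_2)$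 with $H_1=H_2\circ\Phi$. Quantum equivalence. Let $\omega$ be a translation-invariant symplectic structure on the torus $M$ representing an integer cohomology class and $h$ a translation-invariant metric. Let $L$ be a Hermitian complex line bundle over $M$ with Chern class $[\omega]$, and $\nabla$ a Hermitian connection on $L$ with curvature $-2\pi i\omega$; denote also by $\nabla$ the induced connection on $L^{\otimes k}$, $k\in\mathbb{Z}^+$. Let $\Delta=-\operatorname{trace}(\nabla^2)$ be the associated Laplacian (trace with respect to $h$) on sections of $L^{\otimes k}$, and $\widehat H_k=\frac{\hbar^2}{2}\Delta$ with $\hbar=1/k$. $\mathrm{Spec}(k\omega,h)$ denotes the spectrum of $\widehat H_k$, with multiplicities; it does not depend on the choices of $L$ and $\nabla$. The tuples $(M,h_1,\omega_1)$ and $(M,h_2,\omega_2)$ are quantum equivalent if $\mathrm{Spec}(k\omega_1,h_1)=\mathrm{Spec}(k\omega_2,h_2)$ for all $k\in\mathbb{Z}^+$. *)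

theory Defs
  imports
    "HOL-Analysis.Analysis"
    "HOL-Homology.Simplices"
    "HOL-Library.Function_Algebras"
begin

section \<open>The torus and its cotangent space\<close>

text \<open>
  For an index type of cardinality \<open>n\<close>, the following type is the quotient of \<open>R^n\<close> by \<open>Z^n\<close>,
  with projection \<^term>\<open>proj\<close>.  It carries the quotient topology.
\<close>

definition lattice_rel :: "real^'n \<Rightarrow> real^'n \<Rightarrow> bool" where
  "lattice_rel x y \<longleftrightarrow> (\<forall>i. x $ i - y $ i \<in> \<int>)"

lemma equivp_lattice_rel: "equivp lattice_rel"
proof (rule equivpI)
  show "reflp lattice_rel"
    by (auto simp: reflp_def lattice_rel_def)
  show "symp lattice_rel"
    unfolding symp_def lattice_rel_def by (metis Ints_minus minus_diff_eq)
  show "transp lattice_rel"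
    unfolding transp_def lattice_rel_def
  proof (intro allI impI)
    fix x y z :: "real^'n" and i
    assume "\<forall>i. x $ i - y $ i \<in> \<int>" "\<forall>i. y $ i - z $ i \<in> \<int>"
    then have "(x $ i - y $ i) + (y $ i - z $ i) \<in> \<int>"
      by (intro Ints_add) auto
    then show "x $ i - z $ i \<in> \<int>" by simp
  qed
qed

quotient_type 'n torus = "real^'n" / "lattice_rel :: real^'n \<Rightarrow> real^'n \<Rightarrow> bool"
  morphisms torus_rep proj
  by (rule equivp_lattice_rel)

instantiation torus :: (finite) topological_space
begin

definition open_torus :: "'a torus set \<Rightarrow> bool" where
  "open_torus W \<longleftrightarrow> open (proj -` W)"

instance
proof
  show "open (UNIV :: 'a torus set)"
    by (simp add: open_torus_def)
  show "open (S \<inter> T)" if "open S" "open T" for S T :: "'a torus set"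
    using that by (simp add: open_torus_def open_Int)
  show "open (\<Union>K)" if "\<forall>S\<in>K. open S" for K :: "'a torus set set"
    using that by (simp add: open_torus_def vimage_Union open_UN)
qed

end

text \<open>
  The cotangent bundle of the torus is trivialised by the coordinate coframe
  \<open>dq_1, ..., dq_n\<close>: a covector is its list of components, and the pairing with a vector is the
  inner product of \<open>R^n\<close>.  The cotangent bundle of \<open>R^n\<close> covers it.
\<close>

type_synonym 'n cotangent_torus = "'n torus \<times> (real^'n)"

definition cotangent_proj :: "(real^'n) \<times> (real^'n) \<Rightarrow> 'n cotangent_torus" where
  "cotangent_proj = map_prod proj id"

section \<open>Smooth maps and pullbacks\<close>

text \<open>\<open>C^k\<close> functions; only meaningful on open sets \<open>U\<close>.\<close>

fun Ck_on :: "nat \<Rightarrow> 'a::euclidean_space set \<Rightarrow> ('a \<Rightarrow> 'b::real_normed_vector) \<Rightarrow> bool" where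
  "Ck_on 0 U f \<longleftrightarrow> continuous_on U f"
| "Ck_on (Suc k) U f \<longleftrightarrow>
     f differentiable_on U \<and> (\<forall>v. Ck_on k U (\<lambda>x. frechet_derivative f (at x) v))"

definition smooth_on :: "'a::euclidean_space set \<Rightarrow> ('a \<Rightarrow> 'b::real_normed_vector) \<Rightarrow> bool" where
  "smooth_on U f \<longleftrightarrow> (\<forall>k. Ck_on k U f)"

text \<open>
  The smooth structures on the torus and on its cotangent bundle are those for which the coverings
  \<^term>\<open>proj\<close> and \<^term>\<open>cotangent_proj\<close> are local diffeomorphisms.  Accordingly,
  maps between quotients with coverings \<open>p\<close> and \<open>p'\<close> are treated through their local
  expressions \<open>F\<close>, and tensor fields through their pullbacks to the covering space.
\<close>

definition local_expr ::
  "('e::euclidean_space \<Rightarrow> 'x) \<Rightarrow> ('f::euclidean_space \<Rightarrow> 'y) \<Rightarrow> ('x \<Rightarrow> 'y) \<Rightarrow>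
   'e set \<Rightarrow> ('e \<Rightarrow> 'f) \<Rightarrow> bool" where
  "local_expr p p' \<Phi> U F \<longleftrightarrow> open U \<and> smooth_on U F \<and> (\<forall>y\<in>U. \<Phi> (p y) = p' (F y))"

definition smooth_map ::
  "('e::euclidean_space \<Rightarrow> 'x) \<Rightarrow> ('f::euclidean_space \<Rightarrow> 'y) \<Rightarrow> ('x \<Rightarrow> 'y) \<Rightarrow> bool" where
  "smooth_map p p' \<Phi> \<longleftrightarrow> (\<forall>x. \<exists>U F. x \<in> U \<and> local_expr p p' \<Phi> U F)"

definition diffeomorphism ::
  "('e::euclidean_space \<Rightarrow> 'x) \<Rightarrow> ('f::euclidean_space \<Rightarrow> 'y) \<Rightarrow> ('x \<Rightarrow> 'y) \<Rightarrow> bool" where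
  "diffeomorphism p p' \<Phi> \<longleftrightarrow> bij \<Phi> \<and> smooth_map p p' \<Phi> \<and> smooth_map p' p (inv_into UNIV \<Phi>)"

type_synonym 'v tensor2 = "'v \<Rightarrow> 'v \<Rightarrow> real"

text \<open>The pullback of the 2-tensor field \<open>\<tau>'\<close> along the smooth map \<open>\<Phi>\<close> is \<open>\<tau>\<close>.\<close>

definition pulls_back ::
  "('e::euclidean_space \<Rightarrow> 'x) \<Rightarrow> ('f::euclidean_space \<Rightarrow> 'y) \<Rightarrow> ('x \<Rightarrow> 'y) \<Rightarrow>
   ('f \<Rightarrow> 'f tensor2) \<Rightarrow> ('e \<Rightarrow> 'e tensor2) \<Rightarrow> bool" where
  "pulls_back p p' \<Phi> \<tau>' \<tau> \<longleftrightarrow>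
     (\<forall>U F. local_expr p p' \<Phi> U F \<longrightarrow>
       (\<forall>x\<in>U. \<forall>u v.
          \<tau>' (F x) (frechet_derivative F (at x) u) (frechet_derivative F (at x) v) = \<tau> x u v))"

text \<open>Exterior derivative of a real- or complex-valued 1-form \<open>\<alpha>\<close> on a vector space.\<close>

definition ext_deriv ::
  "('e::euclidean_space \<Rightarrow> 'e \<Rightarrow> 'b::real_normed_vector) \<Rightarrow> 'e \<Rightarrow> 'e \<Rightarrow> 'e \<Rightarrow> 'b" where
  "ext_deriv \<alpha> x u v =
     frechet_derivative (\<lambda>y. \<alpha> y v) (at x) u - frechet_derivative (\<lambda>y. \<alpha> y u) (at x) v"

section \<open>Translation-invariant metrics and symplectic structures\<close>

definition flat_metric :: "(real^'n) tensor2 \<Rightarrow> bool" where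
  "flat_metric h \<longleftrightarrow> bilinear h \<and> (\<forall>u v. h u v = h v u) \<and> (\<forall>u. u \<noteq> 0 \<longrightarrow> h u u > 0)"

text \<open>Closedness is automatic for translation-invariant forms.\<close>

definition symplectic_form :: "(real^'n) tensor2 \<Rightarrow> bool" where
  "symplectic_form \<omega> \<longleftrightarrow>
     bilinear \<omega> \<and> (\<forall>u. \<omega> u u = 0) \<and> (\<forall>u. (\<forall>v. \<omega> u v = 0) \<longrightarrow> u = 0)"

definition isometric :: "(real^'n) tensor2 \<Rightarrow> (real^'n) tensor2 \<Rightarrow> bool" where
  "isometric h1 h2 \<longleftrightarrow>
     (\<exists>\<Phi> :: 'n torus \<Rightarrow> 'n torus.
        diffeomorphism proj proj \<Phi> \<and> pulls_back proj proj \<Phi> (\<lambda>_. h2) (\<lambda>_. h1))"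

text \<open>
  The vector \<open>h\<close>-dual to a covector \<open>\<xi>\<close>, and the induced inner product on covectors; its values
  on the standard basis are the entries of the inverse Gram matrix of \<open>h\<close>.
\<close>

definition sharp :: "(real^'n) tensor2 \<Rightarrow> real^'n \<Rightarrow> real^'n" where
  "sharp h \<xi> = (THE u. \<forall>v. h u v = \<xi> \<bullet> v)"

definition cometric :: "(real^'n) tensor2 \<Rightarrow> (real^'n) tensor2" where
  "cometric h \<xi> \<eta> = h (sharp h \<xi>) (sharp h \<eta>)"

section \<open>Classical equivalence\<close>

text \<open>Canonical 1-form at the point \<open>(q, \<xi>)\<close>, evaluated on a tangent vector \<open>w\<close>.\<close>

definition canonical_form :: "(real^'n) \<times> (real^'n) \<Rightarrow> (real^'n) \<times> (real^'n) \<Rightarrow> real" where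
  "canonical_form x w = snd x \<bullet> fst w"

definition magnetic_form ::
  "(real^'n) tensor2 \<Rightarrow> (real^'n) \<times> (real^'n) \<Rightarrow> ((real^'n) \<times> (real^'n)) tensor2" where
  "magnetic_form \<omega> x w w' = - ext_deriv canonical_form x w w' + \<omega> (fst w) (fst w')"

definition hamiltonian :: "(real^'n) tensor2 \<Rightarrow> 'n cotangent_torus \<Rightarrow> real" where
  "hamiltonian h x = 1/2 * cometric h (snd x) (snd x)"

definition symplectomorphism ::
  "(real^'n) tensor2 \<Rightarrow> (real^'n) tensor2 \<Rightarrow> ('n cotangent_torus \<Rightarrow> 'n cotangent_torus) \<Rightarrow> bool"
  where
  "symplectomorphism \<omega>1 \<omega>2 \<Phi> \<longleftrightarrow>
     diffeomorphism cotangent_proj cotangent_proj \<Phi> \<and>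
     pulls_back cotangent_proj cotangent_proj \<Phi> (magnetic_form \<omega>2) (magnetic_form \<omega>1)"

definition classically_equivalent ::
  "(real^'n) tensor2 \<Rightarrow> (real^'n) tensor2 \<Rightarrow> (real^'n) tensor2 \<Rightarrow> (real^'n) tensor2 \<Rightarrow> bool" where
  "classically_equivalent h1 \<omega>1 h2 \<omega>2 \<longleftrightarrow>
     (\<exists>\<Phi>. symplectomorphism \<omega>1 \<omega>2 \<Phi> \<and> (\<forall>x. hamiltonian h1 x = hamiltonian h2 (\<Phi> x)))"

section \<open>Integer cohomology classes\<close>

text \<open>
  A de Rham class is integral iff its periods over smooth singular 2-cycles with integer
  coefficients are integers.  A singular simplex of the torus is smooth iff it is covered by a
  smooth map \<open>F\<close>, here written in the affine coordinates \<open>(t 1, t 2)\<close> of the standard 2-simplex.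
\<close>

definition simplex_lift :: "((nat \<Rightarrow> real) \<Rightarrow> 'n torus) \<Rightarrow> (real \<times> real \<Rightarrow> real^'n) \<Rightarrow> bool" where
  "simplex_lift \<sigma> F \<longleftrightarrow>
     smooth_on UNIV F \<and> (\<forall>t\<in>standard_simplex 2. \<sigma> t = proj (F (t 1, t 2)))"

definition simplex_integral :: "(real^'n) tensor2 \<Rightarrow> (real \<times> real \<Rightarrow> real^'n) \<Rightarrow> real" where
  "simplex_integral \<omega> F =
     integral {(x, y). 0 \<le> x \<and> 0 \<le> y \<and> x + y \<le> 1}
       (\<lambda>p. \<omega> (frechet_derivative F (at p) (1, 0)) (frechet_derivative F (at p) (0, 1)))"

definition integral_class :: "(real^'n) tensor2 \<Rightarrow> bool" where
  "integral_class \<omega> \<longleftrightarrow>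
     (\<forall>(c :: 'n torus chain) F.
        singular_relcycle 2 euclidean {} c \<and> (\<forall>\<sigma>\<in>Poly_Mapping.keys c. simplex_lift \<sigma> (F \<sigma>)) \<longrightarrow>
        (\<Sum>\<sigma>\<in>Poly_Mapping.keys c.
           of_int (Poly_Mapping.lookup c \<sigma>) * simplex_integral \<omega> (F \<sigma>)) \<in> \<int>)"

section \<open>Hermitian line bundles, connections and the quantum Hamiltonians\<close>

text \<open>
  A Hermitian line bundle \<open>L\<close> on the torus is given by an open cover \<open>U\<close> with unitary frames and
  the transition functions \<open>g\<close> between them.  Without loss of generality the cover is indexed
  by the points of the torus, \<open>U a\<close> being a neighbourhood of \<open>a\<close>.  A section is a family of
  functions \<open>s a\<close> on \<open>U a\<close> (extended by 0) with \<open>s a = g a b * s b\<close> on overlaps.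
\<close>

type_synonym 'n cover = "'n torus \<Rightarrow> 'n torus set"
type_synonym 'n transition = "'n torus \<Rightarrow> 'n torus \<Rightarrow> 'n torus \<Rightarrow> complex"
type_synonym 'n connection = "'n torus \<Rightarrow> 'n torus \<Rightarrow> real^'n \<Rightarrow> complex"
type_synonym 'n lb_section = "'n torus \<Rightarrow> 'n torus \<Rightarrow> complex"

definition torus_smooth_on :: "'n::finite torus set \<Rightarrow> ('n torus \<Rightarrow> complex) \<Rightarrow> bool" where
  "torus_smooth_on W f \<longleftrightarrow> smooth_on (proj -` W) (\<lambda>y. f (proj y))"

text \<open>Derivative at \<open>x\<close> in the direction of the translation-invariant vector field \<open>v\<close>.\<close>

definition torus_deriv :: "('n torus \<Rightarrow> complex) \<Rightarrow> 'n torus \<Rightarrow> real^'n \<Rightarrow> complex" where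
  "torus_deriv f x v = frechet_derivative (\<lambda>y. f (proj y)) (at (torus_rep x)) v"

definition hermitian_line_bundle :: "'n::finite cover \<Rightarrow> 'n transition \<Rightarrow> bool" where
  "hermitian_line_bundle U g \<longleftrightarrow>
     (\<forall>a. open (U a) \<and> a \<in> U a) \<and>
     (\<forall>a b. torus_smooth_on (U a \<inter> U b) (g a b)) \<and>
     (\<forall>a b. \<forall>x\<in>U a \<inter> U b. cmod (g a b x) = 1) \<and>
     (\<forall>a b c. \<forall>x\<in>U a \<inter> U b \<inter> U c. g a b x * g b c x = g a c x)"

text \<open>
  A connection is given by 1-forms \<open>\<theta> a\<close> on \<open>U a\<close>, acting by \<open>d + \<theta> a\<close> in the frame over \<open>U a\<close>.
  It is Hermitian iff they are purely imaginary.
\<close>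

definition hermitian_connection :: "'n::finite cover \<Rightarrow> 'n transition \<Rightarrow> 'n connection \<Rightarrow> bool" where
  "hermitian_connection U g \<theta> \<longleftrightarrow>
     (\<forall>a. \<forall>x\<in>U a. linear (\<theta> a x)) \<and>
     (\<forall>a v. torus_smooth_on (U a) (\<lambda>x. \<theta> a x v)) \<and>
     (\<forall>a. \<forall>x\<in>U a. \<forall>v. Re (\<theta> a x v) = 0) \<and>
     (\<forall>a b. \<forall>x\<in>U a \<inter> U b. \<forall>v. \<theta> b x v = \<theta> a x v + torus_deriv (g a b) x v / g a b x)"

definition has_curvature :: "'n::finite cover \<Rightarrow> 'n connection \<Rightarrow> (real^'n \<Rightarrow> real^'n \<Rightarrow> complex) \<Rightarrow> bool"
  where
  "has_curvature U \<theta> K \<longleftrightarrow>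
     (\<forall>a y. proj y \<in> U a \<longrightarrow> (\<forall>u v. ext_deriv (\<lambda>z. \<theta> a (proj z)) y u v = K u v))"

text \<open>
  The Chern class of \<open>L\<close> is represented by \<open>i/(2\<pi>)\<close> times the curvature of any Hermitian
  connection, so curvature \<open>-2\<pi>i\<omega>\<close> says in particular that it is the class of \<open>\<omega>\<close>.
\<close>

definition prequantum_bundle ::
  "(real^'n) tensor2 \<Rightarrow> 'n cover \<Rightarrow> 'n transition \<Rightarrow> 'n connection \<Rightarrow> bool" where
  "prequantum_bundle \<omega> U g \<theta> \<longleftrightarrow>
     hermitian_line_bundle U g \<and> hermitian_connection U g \<theta> \<and>
     has_curvature U \<theta> (\<lambda>u v. - 2 * of_real pi * \<i> * of_real (\<omega> u v))"

definition transition_power :: "nat \<Rightarrow> 'n transition \<Rightarrow> 'n transition" where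
  "transition_power k g = (\<lambda>a b x. g a b x ^ k)"

definition connection_power :: "nat \<Rightarrow> 'n connection \<Rightarrow> 'n connection" where
  "connection_power k \<theta> = (\<lambda>a x v. of_nat k * \<theta> a x v)"

definition smooth_sections :: "'n::finite cover \<Rightarrow> 'n transition \<Rightarrow> 'n lb_section set" where
  "smooth_sections U g = {s.
     (\<forall>a. torus_smooth_on (U a) (s a)) \<and>
     (\<forall>a b. \<forall>x\<in>U a \<inter> U b. s a x = g a b x * s b x) \<and>
     (\<forall>a. \<forall>x. x \<notin> U a \<longrightarrow> s a x = 0)}"

definition cov_deriv ::
  "'n::finite cover \<Rightarrow> 'n connection \<Rightarrow> real^'n \<Rightarrow> 'n lb_section \<Rightarrow> 'n lb_section" where
  "cov_deriv U \<theta> v s =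
     (\<lambda>a x. if x \<in> U a then torus_deriv (s a) x v + \<theta> a x v * s a x else 0)"

text \<open>
  Translation-invariant vector fields are parallel for the Levi-Civita connection of a flat metric,
  so the second covariant derivative in the directions \<open>u\<close>, \<open>v\<close> is the iterated derivative.
\<close>

definition bochner_laplacian ::
  "(real^'n) tensor2 \<Rightarrow> 'n cover \<Rightarrow> 'n connection \<Rightarrow> 'n lb_section \<Rightarrow> 'n lb_section" where
  "bochner_laplacian h U \<theta> s =
     (\<lambda>a x. - (\<Sum>u\<in>Basis. \<Sum>v\<in>Basis.
        of_real (cometric h u v) * cov_deriv U \<theta> u (cov_deriv U \<theta> v s) a x))"

definition quantum_hamiltonian ::
  "nat \<Rightarrow> (real^'n) tensor2 \<Rightarrow> 'n cover \<Rightarrow> 'n connection \<Rightarrow> 'n lb_section \<Rightarrow> 'n lb_section" where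
  "quantum_hamiltonian k h U \<theta> s =
     (\<lambda>a x. of_real ((1 / real k)\<^sup>2 / 2) *
        bochner_laplacian h U (connection_power k \<theta>) s a x)"

definition eigenspace ::
  "nat \<Rightarrow> (real^'n) tensor2 \<Rightarrow> 'n cover \<Rightarrow> 'n transition \<Rightarrow> 'n connection \<Rightarrow>
   complex \<Rightarrow> 'n lb_section set" where
  "eigenspace k h U g \<theta> E = {s \<in> smooth_sections U (transition_power k g).
     \<forall>a x. quantum_hamiltonian k h U \<theta> s a x = E * s a x}"

text \<open>The spectrum as the set of all eigenvalues, paired with their complex multiplicities.\<close>

definition spectrum ::
  "nat \<Rightarrow> (real^'n) tensor2 \<Rightarrow> 'n cover \<Rightarrow> 'n transition \<Rightarrow> 'n connection \<Rightarrow>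
   (complex \<times> nat) set" where
  "spectrum k h U g \<theta> =
     {(E, vector_space.dim (\<lambda>c s a x. c * s a x) (eigenspace k h U g \<theta> E)) |E.
        eigenspace k h U g \<theta> E \<noteq> {0}}"

text \<open>
  The spectra do not depend on the chosen bundles and connections; the definition quantifies
  over all choices.
\<close>

definition quantum_equivalent ::
  "(real^'n) tensor2 \<Rightarrow> (real^'n) tensor2 \<Rightarrow> (real^'n) tensor2 \<Rightarrow> (real^'n) tensor2 \<Rightarrow> bool" where
  "quantum_equivalent h1 \<omega>1 h2 \<omega>2 \<longleftrightarrow>
     (\<forall>U1 g1 \<theta>1 U2 g2 \<theta>2.
        prequantum_bundle \<omega>1 U1 g1 \<theta>1 \<and> prequantum_bundle \<omega>2 U2 g2 \<theta>2 \<longrightarrow>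
        (\<forall>k\<ge>1. spectrum k h1 U1 g1 \<theta>1 = spectrum k h2 U2 g2 \<theta>2))"

end

theory Submission
  imports Defs "HOL-Library.Nat_Bijection"
begin

text \<open>
  For a lattice vector \<open>w\<close>, the transvections \<open>A\<^sub>t v = v + t \<omega>(v, w) w\<close> preserve \<open>\<omega>\<close>; the family
  is \<open>h\<^sub>t = A\<^sub>t\<^sup>* h\<close>.  An isometry between flat tori lifts to an affine map preserving the
  lattice, so the length of the shortest lattice vectors is an isometry invariant; \<open>w\<close> is chosen
  such that this length is strictly decreasing for small \<open>t \<ge> 0\<close>.

  The classical equivalence is the flow on the cotangent bundle generated by \<open>(\<xi> \<bullet> w)\<^sup>2 / 2\<close>.
  Its quantum analogue is the unitary group generated by \<open>\<nabla>\<^sub>w\<^sup>2\<close>, which intertwines \<open>\<nabla>\<^sub>v\<close> and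
  \<open>\<nabla>\<close> in direction \<open>A\<^sub>t v\<close> because the curvature is constant.  As the orbits of \<open>w\<close> on the torus
  are closed, it is given by Fourier series along these loops, which remain convergent on smooth
  sections.  Finally, two prequantum bundles with the same curvature differ by a character of the
  lattice, and hence by a translation since \<open>\<omega>\<close> is nondegenerate.
\<close>

section \<open>Smooth functions\<close>

text \<open>The map \<open>A\<^sub>t\<close> need not preserve the lattice, and for small
  \<open>t > 0\<close> no diffeomorphism of the torus carries \<open>h\<close> to
  \<open>h\<^sub>t\<close>; both equivalences must therefore mix positions with momenta.
  Classically, the shear adds \<open>t (\<xi> \<bullet> w) w\<close> to the base point, which makes
  sense modulo the lattice. On the quantum side the momentum along \<open>w\<close> is discrete:
  with \<open>\<beta> = k \<omega>\<close> and a holonomy phase \<open>\<gamma>\<close>,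
  \<open>\<nabla>\<^sub>w\<close> acts on the \<open>n\<close>-th Fourier mode of the loop through
  \<open>x\<close> as \<open>2 pi i u\<close>, where
  \<open>u = n + \<gamma> - \<beta>(x, w)\<close>. The propagator multiplies this mode by
  \<open>cis (r u\<^sup>2)\<close>. Differentiating the phase in direction \<open>v\<close> yields
  \<open>- (r / pi) \<beta>(v, w)\<close> times the mode of \<open>\<nabla>\<^sub>w f\<close>, which
  is exactly the correction made by a transvection; matching it with \<open>A\<^sub>t\<close> gives
  \<open>r = - pi t / k\<close>. That \<open>\<beta>(z, w)\<close> is an integer for lattice vectors
  \<open>z\<close>, so that translation by \<open>z\<close> shifts \<open>n\<close>, is read off
  from the bundle: the multipliers of its parallel frame satisfy a twisted cocycle identity.\<close>

lemma frechet_derivative_eqI: "(f has_derivative f') (at x) \<Longrightarrow> frechet_derivative f (at x) = f'"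
  by (metis frechet_derivative_at)

text \<open>\<open>frechet_derivative\<close> chooses one of the derivatives of its argument. The
  two functions have the same derivatives at \<open>x\<close>, so the choices coincide, also where
  there is no derivative.\<close>

lemma frechet_derivative_cong_open:
  assumes "open U" "x \<in> U" "\<And>y. y \<in> U \<Longrightarrow> f y = g y"
  shows "frechet_derivative f (at x) = frechet_derivative g (at x)"
proof -
  have "(f has_derivative D) (at x) \<longleftrightarrow> (g has_derivative D) (at x)" for D
    using assms has_derivative_transform_within_open[of f D x UNIV U g]
      has_derivative_transform_within_open[of g D x UNIV U f] by auto
  then show ?thesis by (simp add: frechet_derivative_def)
qed

lemma has_frechet_derivative:
  assumes "f differentiable_on U" "open U" "x \<in> U"
  shows "(f has_derivative frechet_derivative f (at x)) (at x)"
  using assms frechet_derivative_works differentiable_on_eq_differentiable_at by blast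

lemma Ck_on_cong:
  assumes "open U" "\<And>y. y \<in> U \<Longrightarrow> f y = g y"
  shows "Ck_on k U f \<longleftrightarrow> Ck_on k U g"
  using assms(2)
proof (induction k arbitrary: f g)
  case 0
  then show ?case by (simp cong: continuous_on_cong)
next
  case (Suc k)
  have D: "frechet_derivative f (at x) v = frechet_derivative g (at x) v" if "x \<in> U" for x v
    by (simp add: frechet_derivative_cong_open[OF assms(1) that Suc.prems])
  have "Ck_on k U (\<lambda>x. frechet_derivative f (at x) v) \<longleftrightarrow> Ck_on k U (\<lambda>x. frechet_derivative g (at x) v)"
    for v by (rule Suc.IH) (rule D)
  moreover have "f differentiable_on U \<longleftrightarrow> g differentiable_on U"
    using Suc.prems by (auto simp: differentiable_on_def intro: differentiable_transform_within[of _ _ _ 1])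
  ultimately show ?case by simp
qed

lemma Ck_on_SucD: "Ck_on (Suc k) U f \<Longrightarrow> Ck_on k U f"
proof (induction k arbitrary: f)
  case 0
  then show ?case by (auto intro: differentiable_imp_continuous_on)
next
  case (Suc k)
  then show ?case by (metis Ck_on.simps(2))
qed

lemma Ck_on_subset: "open V \<Longrightarrow> V \<subseteq> U \<Longrightarrow> Ck_on k U f \<Longrightarrow> Ck_on k V f"
  by (induction k arbitrary: f) (auto intro: continuous_on_subset differentiable_on_subset)

text \<open>Replaces the chosen \<open>frechet_derivative\<close> by an explicit formula
  \<open>f'\<close>. Most closure properties of \<open>Ck_on\<close> below are inductions on
  \<open>k\<close> through this rule.\<close>

lemma Ck_on_SucI:
  assumes "open U" "\<And>x. x \<in> U \<Longrightarrow> (f has_derivative f' x) (at x)" "\<And>v. Ck_on k U (\<lambda>x. f' x v)"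
  shows "Ck_on (Suc k) U f"
proof -
  have "f differentiable_on U"
    using assms(1,2) by (auto simp: differentiable_on_eq_differentiable_at differentiable_def)
  moreover have "Ck_on k U (\<lambda>x. frechet_derivative f (at x) v)" for v
    using assms(3)[of v] Ck_on_cong[OF assms(1), of "\<lambda>x. frechet_derivative f (at x) v" "\<lambda>x. f' x v" k]
      frechet_derivative_eqI[OF assms(2)] by metis
  ultimately show ?thesis by simp
qed

lemma Ck_on_const: "open U \<Longrightarrow> Ck_on k U (\<lambda>x. c)"
proof (induction k arbitrary: c)
  case (Suc k)
  show ?case by (rule Ck_on_SucI[of _ _ "\<lambda>x v. 0"]) (use Suc in \<open>auto intro!: derivative_eq_intros\<close>)
qed auto

lemma Ck_on_linear:
  assumes "open U" "bounded_linear L" shows "Ck_on k U L"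
proof (cases k)
  case 0
  then show ?thesis using assms linear_continuous_on by auto
next
  case (Suc j)
  show ?thesis unfolding Suc
    by (rule Ck_on_SucI[of _ _ "\<lambda>x. L"])
      (use assms in \<open>auto intro!: bounded_linear_imp_has_derivative Ck_on_const\<close>)
qed

lemma Ck_on_add:
  assumes "open U"
  shows "Ck_on k U f \<Longrightarrow> Ck_on k U g \<Longrightarrow> Ck_on k U (\<lambda>x. f x + g x)"
proof (induction k arbitrary: f g)
  case 0
  then show ?case by (auto intro: continuous_on_add)
next
  case (Suc k)
  show ?case
    by (rule Ck_on_SucI[OF assms, of _ "\<lambda>x v. frechet_derivative f (at x) v + frechet_derivative g (at x) v"])
      (use Suc assms in \<open>auto intro!: has_derivative_add has_frechet_derivative\<close>)
qed

lemma Ck_on_compose_linear: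
  assumes "open U" "bounded_linear L"
  shows "Ck_on k U f \<Longrightarrow> Ck_on k U (\<lambda>x. L (f x))"
proof (induction k arbitrary: f)
  case 0
  then show ?case using assms by (auto intro: bounded_linear.continuous_on)
next
  case (Suc k)
  show ?case
    by (rule Ck_on_SucI[OF assms(1), of _ "\<lambda>x v. L (frechet_derivative f (at x) v)"])
      (use Suc assms in \<open>auto intro!: bounded_linear.has_derivative[OF assms(2)] has_frechet_derivative\<close>)
qed

lemma Ck_on_mult:
  fixes f g :: "'a::euclidean_space \<Rightarrow> 'b::real_normed_algebra"
  assumes "open U"
  shows "Ck_on k U f \<Longrightarrow> Ck_on k U g \<Longrightarrow> Ck_on k U (\<lambda>x. f x * g x)"
proof (induction k arbitrary: f g)
  case 0
  then show ?case by (auto intro: continuous_on_mult)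
next
  case (Suc k)
  show ?case
  proof (rule Ck_on_SucI[OF assms, of _ "\<lambda>x v. f x * frechet_derivative g (at x) v + frechet_derivative f (at x) v * g x"])
    \<comment> \<open>The Leibniz rule multiplies a C^k derivative by an undifferentiated C^(k+1)
      factor; \<open>Ck_on_SucD\<close> lowers the latter so that the induction hypothesis applies
      to the product.\<close>
    show "Ck_on k U (\<lambda>x. f x * frechet_derivative g (at x) v + frechet_derivative f (at x) v * g x)" for v
      using Suc.prems Ck_on_SucD[OF Suc.prems(1)] Ck_on_SucD[OF Suc.prems(2)]
      by (intro Ck_on_add[OF assms] Suc.IH) simp_all
  qed (use Suc assms in \<open>auto intro!: has_derivative_mult has_frechet_derivative\<close>)
qed

lemma Ck_on_translate:
  assumes "open U" "open V" "\<And>x. x \<in> U \<Longrightarrow> x + a \<in> V"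
  shows "Ck_on k V f \<Longrightarrow> Ck_on k U (\<lambda>x. f (x + a))"
proof (induction k arbitrary: f)
  case 0
  then show ?case using assms
    by (auto intro!: continuous_on_compose2[of V f U "\<lambda>x. x + a"] continuous_intros)
next
  case (Suc k)
  show ?case
  proof (rule Ck_on_SucI[OF assms(1), of _ "\<lambda>x. frechet_derivative f (at (x + a))"])
    fix x assume "x \<in> U"
    then have "(f has_derivative frechet_derivative f (at (x + a))) (at (x + a))"
      using Suc.prems assms by (auto intro!: has_frechet_derivative)
    moreover have "((\<lambda>x. x + a) has_derivative (\<lambda>v. v)) (at x)"
      by (auto intro!: derivative_eq_intros)
    ultimately show "((\<lambda>x. f (x + a)) has_derivative frechet_derivative f (at (x + a))) (at x)"
      using has_derivative_compose[of "\<lambda>x. x + a" "\<lambda>v. v" x UNIV f] by simp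
  next
    show "Ck_on k U (\<lambda>x. frechet_derivative f (at (x + a)) v)" for v
      using Suc.IH[of "\<lambda>x. frechet_derivative f (at x) v"] Suc.prems by simp
  qed
qed

lemma smooth_on_cong:
  "open U \<Longrightarrow> (\<And>y. y \<in> U \<Longrightarrow> f y = g y) \<Longrightarrow> smooth_on U f \<longleftrightarrow> smooth_on U g"
  unfolding smooth_on_def by (intro all_cong1 Ck_on_cong)

lemma smooth_on_differentiable: "smooth_on U f \<Longrightarrow> f differentiable_on U"
  unfolding smooth_on_def by (metis Ck_on.simps(2))

lemma smooth_on_has_derivative:
  "smooth_on U f \<Longrightarrow> open U \<Longrightarrow> x \<in> U \<Longrightarrow> (f has_derivative frechet_derivative f (at x)) (at x)"
  by (intro has_frechet_derivative smooth_on_differentiable)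

lemma smooth_on_continuous: "smooth_on U f \<Longrightarrow> continuous_on U f"
  unfolding smooth_on_def by (metis Ck_on.simps(1))

lemma smooth_on_derivative: "smooth_on U f \<Longrightarrow> smooth_on U (\<lambda>x. frechet_derivative f (at x) v)"
  unfolding smooth_on_def by (metis Ck_on.simps(2))

lemma smooth_on_subset: "open V \<Longrightarrow> V \<subseteq> U \<Longrightarrow> smooth_on U f \<Longrightarrow> smooth_on V f"
  unfolding smooth_on_def using Ck_on_subset by blast

lemma smooth_on_const: "open U \<Longrightarrow> smooth_on U (\<lambda>x. c)"
  unfolding smooth_on_def using Ck_on_const by blast

lemma smooth_on_linear: "open U \<Longrightarrow> bounded_linear L \<Longrightarrow> smooth_on U L"
  unfolding smooth_on_def using Ck_on_linear by blast

lemma smooth_on_add: "open U \<Longrightarrow> smooth_on U f \<Longrightarrow> smooth_on U g \<Longrightarrow> smooth_on U (\<lambda>x. f x + g x)"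
  unfolding smooth_on_def using Ck_on_add by blast

lemma smooth_on_compose_linear:
  "open U \<Longrightarrow> bounded_linear L \<Longrightarrow> smooth_on U f \<Longrightarrow> smooth_on U (\<lambda>x. L (f x))"
  unfolding smooth_on_def using Ck_on_compose_linear by blast

lemma smooth_on_mult:
  fixes f g :: "'a::euclidean_space \<Rightarrow> 'b::real_normed_algebra"
  shows "open U \<Longrightarrow> smooth_on U f \<Longrightarrow> smooth_on U g \<Longrightarrow> smooth_on U (\<lambda>x. f x * g x)"
  unfolding smooth_on_def using Ck_on_mult by blast

lemma smooth_on_diff:
  assumes "open U" "smooth_on U f" "smooth_on U g" shows "smooth_on U (\<lambda>x. f x - g x)"
  using smooth_on_add[OF assms(1,2) smooth_on_compose_linear[OF assms(1) bounded_linear_minus[OF bounded_linear_ident] assms(3)]]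
  by simp

lemma smooth_on_power:
  fixes f :: "'a::euclidean_space \<Rightarrow> 'b::real_normed_algebra_1"
  shows "open U \<Longrightarrow> smooth_on U f \<Longrightarrow> smooth_on U (\<lambda>x. f x ^ k)"
  by (induction k) (auto intro: smooth_on_const smooth_on_mult)

lemma smooth_on_translate:
  assumes "open U" "open V" "\<And>x. x \<in> U \<Longrightarrow> x + a \<in> V" "smooth_on V f"
  shows "smooth_on U (\<lambda>x. f (x + a))"
  using assms Ck_on_translate unfolding smooth_on_def by blast

text \<open>Bootstrapping: if \<open>f\<close> is C^k, then so is its derivative
  \<open>p v x * f x\<close>, hence \<open>f\<close> is C^(k+1). This yields the smoothness of
  exponentials of linear forms and of parallel frames without composing smooth maps.\<close>

lemma smooth_on_linear_system:
  fixes f :: "'a::euclidean_space \<Rightarrow> 'b::real_normed_algebra"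
  assumes U: "open U" and f: "\<And>x. x \<in> U \<Longrightarrow> (f has_derivative (\<lambda>v. p v x * f x)) (at x)"
    and p: "\<And>v. smooth_on U (p v)"
  shows "smooth_on U f"
  unfolding smooth_on_def
proof
  fix k show "Ck_on k U f"
  proof (induction k)
    case 0
    show ?case using f by (auto intro!: continuous_at_imp_continuous_on has_derivative_continuous)
  next
    case (Suc k)
    show ?case
      by (rule Ck_on_SucI[OF U f])
        (use p Suc in \<open>auto intro!: Ck_on_mult U simp: smooth_on_def\<close>)
  qed
qed

lemma smooth_on_local:
  assumes "\<And>x. x \<in> U \<Longrightarrow> \<exists>V. open V \<and> x \<in> V \<and> V \<subseteq> U \<and> smooth_on V f"
  shows "smooth_on U f"
proof -
  have loc: "Ck_on k U f" if "\<And>x. x \<in> U \<Longrightarrow> \<exists>V. open V \<and> x \<in> V \<and> V \<subseteq> U \<and> Ck_on k V f" for k f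
    using that
  proof (induction k arbitrary: f)
    case 0
    show ?case unfolding Ck_on.simps
    proof (rule continuous_at_imp_continuous_on, rule ballI)
      fix x assume "x \<in> U"
      then show "isCont f x"
        using 0[of x] by (auto simp: continuous_on_eq_continuous_at)
    qed
  next
    case (Suc k)
    have "f differentiable_on U"
      unfolding differentiable_on_def
    proof
      fix x assume "x \<in> U"
      then show "f differentiable (at x within U)"
        using Suc.prems[of x] by (auto simp: differentiable_on_eq_differentiable_at intro: differentiable_at_withinI)
    qed
    moreover have "Ck_on k U (\<lambda>x. frechet_derivative f (at x) v)" for v
      by (rule Suc.IH) (use Suc.prems in fastforce)
    ultimately show ?case by simp
  qed
  show ?thesis unfolding smooth_on_def
  proof
    fix k show "Ck_on k U f"
    proof (rule loc)
      fix x assume "x \<in> U"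
      then obtain V where "open V \<and> x \<in> V \<and> V \<subseteq> U \<and> smooth_on V f" using assms by blast
      then show "\<exists>V. open V \<and> x \<in> V \<and> V \<subseteq> U \<and> Ck_on k V f" unfolding smooth_on_def by blast
    qed
  qed
qed

section \<open>Symplectic transvections and classical equivalence\<close>

definition transvection :: "(real^'n) tensor2 \<Rightarrow> real^'n \<Rightarrow> real \<Rightarrow> real^'n \<Rightarrow> real^'n" where
  "transvection \<omega> w t v = v + (t * \<omega> v w) *\<^sub>R w"

definition transvected :: "(real^'n) tensor2 \<Rightarrow> real^'n \<Rightarrow> (real^'n) tensor2 \<Rightarrow> real \<Rightarrow> (real^'n) tensor2" where
  "transvected \<omega> w h t u v = h (transvection \<omega> w t u) (transvection \<omega> w t v)"

lemma symplectic_formD: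
  assumes "symplectic_form \<omega>"
  shows "bilinear \<omega>" "\<omega> u u = 0" "\<omega> u v = - \<omega> v u" "(\<And>v. \<omega> u v = 0) \<Longrightarrow> u = 0"
proof -
  show b: "bilinear \<omega>" and z: "\<omega> u u = 0" for u
    using assms by (auto simp: symplectic_form_def)
  have "\<omega> (u + v) (u + v) = 0" by (rule z)
  then show "\<omega> u v = - \<omega> v u"
    using z[of u] z[of v] by (simp add: bilinear_ladd[OF b] bilinear_radd[OF b])
  show "(\<And>v. \<omega> u v = 0) \<Longrightarrow> u = 0"
    using assms by (auto simp: symplectic_form_def)
qed

lemma flat_metricD:
  assumes "flat_metric h"
  shows "bilinear h" "h u v = h v u" "u \<noteq> 0 \<Longrightarrow> h u u > 0"
  using assms by (auto simp: flat_metric_def)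

lemmas bilinear_simps = bilinear_ladd bilinear_radd bilinear_lmul bilinear_rmul
  bilinear_lsub bilinear_rsub bilinear_lneg bilinear_rneg bilinear_lzero bilinear_rzero

context
  fixes \<omega> :: "(real^'n) tensor2" and w :: "real^'n"
  assumes \<omega>: "symplectic_form \<omega>"
begin

text \<open>Since \<open>\<omega> w w = 0\<close>, a transvection does not change the pairing with
  \<open>w\<close> that determines its own displacement; so transvections along the same
  \<open>w\<close> compose by adding their parameters.\<close>

lemma transvection_pairing: "\<omega> (transvection \<omega> w t v) w = \<omega> v w"
  using symplectic_formD(1,2)[OF \<omega>] by (simp add: transvection_def bilinear_simps)

lemma transvection_inverse: "transvection \<omega> w t (transvection \<omega> w (-t) v) = v"
  using transvection_pairing[of "-t" v] by (simp add: transvection_def[of _ _ t]) (simp add: transvection_def)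

lemma linear_transvection: "linear (transvection \<omega> w t)"
  using symplectic_formD(1)[OF \<omega>]
  by (intro linearI) (simp_all add: transvection_def bilinear_simps algebra_simps)

lemma transvection_eq_0_iff: "transvection \<omega> w t v = 0 \<longleftrightarrow> v = 0"
  by (metis linear_0 linear_transvection transvection_inverse minus_minus)

lemma flat_metric_transvected:
  assumes h: "flat_metric h"
  shows "flat_metric (transvected \<omega> w h t)"
  unfolding flat_metric_def
proof (intro conjI allI impI)
  show "bilinear (transvected \<omega> w h t)"
    using linear_transvection[of t] flat_metricD(1)[OF h]
    unfolding bilinear_def transvected_def linear_iff by simp
  show "transvected \<omega> w h t u v = transvected \<omega> w h t v u" for u v
    by (simp only: transvected_def flat_metricD(2)[OF h, of "transvection \<omega> w t u"])
  show "0 < transvected \<omega> w h t u u" if "u \<noteq> 0" for u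
    using that by (simp add: transvected_def flat_metricD(3)[OF h] transvection_eq_0_iff)
qed

end

lemma ex1_sharp:
  fixes h :: "(real^'n) tensor2"
  assumes h: "flat_metric h"
  shows "\<exists>!u. \<forall>v. h u v = \<xi> \<bullet> v"
proof -
  note b = flat_metricD(1)[OF h]
  \<comment> \<open>\<open>M u\<close> represents the functional \<open>h u\<close> in the standard
    inner product. Definiteness of \<open>h\<close> makes \<open>M\<close> injective, hence
    bijective in finite dimension.\<close>
  define M where "M u = (\<chi> i. h u (axis i 1))" for u
  have lin: "linear (h u)" for u using b by (simp add: bilinear_def)
  have M: "M u \<bullet> v = h u v" for u v
  proof -
    have "h u v = h u (\<Sum>i\<in>UNIV. v $ i *\<^sub>R axis i 1)" 
      using basis_expansion[of v] by (simp add: scalar_mult_eq_scaleR)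
    also have "\<dots> = (\<Sum>i\<in>UNIV. v $ i * h u (axis i 1))"
      by (simp add: linear_sum[OF lin] linear_cmul[OF lin])
    also have "\<dots> = M u \<bullet> v"
      by (simp add: M_def inner_vec_def mult.commute)
    finally show ?thesis by simp
  qed
  have linM: "linear M"
    by (rule linearI) (simp_all add: M_def vec_eq_iff bilinear_simps[OF b])
  have "inj M"
    unfolding linear_injective_0[OF linM]
  proof (intro allI impI)
    fix u assume "M u = 0"
    then have "h u u = 0" using M[of u u] by simp
    then show "u = 0" using flat_metricD(3)[OF h, of u] by force
  qed
  then have "bij M" using linM by (simp add: bij_def linear_injective_imp_surjective)
  moreover have "(\<forall>v. h u v = \<xi> \<bullet> v) \<longleftrightarrow> M u = \<xi>" for u
    using M vector_eq_rdot[of "M u" \<xi>] by simp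
  ultimately show ?thesis by (simp add: bij_iff)
qed

lemma sharp_eqI: "flat_metric h \<Longrightarrow> (\<And>v. h u v = \<xi> \<bullet> v) \<Longrightarrow> sharp h \<xi> = u"
  unfolding sharp_def by (rule the1_equality[OF ex1_sharp]) auto

lemma sharp_works: "flat_metric h \<Longrightarrow> h (sharp h \<xi>) v = \<xi> \<bullet> v"
  unfolding sharp_def using theI'[OF ex1_sharp, of h \<xi>] by blast

lemma linear_sharp:
  assumes "flat_metric h" shows "linear (sharp h)"
  using flat_metricD(1)[OF assms]
  by (intro linearI sharp_eqI[OF assms])
    (simp_all add: bilinear_simps sharp_works[OF assms] inner_add_left)

lemma bilinear_cometric:
  assumes "flat_metric h" shows "bilinear (cometric h)"
  using flat_metricD(1)[OF assms] linear_sharp[OF assms]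
  unfolding bilinear_def cometric_def linear_iff by simp

text \<open>\<open>A\<close> is an isometry from the pulled back metric to \<open>h\<close>, so it
  maps the dual vector of the pulled back covector \<open>\<xi>'\<close> to the dual vector of
  \<open>\<xi>\<close>.\<close>

lemma cometric_pullback:
  assumes h: "flat_metric h" and h': "flat_metric (\<lambda>u v. h (A u) (A v))" and "surj A"
    and "\<And>v. \<xi>' \<bullet> v = \<xi> \<bullet> A v" "\<And>v. \<eta>' \<bullet> v = \<eta> \<bullet> A v"
  shows "cometric (\<lambda>u v. h (A u) (A v)) \<xi>' \<eta>' = cometric h \<xi> \<eta>"
proof -
  have *: "A (sharp (\<lambda>u v. h (A u) (A v)) \<zeta>') = sharp h \<zeta>" if "\<And>v. \<zeta>' \<bullet> v = \<zeta> \<bullet> A v" for \<zeta> \<zeta>'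
  proof (rule sharp_eqI[OF h, symmetric])
    fix v obtain v' where "v = A v'" using \<open>surj A\<close> by blast
    then show "h (A (sharp (\<lambda>u v. h (A u) (A v)) \<zeta>')) v = \<zeta> \<bullet> v"
      using sharp_works[OF h', of \<zeta>' v'] that by simp
  qed
  show ?thesis unfolding cometric_def using * assms(4,5) by simp
qed

lemma surj_transvection: "symplectic_form \<omega> \<Longrightarrow> surj (transvection \<omega> w t)"
  by (metis surjI transvection_inverse)

lemma ex_flat:
  fixes \<omega> :: "(real^'n) tensor2"
  assumes "symplectic_form \<omega>"
  obtains q where "\<And>v. q \<bullet> v = \<omega> v w"
proof -
  have lin: "linear (\<lambda>v. \<omega> v w)" using symplectic_formD(1)[OF assms] by (simp add: bilinear_def)
  have "(\<Sum>b\<in>Basis. \<omega> b w *\<^sub>R b) \<bullet> v = \<omega> v w" for v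
  proof -
    have "\<omega> v w = \<omega> (\<Sum>b\<in>Basis. (v \<bullet> b) *\<^sub>R b) w" by (simp add: euclidean_representation)
    also have "\<dots> = (\<Sum>b\<in>Basis. (v \<bullet> b) * \<omega> b w)"
      by (simp add: linear_sum[OF lin] linear_cmul[OF lin])
    also have "\<dots> = (\<Sum>b\<in>Basis. \<omega> b w *\<^sub>R b) \<bullet> v"
      by (simp add: inner_sum_left mult.commute inner_commute[of v])
    finally show ?thesis by simp
  qed
  then show ?thesis using that by blast
qed

section \<open>Lifts through the covering and the flow on the cotangent bundle\<close>

lemma proj_eq_iff: "proj x = proj y \<longleftrightarrow> (\<forall>i. x $ i - y $ i \<in> \<int>)"
  by (metis lattice_rel_def torus.abs_eq_iff)

lemma proj_torus_rep [simp]: "proj (torus_rep x) = x"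
  by (metis Quotient3_abs_rep Quotient3_torus)

lemma open_vimage_proj: "open W \<Longrightarrow> open (proj -` W)"
  by (metis open_torus_def)

text \<open>Distinct integers have distance at least 1. Applied to differences of two lifts of the
  same map, this shows that such lifts have the same derivative.\<close>

lemma eventually_constant_of_int_components:
  fixes f :: "'a::euclidean_space \<Rightarrow> real^'n"
  assumes U: "open U" "x \<in> U" and cont: "continuous_on U f" and int: "\<And>y i. y \<in> U \<Longrightarrow> f y $ i \<in> \<int>"
  shows "\<forall>\<^sub>F y in nhds x. f y = f x"
proof -
  have "isCont f x" using U cont by (simp add: continuous_on_eq_continuous_at)
  then have "\<forall>\<^sub>F y in nhds x. dist (f y) (f x) < 1"
    by (simp add: isCont_def tendsto_at_iff_tendsto_nhds) (erule tendstoD, simp)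
  moreover have "\<forall>\<^sub>F y in nhds x. y \<in> U" using U by (simp add: eventually_nhds_in_open)
  ultimately show ?thesis
  proof eventually_elim
    case (elim y)
    show "f y = f x"
    proof (rule vec_eq_iff[THEN iffD2], rule allI)
      fix i
      have "\<bar>f y $ i - f x $ i\<bar> < 1"
        using component_le_norm_cart[of "f y - f x" i] elim(1) by (simp add: dist_norm)
      moreover have "f y $ i - f x $ i \<in> \<int>" using int elim U by (intro Ints_diff) auto
      ultimately show "f y $ i = f x $ i"
        using Ints_nonzero_abs_less1[of "f y $ i - f x $ i"] by auto
    qed
  qed
qed

text \<open>The flow of the Hamiltonian \<open>(\<xi> \<bullet> w)\<^sup>2 / 2\<close> for the magnetic form, where \<open>q\<close> represents \<open>\<omega>(\<cdot>, w)\<close>.\<close>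

definition shear :: "real^'n \<Rightarrow> real^'n \<Rightarrow> real \<Rightarrow> (real^'n) \<times> (real^'n) \<Rightarrow> (real^'n) \<times> (real^'n)" where
  "shear w q t x = (fst x + (t * (snd x \<bullet> w)) *\<^sub>R w, snd x - (t * (snd x \<bullet> w)) *\<^sub>R q)"

definition torus_shear :: "real^'n \<Rightarrow> real^'n \<Rightarrow> real \<Rightarrow> 'n cotangent_torus \<Rightarrow> 'n cotangent_torus" where
  "torus_shear w q t x = cotangent_proj (shear w q t (torus_rep (fst x), snd x))"

lemma cotangent_proj_eq_iff:
  "cotangent_proj x = cotangent_proj y \<longleftrightarrow> (\<forall>i. fst x $ i - fst y $ i \<in> \<int>) \<and> snd x = snd y"
  by (cases x; cases y) (simp add: cotangent_proj_def proj_eq_iff)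

text \<open>The increments of \<open>shear\<close> depend on the fibre coordinate only, so the
  representative chosen by \<open>torus_rep\<close> does not matter and the linear map
  \<open>shear\<close> is a global local expression.\<close>

lemma torus_shear_proj: "torus_shear w q t (cotangent_proj x) = cotangent_proj (shear w q t x)"
proof -
  have "proj (torus_rep (proj (fst x))) = proj (fst x)" by simp
  then show ?thesis
    unfolding torus_shear_def cotangent_proj_eq_iff
    by (cases x) (simp only: proj_eq_iff, simp add: shear_def cotangent_proj_def)
qed

lemma surj_cotangent_proj: "\<exists>y. x = cotangent_proj y"
  by (cases x) (metis cotangent_proj_def id_apply map_prod_simp proj_torus_rep)

text \<open>Because of \<open>q \<bullet> w = 0\<close> the pairing
  \<open>\<xi> \<bullet> w\<close>, and with it the velocity, is constant along the flow.\<close>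

lemma shear_inverse: "q \<bullet> w = 0 \<Longrightarrow> shear w q t (shear w q (-t) x) = x"
  by (cases x) (simp add: shear_def inner_add_left)

lemma linear_shear: "linear (shear w q t)"
  by (rule linearI) (simp_all add: shear_def inner_add_left algebra_simps)

lemma torus_shear_inverse: "q \<bullet> w = 0 \<Longrightarrow> torus_shear w q t (torus_shear w q (-t) x) = x"
  using surj_cotangent_proj[of x] by (auto simp: torus_shear_proj shear_inverse)

lemma smooth_map_torus_shear: "smooth_map cotangent_proj cotangent_proj (torus_shear w q t)"
  unfolding smooth_map_def local_expr_def
  using linear_shear[of w q t] smooth_on_linear[OF open_UNIV, of "shear w q t"]
  by (auto simp: torus_shear_proj linear_conv_bounded_linear
      intro!: exI[of _ UNIV] exI[of _ "shear w q t"])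

lemma diffeomorphism_torus_shear:
  assumes "q \<bullet> w = 0"
  shows "diffeomorphism cotangent_proj cotangent_proj (torus_shear w q t)"
proof -
  have i: "torus_shear w q t (torus_shear w q (-t) x) = x" "torus_shear w q (-t) (torus_shear w q t x) = x" for x
    using torus_shear_inverse[OF assms, of t x] torus_shear_inverse[OF assms, of "-t" x] by simp_all
  have "bij (torus_shear w q t)"
    by (rule bijI') (use i in metis)+
  moreover have "inv_into UNIV (torus_shear w q t) = torus_shear w q (-t)"
    by (rule inv_equality) (use i in auto)
  ultimately show ?thesis
    unfolding diffeomorphism_def by (simp add: smooth_map_torus_shear)
qed

text \<open>\<open>pulls_back\<close> quantifies over all local expressions. Near each point an
  arbitrary one differs from the linear map \<open>shear\<close> by a constant vector in the base
  direction, so its derivative is \<open>shear\<close> itself.\<close>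

lemma local_expr_derivative:
  assumes "local_expr cotangent_proj cotangent_proj (torus_shear w q t) U F" "x \<in> U"
  shows "frechet_derivative F (at x) = shear w q t"
proof -
  have U: "open U" and F: "smooth_on U F" and eq: "\<And>y. y \<in> U \<Longrightarrow> cotangent_proj (shear w q t y) = cotangent_proj (F y)"
    using assms(1) by (auto simp: local_expr_def torus_shear_proj)
  let ?d = "\<lambda>y. fst (F y) - fst (shear w q t y)"
  have bl: "bounded_linear (shear w q t)" using linear_shear linear_conv_bounded_linear by blast
  have "eventually (\<lambda>y. ?d y = ?d x) (nhds x)"
  proof (rule eventually_constant_of_int_components[OF U assms(2)])
    show "continuous_on U ?d"
      by (intro continuous_intros smooth_on_continuous[OF F] linear_continuous_on bl)
    show "?d y $ i \<in> \<int>" if "y \<in> U" for y i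
      using eq[OF that] unfolding cotangent_proj_eq_iff by (metis Ints_minus minus_diff_eq vector_minus_component)
  qed
  moreover have "\<forall>\<^sub>F y in nhds x. y \<in> U" using U assms(2) by (simp add: eventually_nhds_in_open)
  ultimately have ev: "\<forall>\<^sub>F y in nhds x. F y = shear w q t y + (?d x, 0)"
  proof eventually_elim
    case (elim y)
    then show ?case using eq[OF elim(2)] unfolding cotangent_proj_eq_iff
      by (intro prod_eqI) (simp_all add: algebra_simps)
  qed
  obtain V where V: "open V" "x \<in> V" "\<And>y. y \<in> V \<Longrightarrow> F y = shear w q t y + (?d x, 0)"
    using ev unfolding eventually_nhds by blast
  have "frechet_derivative F (at x) = frechet_derivative (\<lambda>y. shear w q t y + (?d x, 0)) (at x)"
    by (rule frechet_derivative_cong_open[OF V])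
  also have "\<dots> = shear w q t"
    by (rule frechet_derivative_eqI) (auto intro!: derivative_eq_intros bounded_linear_imp_has_derivative bl)
  finally show ?thesis .
qed

lemma magnetic_form_eq:
  "magnetic_form \<omega> x u v = snd v \<bullet> fst u - snd u \<bullet> fst v + \<omega> (fst u) (fst v)"
proof -
  have "frechet_derivative (\<lambda>y. canonical_form y v) (at x) u = snd u \<bullet> fst v" for u v
  proof -
    have "((\<lambda>y. canonical_form y v) has_derivative (\<lambda>u. snd u \<bullet> fst v)) (at x)"
      unfolding canonical_form_def by (auto intro!: derivative_eq_intros)
    then show ?thesis by (simp add: frechet_derivative_eqI)
  qed
  then show ?thesis by (simp add: magnetic_form_def ext_deriv_def)
qed

text \<open>The translation of the fibre by a multiple of \<open>q\<close> changes the canonical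
  part by precisely the negative of what the translation of the base along \<open>w\<close> changes
  in \<open>\<omega>\<close>. The remaining terms vanish by symmetry,
  \<open>q \<bullet> w = 0\<close> and \<open>\<omega> w w = 0\<close>.\<close>

lemma symplectomorphism_torus_shear:
  fixes \<omega> :: "(real^'n::finite) tensor2"
  assumes \<omega>: "symplectic_form \<omega>" and q: "\<And>v. q \<bullet> v = \<omega> v w"
  shows "symplectomorphism \<omega> \<omega> (torus_shear w q t)"
  unfolding symplectomorphism_def pulls_back_def
proof (intro conjI allI impI ballI)
  have qw: "q \<bullet> w = 0" by (simp add: q symplectic_formD(2)[OF \<omega>])
  then show "diffeomorphism cotangent_proj cotangent_proj (torus_shear w q t)"
    by (rule diffeomorphism_torus_shear)
  fix U F x and u v :: "(real^'n) \<times> (real^'n)"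
  assume *: "local_expr cotangent_proj cotangent_proj (torus_shear w q t) U F" "x \<in> U"
  note s = symplectic_formD[OF \<omega>]
  have "\<omega> (fst u) w = q \<bullet> fst u" "\<omega> (fst v) w = q \<bullet> fst v" "\<omega> w (fst v) = - (q \<bullet> fst v)"
    using q s(3)[of w "fst v"] by auto
  then show "magnetic_form \<omega> (F x) (frechet_derivative F (at x) u) (frechet_derivative F (at x) v) =
       magnetic_form \<omega> x u v"
    unfolding local_expr_derivative[OF *] magnetic_form_eq shear_def
    using qw s(2)[of w]
    by (simp add: bilinear_simps[OF s(1)] inner_add_right inner_diff_left inner_commute algebra_simps)
qed

text \<open>On covectors the shear is the inverse transpose of the transvection, so it carries the
  cometric of the pulled back metric to that of \<open>h\<close>.\<close>

lemma classically_equivalent_transvected: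
  fixes \<omega> :: "(real^'n::finite) tensor2"
  assumes \<omega>: "symplectic_form \<omega>" and h: "flat_metric h"
  shows "classically_equivalent (transvected \<omega> w h t) \<omega> h \<omega>"
proof -
  obtain q where q: "\<And>v. q \<bullet> v = \<omega> v w" using ex_flat[OF \<omega>] by blast
  have qw: "q \<bullet> w = 0" by (simp add: q symplectic_formD(2)[OF \<omega>])
  have "cometric (transvected \<omega> w h t) \<xi> \<xi> = cometric h (\<xi> - (t * (\<xi> \<bullet> w)) *\<^sub>R q) (\<xi> - (t * (\<xi> \<bullet> w)) *\<^sub>R q)" for \<xi>
  proof -
    have e: "transvected \<omega> w h t = (\<lambda>u v. h (transvection \<omega> w t u) (transvection \<omega> w t v))"
      by (intro ext) (simp add: transvected_def)
    have f: "flat_metric (\<lambda>u v. h (transvection \<omega> w t u) (transvection \<omega> w t v))"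
      using flat_metric_transvected[OF \<omega> h, of w t] by (simp add: e)
    have *: "\<xi> \<bullet> v = (\<xi> - (t * (\<xi> \<bullet> w)) *\<^sub>R q) \<bullet> transvection \<omega> w t v" for v
      using qw by (simp add: transvection_def inner_add_right inner_diff_left q[symmetric])
    show ?thesis unfolding e
      by (rule cometric_pullback[OF h f surj_transvection[OF \<omega>] * *])
  qed
  then have "hamiltonian (transvected \<omega> w h t) x = hamiltonian h (torus_shear w q t x)" for x
    by (simp add: hamiltonian_def torus_shear_def shear_def cotangent_proj_def)
  then show ?thesis
    unfolding classically_equivalent_def using symplectomorphism_torus_shear[OF \<omega> q] by blast
qed

section \<open>Isometries of flat tori\<close>

text \<open>Schwarz's theorem by integration: \<open>f (x + s u + t v) - f (x + t v)\<close> is the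
  integral of the \<open>u\<close>-derivative. Differentiating at \<open>t = 0\<close> under the
  integral sign and then at \<open>s = 0\<close> produces the mixed derivatives in both orders.
  One-sided derivatives on \<open>{0..d}\<close> suffice for the comparison.\<close>

lemma symmetric_second_derivative:
  fixes f :: "'a::euclidean_space \<Rightarrow> 'b::banach"
  assumes U: "open U" "x \<in> U" and f: "smooth_on U f"
  shows "frechet_derivative (\<lambda>y. frechet_derivative f (at y) v) (at x) u =
         frechet_derivative (\<lambda>y. frechet_derivative f (at y) u) (at x) v"
proof -
  define D where "D g y a = frechet_derivative g (at y) a" for g :: "'a \<Rightarrow> 'b" and y a
  obtain e where e: "e > 0" "ball x e \<subseteq> U" using U openE by blast
  define n where "n = norm u + norm v + 1"
  \<comment> \<open>Chosen so that the parallelogram spanned by \<open>d *\<^sub>R u\<close> and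
    \<open>d *\<^sub>R v\<close> at \<open>x\<close> stays within half the radius of the ball; the
    summand 1 in \<open>n\<close> covers \<open>u = v = 0\<close>.\<close>
  define d where "d = e / (2 * n)"
  have n: "n > 0" by (smt (verit) n_def norm_ge_zero)
  have d: "d > 0" using e n by (simp add: d_def)
  have inU: "x + s *\<^sub>R u + t *\<^sub>R v \<in> U" if "s \<in> {0..d}" "t \<in> {0..d}" for s t
  proof -
    have "norm (s *\<^sub>R u + t *\<^sub>R v) \<le> s * norm u + t * norm v"
      using that norm_triangle_ineq[of "s *\<^sub>R u" "t *\<^sub>R v"] by simp
    also have "\<dots> \<le> d * norm u + d * norm v"
      using that by (intro add_mono mult_right_mono) auto
    also have "\<dots> \<le> d * n" using d by (simp add: n_def algebra_simps)
    also have "\<dots> = e / 2" using n by (simp add: d_def)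
    also have "\<dots> < e" using e by simp
    finally have "dist x (x + (s *\<^sub>R u + t *\<^sub>R v)) < e"
      by (metis add_diff_cancel_left' dist_commute dist_norm)
    then show ?thesis using e by (auto simp: add.assoc)
  qed
  have line: "((\<lambda>r. g (p + r *\<^sub>R a)) has_vector_derivative D g (p + r *\<^sub>R a) a) (at r within T)"
    if "smooth_on U g" "p + r *\<^sub>R a \<in> U" for g :: "'a \<Rightarrow> 'b" and p a r T
  proof -
    have "(g has_derivative D g (p + r *\<^sub>R a)) (at (p + r *\<^sub>R a))"
      using smooth_on_has_derivative[OF that(1) U(1) that(2)] by (simp add: D_def[abs_def])
    moreover have "((\<lambda>r. p + r *\<^sub>R a) has_vector_derivative a) (at r within T)"
      by (auto intro!: derivative_eq_intros)
    ultimately show ?thesis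
      using vector_derivative_diff_chain_within[of "\<lambda>r. p + r *\<^sub>R a" a r T g, OF _ has_derivative_at_withinI]
      unfolding o_def by blast
  qed
  have unique: "a = b" if "(g has_vector_derivative a) (at 0 within {0..d})" "(g has_vector_derivative b) (at 0 within {0..d})"
    for g :: "real \<Rightarrow> 'b" and a b
    using vector_derivative_unique_within_closed_interval[of 0 d 0 g a b] that d by simp
  have smD: "smooth_on U (\<lambda>y. D f y a)" for a
    unfolding D_def by (rule smooth_on_derivative[OF f])
  have smDD: "smooth_on U (\<lambda>y. D (\<lambda>y. D f y a) y b)" for a b
    unfolding D_def[of "\<lambda>y. D f y a"] by (rule smooth_on_derivative[OF smD])
  have FTC: "((\<lambda>s'. D f (x + s' *\<^sub>R u + t *\<^sub>R v) u) has_integral f (x + s *\<^sub>R u + t *\<^sub>R v) - f (x + t *\<^sub>R v)) {0..s}"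
    if "s \<in> {0..d}" "t \<in> {0..d}" for s t
  proof -
    have "((\<lambda>s'. D f (x + t *\<^sub>R v + s' *\<^sub>R u) u) has_integral
        f (x + t *\<^sub>R v + s *\<^sub>R u) - f (x + t *\<^sub>R v + 0 *\<^sub>R u)) {0..s}"
    proof (rule fundamental_theorem_of_calculus)
      fix r assume "r \<in> {0..s}"
      then show "((\<lambda>r. f (x + t *\<^sub>R v + r *\<^sub>R u)) has_vector_derivative D f (x + t *\<^sub>R v + r *\<^sub>R u) u) (at r within {0..s})"
        using that inU[of r t] by (intro line f) (auto simp: algebra_simps)
    qed (use that in auto)
    then show ?thesis by (simp add: algebra_simps)
  qed
  have key: "D f (x + s *\<^sub>R u) v - D f x v = integral {0..s} (\<lambda>s'. D (\<lambda>y. D f y u) (x + s' *\<^sub>R u) v)"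
    if s: "s \<in> {0..d}" for s
  proof -
    have A: "((\<lambda>t. integral (cbox 0 s) (\<lambda>s'. D f (x + s' *\<^sub>R u + t *\<^sub>R v) u)) has_vector_derivative
        integral (cbox 0 s) (\<lambda>s'. D (\<lambda>y. D f y u) (x + s' *\<^sub>R u + 0 *\<^sub>R v) v)) (at 0 within {0..d})"
    proof (rule leibniz_rule_vector_derivative)
      fix t r assume tr: "t \<in> {0..d}" "r \<in> cbox 0 s"
      then show "((\<lambda>t. D f (x + r *\<^sub>R u + t *\<^sub>R v) u) has_vector_derivative
          D (\<lambda>y. D f y u) (x + r *\<^sub>R u + t *\<^sub>R v) v) (at t within {0..d})"
        using inU[of r t] s by (intro line smD) auto
    next
      fix t assume "t \<in> {0..d}"
      then show "(\<lambda>s'. D f (x + s' *\<^sub>R u + t *\<^sub>R v) u) integrable_on cbox 0 s"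
        using FTC[OF s] by (auto simp: integrable_on_def)
    next
      show "continuous_on ({0..d} \<times> cbox 0 s) (\<lambda>(t, r). D (\<lambda>y. D f y u) (x + r *\<^sub>R u + t *\<^sub>R v) v)"
        using s inU unfolding split_beta
        by (intro continuous_on_compose2[OF smooth_on_continuous[OF smDD]] continuous_intros) auto
    qed (use d in auto)
    have B: "((\<lambda>t. f (x + s *\<^sub>R u + t *\<^sub>R v) - f (x + t *\<^sub>R v)) has_vector_derivative
        D f (x + s *\<^sub>R u + 0 *\<^sub>R v) v - D f (x + 0 *\<^sub>R v) v) (at 0 within {0..d})"
    proof (rule has_vector_derivative_diff)
      show "((\<lambda>t. f (x + s *\<^sub>R u + t *\<^sub>R v)) has_vector_derivative D f (x + s *\<^sub>R u + 0 *\<^sub>R v) v) (at 0 within {0..d})"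
        by (rule line[OF f]) (use inU[of s 0] s d in simp)
      show "((\<lambda>t. f (x + t *\<^sub>R v)) has_vector_derivative D f (x + 0 *\<^sub>R v) v) (at 0 within {0..d})"
        by (rule line[OF f]) (use inU[of 0 0] d in simp)
    qed
    have C: "((\<lambda>t. integral (cbox 0 s) (\<lambda>s'. D f (x + s' *\<^sub>R u + t *\<^sub>R v) u)) has_vector_derivative
        D f (x + s *\<^sub>R u + 0 *\<^sub>R v) v - D f (x + 0 *\<^sub>R v) v) (at 0 within {0..d})"
      by (rule has_vector_derivative_transform[OF _ _ B])
        (use d FTC[OF s, THEN integral_unique] in auto)
    show ?thesis using unique[OF A C] by simp
  qed
  have "((\<lambda>s. integral {0..s} (\<lambda>s'. D (\<lambda>y. D f y u) (x + s' *\<^sub>R u) v)) has_vector_derivative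
      D (\<lambda>y. D f y u) (x + 0 *\<^sub>R u) v) (at 0 within {0..d})"
  proof (rule integral_has_vector_derivative)
    show "continuous_on {0..d} (\<lambda>s'. D (\<lambda>y. D f y u) (x + s' *\<^sub>R u) v)"
      using inU[of _ 0] d
      by (intro continuous_on_compose2[OF smooth_on_continuous[OF smDD]] continuous_intros) auto
  qed (use d in auto)
  moreover have "((\<lambda>s. integral {0..s} (\<lambda>s'. D (\<lambda>y. D f y u) (x + s' *\<^sub>R u) v)) has_vector_derivative
      D (\<lambda>y. D f y v) (x + 0 *\<^sub>R u) u - 0) (at 0 within {0..d})"
  proof (rule has_vector_derivative_transform)
    show "((\<lambda>s. D f (x + s *\<^sub>R u) v - D f x v) has_vector_derivative
      D (\<lambda>y. D f y v) (x + 0 *\<^sub>R u) u - 0) (at 0 within {0..d})"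
    proof (rule has_vector_derivative_diff)
      show "((\<lambda>s. D f (x + s *\<^sub>R u) v) has_vector_derivative D (\<lambda>y. D f y v) (x + 0 *\<^sub>R u) u) (at 0 within {0..d})"
        by (rule line[OF smD]) (use inU[of 0 0] d in simp)
    qed (rule has_vector_derivative_const)
  qed (use d key in auto)
  ultimately have "D (\<lambda>y. D f y u) (x + 0 *\<^sub>R u) v = D (\<lambda>y. D f y v) (x + 0 *\<^sub>R u) u - 0"
    by (rule unique)
  then show ?thesis by (simp add: D_def)
qed

text \<open>Differentiating \<open>iso\<close> shows that the second derivative of \<open>F\<close>
  is orthogonal to the image of the first. As that image is the whole space, the second derivative
  vanishes on the ball.\<close>

lemma isometric_derivative_constant:
  fixes F :: "real^'n::finite \<Rightarrow> real^'n"
  assumes h1: "flat_metric h1" and h2: "flat_metric h2" and F: "smooth_on (ball p e) F"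
    and iso: "\<And>x u v. x \<in> ball p e \<Longrightarrow>
      h2 (frechet_derivative F (at x) u) (frechet_derivative F (at x) v) = h1 u v"
    and x: "x \<in> ball p e"
  shows "frechet_derivative F (at x) = frechet_derivative F (at p)"
proof -
  let ?B = "ball p e"
  define D where "D a y = frechet_derivative F (at y) a" for a y
  define DD where "DD a b y = frechet_derivative (D a) (at y) b" for a b y
  have smD: "smooth_on ?B (D a)" for a
    unfolding D_def by (rule smooth_on_derivative[OF F])
  have Dd: "(D a has_derivative (\<lambda>b. DD a b y)) (at y)" if "y \<in> ?B" for a y
    using smooth_on_has_derivative[OF smD _ that] by (simp add: DD_def[abs_def])
  have sym: "DD a b y = DD b a y" if "y \<in> ?B" for a b y
    unfolding DD_def D_def using symmetric_second_derivative[OF _ that F] by (simp add: eta_contract_eq)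
  have bb: "bounded_bilinear h2"
    using flat_metricD(1)[OF h2] bilinear_conv_bounded_bilinear by blast
  have c: "h2 (DD u w y) (D v y) + h2 (D u y) (DD v w y) = 0" if y: "y \<in> ?B" for u v w y
  proof -
    have "((\<lambda>y. h2 (D u y) (D v y)) has_derivative
        (\<lambda>w. h2 (D u y) (DD v w y) + h2 (DD u w y) (D v y))) (at y)"
      by (rule bounded_bilinear.FDERIV[OF bb Dd[OF y] Dd[OF y]])
    moreover have "((\<lambda>y. h2 (D u y) (D v y)) has_derivative (\<lambda>w. 0)) (at y)"
      by (rule has_derivative_transform_within_open[of "\<lambda>y. h1 u v" _ _ _ ?B])
        (use y iso in \<open>auto simp: D_def\<close>)
    ultimately have "(\<lambda>w. h2 (D u y) (DD v w y) + h2 (DD u w y) (D v y)) = (\<lambda>w. 0)"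
      by (rule has_derivative_unique)
    then show ?thesis by (metis add.commute)
  qed
  have zero: "DD u w y = 0" if y: "y \<in> ?B" for u w y
  proof -
    \<comment> \<open>Symmetric in the first two and skew in the outer two arguments, like Christoffel symbols.\<close>
    have o: "h2 (DD u w y) (D v y) = 0" for u v w
    proof -
      have T: "h2 (DD a b y) (D v y) = - h2 (DD v b y) (D a y)" for a b v
        using c[OF y, of a b v] flat_metricD(2)[OF h2, of "D a y"] by simp
      show ?thesis
        using T[of u w v] T[of w v u] T[of v u w] sym[OF y, of u w] sym[OF y, of v w] sym[OF y, of u v]
        by simp
    qed
    have lin: "linear (\<lambda>a. D a y)"
      unfolding D_def
      using smooth_on_has_derivative[OF F _ y] has_derivative_linear by auto
    have "inj (\<lambda>a. D a y)"
      unfolding linear_injective_0[OF lin]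
    proof (intro allI impI)
      fix a assume "D a y = 0"
      then have "h1 a a = 0" using iso[OF y, of a a] flat_metricD(1)[OF h2] by (simp add: D_def bilinear_simps)
      then show "a = 0" using flat_metricD(3)[OF h1, of a] by force
    qed
    then have "surj (\<lambda>a. D a y)" using linear_injective_imp_surjective[OF lin] by simp
    then obtain v where "DD u w y = D v y" by blast
    then have "h2 (DD u w y) (DD u w y) = 0" using o[of u w v] by simp
    then show ?thesis using flat_metricD(3)[OF h2] by force
  qed
  have "D a x = D a p" for a
  proof (rule has_derivative_zero_unique[of ?B "D a"])
    show "(D a has_derivative (\<lambda>h. 0)) (at y within ?B)" if "y \<in> ?B" for y
      using Dd[OF that, of a] zero[OF that] by (simp add: has_derivative_at_withinI)
    show "p \<in> ?B" using x by (metis ball_eq_empty centre_in_ball empty_iff not_le)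
  qed (use x in auto)
  then show ?thesis by (auto simp: D_def)
qed

section \<open>From local isometries to linear automorphisms of the lattice\<close>

lemma locally_constant_eq:
  assumes "connected S" and loc: "\<And>a. a \<in> S \<Longrightarrow> \<exists>T. open T \<and> a \<in> T \<and> (\<forall>x\<in>T. f x = f a)"
    and "x \<in> S" "y \<in> S"
  shows "f x = f y"
proof -
  have "f constant_on S"
  proof (rule locally_constant_imp_constant[OF assms(1)])
    fix a assume a: "a \<in> S"
    then obtain T where "open T" "a \<in> T" "\<forall>x\<in>T. f x = f a" using loc by blast
    moreover from this have "openin (top_of_set S) (S \<inter> T)" by (simp add: openin_open_Int)
    ultimately show "\<exists>T. openin (top_of_set S) T \<and> a \<in> T \<and> (\<forall>x\<in>T. f x = f a)"
      using a by blast
  qed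
  then show ?thesis using assms(3,4) by (auto simp: constant_on_def)
qed

definition int_lattice :: "(real^'n) set" where
  "int_lattice = {z. \<forall>i. z $ i \<in> \<int>}"

lemma proj_eq_iff_lattice: "proj x = proj y \<longleftrightarrow> x - y \<in> int_lattice"
  by (simp add: proj_eq_iff int_lattice_def)

lemma int_lattice_closed:
  "0 \<in> int_lattice" "x \<in> int_lattice \<Longrightarrow> y \<in> int_lattice \<Longrightarrow> x + y \<in> int_lattice"
  "x \<in> int_lattice \<Longrightarrow> y \<in> int_lattice \<Longrightarrow> x - y \<in> int_lattice"
  "x \<in> int_lattice \<Longrightarrow> - x \<in> int_lattice"
  by (simp_all add: int_lattice_def)

text \<open>The difference of the two lifts takes values in the lattice, so it is locally constant
  and its derivative \<open>L - L'\<close> vanishes.\<close>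

lemma affine_lifts_agree:
  fixes L L' :: "real^'n::finite \<Rightarrow> real^'n"
  assumes V: "open V" "x \<in> V" and L: "linear L" "linear L'"
    and eq: "\<And>y. y \<in> V \<Longrightarrow> proj (L y + b) = proj (L' y + b')"
  shows "L = L'"
proof -
  have l: "bounded_linear L" "bounded_linear L'" using L linear_conv_bounded_linear by auto
  let ?f = "\<lambda>y. (L y + b) - (L' y + b')"
  have "eventually (\<lambda>y. ?f y = ?f x) (nhds x)"
  proof (rule eventually_constant_of_int_components[OF V])
    show "continuous_on V ?f" by (intro continuous_intros linear_continuous_on l)
    show "?f y $ i \<in> \<int>" if "y \<in> V" for y i
      using eq[OF that] by (simp add: proj_eq_iff)
  qed
  then obtain W where W: "open W" "x \<in> W" "\<And>y. y \<in> W \<Longrightarrow> ?f y = ?f x"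
    unfolding eventually_nhds by blast
  have "(?f has_derivative (\<lambda>v. 0)) (at x)"
    by (rule has_derivative_transform_within_open[OF has_derivative_const W(1,2) W(3)[symmetric]])
  moreover have "(?f has_derivative (\<lambda>v. L v - L' v)) (at x)"
    by (auto intro!: derivative_eq_intros bounded_linear_imp_has_derivative l)
  ultimately have "(\<lambda>v. L v - L' v) = (\<lambda>v. 0)" by (rule has_derivative_unique[symmetric])
  then show ?thesis by (metis (no_types) eq_iff_diff_eq_0 ext)
qed

text \<open>Every local expression is affine on a small ball. The linear parts of neighbouring
  expressions agree, hence are one map \<open>B\<close>, and the translation parts agree modulo the
  lattice. Injectivity of \<open>\<Phi>\<close> on the torus then translates into \<open>B\<close>
  preserving and reflecting membership in the lattice.\<close>

lemma isometry_lift: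
  fixes h1 h2 :: "(real^'n::finite) tensor2"
  assumes h1: "flat_metric h1" and h2: "flat_metric h2" and "isometric h1 h2"
  obtains B where "linear B" "bij B" "\<And>u v. h2 (B u) (B v) = h1 u v"
    "\<And>z. B z \<in> int_lattice \<longleftrightarrow> z \<in> int_lattice"
proof -
  obtain \<Phi> where \<Phi>: "diffeomorphism proj proj \<Phi>" and pb: "pulls_back proj proj \<Phi> (\<lambda>_. h2) (\<lambda>_. h1)"
    using assms(3) by (auto simp: isometric_def)
  have "\<exists>L b e. e > 0 \<and> linear L \<and> (\<forall>u v. h2 (L u) (L v) = h1 u v) \<and>
      (\<forall>y\<in>ball x e. \<Phi> (proj y) = proj (L y + b))" for x
  proof -
    have "smooth_map proj proj \<Phi>" using \<Phi> by (simp add: diffeomorphism_def)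
    then obtain U F where x: "x \<in> U" and le: "local_expr proj proj \<Phi> U F"
      unfolding smooth_map_def by blast
    have U: "open U" and F: "smooth_on U F" and eq: "\<And>y. y \<in> U \<Longrightarrow> \<Phi> (proj y) = proj (F y)"
      using le by (auto simp: local_expr_def)
    obtain e where e: "e > 0" "ball x e \<subseteq> U" using U x openE by blast
    have FB: "smooth_on (ball x e) F" by (rule smooth_on_subset[OF _ e(2) F]) simp
    define L where "L = frechet_derivative F (at x)"
    have iso: "h2 (frechet_derivative F (at y) u) (frechet_derivative F (at y) v) = h1 u v" if "y \<in> U" for y u v
      using pb le that unfolding pulls_back_def by blast
    have D: "(F has_derivative L) (at y)" if "y \<in> ball x e" for y
    proof -
      have "frechet_derivative F (at y) = L"
        unfolding L_def by (rule isometric_derivative_constant[OF h1 h2 FB _ that]) (use iso e in blast)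
      then show ?thesis using smooth_on_has_derivative[OF FB _ that] by simp
    qed
    have lin: "linear L" using D[of x] e has_derivative_linear by auto
    have bl: "bounded_linear L" using lin linear_conv_bounded_linear by auto
    have "F y - L y = F x - L x" if "y \<in> ball x e" for y
    proof (rule has_derivative_zero_unique[of "ball x e" "\<lambda>y. F y - L y"])
      fix y assume "y \<in> ball x e"
      then have "((\<lambda>y. F y - L y) has_derivative (\<lambda>h. L h - L h)) (at y)"
        by (intro has_derivative_diff D bounded_linear_imp_has_derivative bl)
      then show "((\<lambda>y. F y - L y) has_derivative (\<lambda>h. 0)) (at y within ball x e)"
        by (simp add: has_derivative_at_withinI)
    qed (use that e in auto)
    then have "F y = L y + (F x - L x)" if "y \<in> ball x e" for y
      using that by (metis add.commute diff_add_cancel)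
    then have "\<forall>y\<in>ball x e. \<Phi> (proj y) = proj (L y + (F x - L x))"
      using eq e by (metis subsetD)
    then show ?thesis using e lin iso[OF x] unfolding L_def by blast
  qed
  then obtain L b e where e: "\<And>x. e x > (0::real)" and lin: "\<And>x. linear (L x)"
    and iso: "\<And>x u v. h2 (L x u) (L x v) = h1 u v"
    and eq: "\<And>x y. y \<in> ball x (e x) \<Longrightarrow> \<Phi> (proj y) = proj (L x y + b x)"
    by metis
  have "L x = L y" for x y
  proof (rule locally_constant_eq[of UNIV L])
    fix a :: "real^'n"
    have "L x = L a" if "x \<in> ball a (e a)" for x
    proof (rule affine_lifts_agree[of "ball a (e a) \<inter> ball x (e x)" x, OF _ _ lin lin])
      fix y assume "y \<in> ball a (e a) \<inter> ball x (e x)"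
      then show "proj (L x y + b x) = proj (L a y + b a)" using eq[of y x] eq[of y a] by simp
    qed (use that e in auto)
    moreover have "a \<in> ball a (e a)" using e by simp
    ultimately show "\<exists>T. open T \<and> a \<in> T \<and> (\<forall>x\<in>T. L x = L a)" using open_ball by blast
  qed auto
  then obtain B where B: "\<And>x. L x = B" by metis
  \<comment> \<open>The translation parts are determined only modulo the lattice, so local constancy
    is stated in the torus; there the choice made by \<open>torus_rep\<close> disappears.\<close>
  let ?c = "\<lambda>y. proj (torus_rep (\<Phi> (proj y)) - B y)"
  have "?c x = ?c y" for x y
  proof (rule locally_constant_eq[of UNIV ?c])
    fix a :: "real^'n"
    have "?c x = proj (b a)" if "x \<in> ball a (e a)" for x
    proof -
      have "proj (torus_rep (\<Phi> (proj x))) = proj (B x + b a)" using eq[OF that] by (simp add: B)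
      then show ?thesis unfolding proj_eq_iff by (simp add: algebra_simps)
    qed
    moreover have "a \<in> ball a (e a)" using e by simp
    ultimately show "\<exists>T. open T \<and> a \<in> T \<and> (\<forall>x\<in>T. ?c x = ?c a)" using open_ball by metis
  qed auto
  then obtain c where c: "\<And>x. ?c x = proj c" by metis
  have glob: "\<Phi> (proj y) = proj (B y + c)" for y
  proof -
    have "proj (torus_rep (\<Phi> (proj y))) = proj (B y + c)"
      using c[of y] unfolding proj_eq_iff by (simp add: algebra_simps)
    then show ?thesis by simp
  qed
  have linB: "linear B" and isoB: "\<And>u v. h2 (B u) (B v) = h1 u v" using lin iso B by auto
  have "inj B"
    unfolding linear_injective_0[OF linB]
  proof (intro allI impI)
    fix a assume "B a = 0"
    then have "h1 a a = 0" using isoB[of a a] flat_metricD(1)[OF h2] by (simp add: bilinear_simps)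
    then show "a = 0" using flat_metricD(3)[OF h1, of a] by force
  qed
  then have "bij B" using linB by (simp add: bij_def linear_injective_imp_surjective)
  moreover have "B z \<in> int_lattice \<longleftrightarrow> z \<in> int_lattice" for z
  proof -
    have "B z \<in> int_lattice \<longleftrightarrow> \<Phi> (proj z) = \<Phi> (proj 0)"
      unfolding glob proj_eq_iff_lattice by (simp add: linear_0[OF linB])
    also have "\<dots> \<longleftrightarrow> proj z = proj 0"
      using \<Phi> by (simp add: diffeomorphism_def bij_def inj_eq)
    finally show ?thesis by (simp add: proj_eq_iff_lattice)
  qed
  ultimately show ?thesis using that linB isoB by blast
qed

section \<open>Shortest lattice vectors\<close>

lemma finite_int_lattice_cball: "finite {z :: real^'n::finite. z \<in> int_lattice \<and> norm z \<le> R}"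
proof -
  let ?S = "real_of_int ` {-\<lceil>R\<rceil>..\<lceil>R\<rceil>}"
  have "{z :: real^'n. z \<in> int_lattice \<and> norm z \<le> R} \<subseteq> (\<lambda>f. \<chi> i. f i) ` (PiE UNIV (\<lambda>_. ?S))"
  proof
    fix z :: "real^'n" assume "z \<in> {z. z \<in> int_lattice \<and> norm z \<le> R}"
    then have z: "z \<in> int_lattice" "norm z \<le> R" by auto
    have "z $ i \<in> ?S" for i
    proof -
      obtain k where k: "z $ i = of_int k" using z(1) by (auto simp: int_lattice_def elim: Ints_cases)
      have "\<bar>z $ i\<bar> \<le> R" using component_le_norm_cart[of z i] z by simp
      then have "k \<in> {-\<lceil>R\<rceil>..\<lceil>R\<rceil>}" unfolding k by simp linarith
      then show "z $ i \<in> ?S" by (simp add: k)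
    qed
    then show "z \<in> (\<lambda>f. \<chi> i. f i) ` (PiE UNIV (\<lambda>_. ?S))"
      by (intro image_eqI[of _ _ "\<lambda>i. z $ i"]) auto
  qed
  then show ?thesis by (rule finite_subset) (auto intro!: finite_imageI finite_PiE)
qed

text \<open>The constant is the minimum of \<open>h v v\<close> on the compact unit sphere;
  homogeneity does the rest.\<close>

lemma flat_metric_lower_bound:
  fixes h :: "(real^'n::finite) tensor2"
  assumes h: "flat_metric h"
  obtains c where "c > 0" "\<And>v. c * (norm v)\<^sup>2 \<le> h v v"
proof -
  note b = flat_metricD(1)[OF h]
  have bb: "bounded_bilinear h" using b bilinear_conv_bounded_bilinear by blast
  have "\<exists>x\<in>sphere 0 1. \<forall>y\<in>sphere (0::real^'n) 1. h x x \<le> h y y"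
  proof (rule continuous_attains_inf)
    show "continuous_on (sphere 0 1) (\<lambda>x. h x x)"
      by (intro bounded_bilinear.continuous_on[OF bb] continuous_intros)
  qed auto
  then obtain x where x: "norm x = 1" and min: "\<And>y. norm y = 1 \<Longrightarrow> h x x \<le> h y y" by auto
  have "h x x * (norm v)\<^sup>2 \<le> h v v" for v
  proof (cases "v = 0")
    case False
    have "h x x \<le> h (v /\<^sub>R norm v) (v /\<^sub>R norm v)" by (rule min) (use False in simp)
    also have "\<dots> = h v v / (norm v)\<^sup>2"
      by (simp add: bilinear_simps[OF b] power2_eq_square field_simps)
    finally show ?thesis using False by (simp add: pos_le_divide_eq)
  qed (simp add: bilinear_simps[OF b])
  moreover have "h x x > 0" using flat_metricD(3)[OF h, of x] x by fastforce
  ultimately show ?thesis using that by blast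
qed

lemma transvected_expand:
  assumes h: "flat_metric h"
  shows "transvected \<omega> w h t v v = h v v + t * (2 * (\<omega> v w * h v w)) + t\<^sup>2 * ((\<omega> v w)\<^sup>2 * h w w)"
  using flat_metricD(2)[OF h, of w v]
  by (simp add: transvected_def transvection_def bilinear_simps[OF flat_metricD(1)[OF h]] power2_eq_square algebra_simps)

text \<open>The inverse transvection distorts norms by at most the factor \<open>C\<close>,
  uniformly for \<open>t \<in> {0..1}\<close>. Together with the lower bound on \<open>h\<close>
  this confines all vectors in question to one ball. Uniformity in \<open>t\<close> is what later
  allows a single interval to be chosen for all vectors.\<close>

lemma finite_short_vectors:
  fixes h \<omega> :: "(real^'n::finite) tensor2"
  assumes \<omega>: "symplectic_form \<omega>" and h: "flat_metric h"
  shows "finite {z \<in> int_lattice. \<exists>t\<in>{0..1}. transvected \<omega> w h t z z \<le> R}"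
proof -
  obtain c where c: "c > 0" "\<And>v. c * (norm v)\<^sup>2 \<le> h v v" using flat_metric_lower_bound[OF h] by blast
  obtain K where K: "K > 0" "\<And>u v. \<bar>\<omega> u v\<bar> \<le> norm u * norm v * K"
    using bounded_bilinear.pos_bounded[of \<omega>] symplectic_formD(1)[OF \<omega>] bilinear_conv_bounded_bilinear
    by (auto simp: real_norm_def)
  define C where "C = 1 + norm w * norm w * K"
  have C: "C > 0" using K by (simp add: C_def add_pos_nonneg)
  have bound: "norm z \<le> C * sqrt (R / c)" if t: "t \<in> {0..1}" and le: "transvected \<omega> w h t z z \<le> R" for t z
  proof -
    define y where "y = transvection \<omega> w t z"
    have "c * (norm y)\<^sup>2 \<le> R" using c(2)[of y] le by (simp add: y_def transvected_def)
    then have "norm y \<le> sqrt (R / c)"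
      using c(1) by (intro real_le_rsqrt) (simp add: field_simps)
    have "z = transvection \<omega> w (-t) y"
      using transvection_inverse[OF \<omega>, of w "-t" z] by (simp add: y_def)
    then have "norm z \<le> norm y + norm ((- t * \<omega> y w) *\<^sub>R w)"
      using norm_triangle_ineq[of y "(- t * \<omega> y w) *\<^sub>R w"] by (simp only: transvection_def)
    also have "norm ((- t * \<omega> y w) *\<^sub>R w) = t * \<bar>\<omega> y w\<bar> * norm w" using t by (simp add: abs_mult)
    also have "\<dots> \<le> 1 * (norm y * norm w * K) * norm w"
      using t K by (intro mult_right_mono mult_mono) auto
    also have "norm y + \<dots> = C * norm y" by (simp add: C_def algebra_simps)
    also have "\<dots> \<le> C * sqrt (R / c)" using C \<open>norm y \<le> sqrt (R / c)\<close> by simp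
    finally show ?thesis by simp
  qed
  show ?thesis
    by (rule finite_subset[OF _ finite_int_lattice_cball[of "C * sqrt (R / c)"]]) (use bound in auto)
qed

lemma symplectic_nonzero_axis:
  assumes "symplectic_form \<omega>" "z \<noteq> 0"
  obtains j where "\<omega> z (axis j 1) \<noteq> 0"
proof -
  have lin: "linear (\<omega> z)" using symplectic_formD(1)[OF assms(1)] by (simp add: bilinear_def)
  have "\<exists>j. \<omega> z (axis j 1) \<noteq> 0"
  proof (rule ccontr)
    assume a: "\<not> ?thesis"
    have "\<omega> z v = 0" for v
    proof -
      have "\<omega> z v = \<omega> z (\<Sum>i\<in>UNIV. v $ i *\<^sub>R axis i 1)"
        using basis_expansion[of v] by (simp add: scalar_mult_eq_scaleR)
      also have "\<dots> = 0" using a by (simp add: linear_sum[OF lin] linear_cmul[OF lin])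
      finally show ?thesis .
    qed
    then show False using symplectic_formD(4)[OF assms(1)] assms(2) by blast
  qed
  then show ?thesis using that by blast
qed

lemma axis_in_int_lattice: "axis j 1 \<in> int_lattice"
  by (simp add: int_lattice_def axis_def)

lemma int_lattice_scale: "k \<in> \<int> \<Longrightarrow> z \<in> int_lattice \<Longrightarrow> k *\<^sub>R z \<in> int_lattice"
  by (simp add: int_lattice_def)

text \<open>
  The direction \<open>w\<close> is chosen so that some shortest lattice vector becomes shorter to first order;
  then the length of the shortest vectors is strictly decreasing for small \<open>t\<close>, since by convexity
  in \<open>t\<close> the other ones cannot become shorter than they were initially.
\<close>

lemma systole_decreasing:
  fixes h \<omega> :: "(real^'n::finite) tensor2"
  assumes \<omega>: "symplectic_form \<omega>" and h: "flat_metric h"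
  obtains w :: "real^'n" and e where "w \<in> int_lattice" "e > 0"
    "\<And>s t. 0 \<le> s \<Longrightarrow> s < t \<Longrightarrow> t \<le> e \<Longrightarrow>
      \<exists>z\<in>int_lattice - {0}. \<forall>z'\<in>int_lattice - {0}. transvected \<omega> w h t z z < transvected \<omega> w h s z' z'"
proof -
  have "\<exists>z0\<in>int_lattice - {0}. \<forall>z\<in>int_lattice - {0}. h z0 z0 \<le> h z z"
  proof -
    obtain j :: 'n where True by simp
    define a :: "real^'n" where "a = axis j 1"
    have a: "a \<in> int_lattice - {0}" by (simp add: a_def axis_in_int_lattice axis_eq_0_iff)
    define S where "S = {z \<in> int_lattice - {0}. h z z \<le> h a a}"
    \<comment> \<open>With \<open>0\<close> in place of \<open>w\<close> the transvection is the
      identity, so \<open>finite_short_vectors\<close> speaks about \<open>h\<close> itself.\<close>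
    have "S \<subseteq> {z \<in> int_lattice. \<exists>t\<in>{0..1}. transvected \<omega> 0 h t z z \<le> h a a}"
      by (auto simp: S_def transvected_def transvection_def intro!: bexI[of _ 0])
    then have fin: "finite S" using finite_short_vectors[OF \<omega> h] finite_subset by blast
    have "a \<in> S" using a by (simp add: S_def)
    then obtain z0 where z0: "z0 \<in> S" "\<forall>z\<in>S. h z0 z0 \<le> h z z"
      using arg_min_if_finite[OF fin, of "\<lambda>z. h z z"] by (metis empty_iff not_le)
    then show ?thesis unfolding S_def by (intro bexI[of _ z0]) force+
  qed
  then obtain z0 where z0: "z0 \<in> int_lattice" "z0 \<noteq> 0"
    and min: "\<And>z. z \<in> int_lattice \<Longrightarrow> z \<noteq> 0 \<Longrightarrow> h z0 z0 \<le> h z z" by auto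
  have p0: "h z0 z0 > 0" using flat_metricD(3)[OF h] z0 by blast
  obtain w where w: "w \<in> int_lattice" "\<omega> z0 w * h z0 w < 0"
  proof -
    obtain j where j: "\<omega> z0 (axis j 1) \<noteq> 0" by (rule symplectic_nonzero_axis[OF \<omega> z0(2)])
    \<comment> \<open>\<open>c\<close> orients the axis vector so that
      \<open>\<omega> z0 b > 0\<close>. Subtracting a multiple of \<open>z0\<close> leaves this
      pairing unchanged since \<open>\<omega> z0 z0 = 0\<close>, while \<open>N\<close> is large
      enough to make the pairing under \<open>h\<close> negative.\<close>
    define c where "c = sgn (\<omega> z0 (axis j 1))"
    define b where "b = c *\<^sub>R axis j (1::real)"
    define N where "N = real_of_int (\<lceil>h z0 b / h z0 z0\<rceil> + 1)"
    have b: "\<omega> z0 b > 0" using j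
      by (simp add: b_def c_def bilinear_simps[OF symplectic_formD(1)[OF \<omega>]] sgn_if)
    have "c \<in> \<int>" by (simp add: c_def sgn_if)
    then have L: "b - N *\<^sub>R z0 \<in> int_lattice"
      unfolding b_def N_def by (intro int_lattice_closed int_lattice_scale axis_in_int_lattice z0) auto
    have "h z0 b / h z0 z0 < N" unfolding N_def by simp linarith
    then have "h z0 b - N * h z0 z0 < 0" using p0 by (simp add: field_simps)
    then have "\<omega> z0 (b - N *\<^sub>R z0) * h z0 (b - N *\<^sub>R z0) < 0"
      using b by (simp add: bilinear_simps[OF symplectic_formD(1)[OF \<omega>]] symplectic_formD(2)[OF \<omega>]
          bilinear_simps[OF flat_metricD(1)[OF h]] mult_pos_neg)
    then show ?thesis using that L by blast
  qed
  define q where "q z t = transvected \<omega> w h t z z" for z t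
  define \<beta> where "\<beta> z = 2 * (\<omega> z w * h z w)" for z
  define \<gamma> where "\<gamma> z = (\<omega> z w)\<^sup>2 * h w w" for z
  have q: "q z t = h z z + t * \<beta> z + t\<^sup>2 * \<gamma> z" for z t
    unfolding q_def \<beta>_def \<gamma>_def by (rule transvected_expand[OF h])
  have hw: "h w w \<ge> 0"
    using flat_metricD(3)[OF h, of w] flat_metricD(1)[OF h] by (cases "w = 0") (auto simp: bilinear_simps)
  then have \<gamma>: "\<gamma> z \<ge> 0" for z by (simp add: \<gamma>_def)
  \<comment> \<open>Only these vectors can become as short as \<open>z0\<close> is under
    \<open>h\<close>. Among them, \<open>A\<close> below collects the shortest ones whose length
    decreases to first order.\<close>
  define S where "S = {z \<in> int_lattice - {0}. \<exists>t\<in>{0..1}. q z t \<le> h z0 z0}"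
  have "S \<subseteq> {z \<in> int_lattice. \<exists>t\<in>{0..1}. transvected \<omega> w h t z z \<le> h z0 z0}"
    by (auto simp: S_def q_def)
  then have finS: "finite S" using finite_short_vectors[OF \<omega> h] finite_subset by blast
  define A where "A = {z \<in> S. h z z = h z0 z0 \<and> \<beta> z < 0}"
  have "\<exists>e>0. (z \<in> A \<longrightarrow> (\<forall>s t. 0 \<le> s \<longrightarrow> s < t \<longrightarrow> t \<le> e \<longrightarrow> q z t < q z s)) \<and>
     (z \<notin> A \<longrightarrow> (\<forall>t. 0 \<le> t \<longrightarrow> t \<le> e \<longrightarrow> h z0 z0 \<le> q z t))" if z: "z \<in> S" for z
  proof (cases "z \<in> A")
    case True
    \<comment> \<open>With this \<open>e\<close> the derivative
      \<open>\<beta> z + 2 t \<gamma> z\<close> stays negative up to \<open>t = e\<close>; the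
      summand 1 keeps the denominator positive when \<open>\<gamma> z = 0\<close>.\<close>
    define e where "e = - \<beta> z / (2 * \<gamma> z + 1)"
    have g: "2 * \<gamma> z + 1 > 0" using \<gamma>[of z] by simp
    have b: "\<beta> z < 0" using True by (simp add: A_def)
    have e: "e > 0" using b g unfolding e_def by (intro divide_pos_pos) auto
    have "q z t < q z s" if "0 \<le> s" "s < t" "t \<le> e" for s t
    proof -
      have "(s + t) * \<gamma> z \<le> 2 * e * \<gamma> z" using that \<gamma>[of z] by (intro mult_right_mono) auto
      also have "\<dots> < e * (2 * \<gamma> z + 1)" using e by (simp add: algebra_simps)
      also have "\<dots> = - \<beta> z" using g by (simp add: e_def)
      finally have "(t - s) * (\<beta> z + (s + t) * \<gamma> z) < 0"
        using that by (intro mult_pos_neg) auto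
      then show ?thesis by (simp add: q power2_eq_square algebra_simps)
    qed
    then show ?thesis using e True by blast
  next
    case False
    have "h z0 z0 \<le> h z z" using min z by (simp add: S_def)
    show ?thesis
    proof (cases "\<beta> z \<ge> 0")
      case True
      have "h z0 z0 \<le> q z t" if "0 \<le> t" for t
        using \<open>h z0 z0 \<le> h z z\<close> True \<gamma>[of z] that by (simp add: q add_increasing2)
      then show ?thesis using False by (intro exI[of _ 1]) auto
    next
      case neg: False
      then have gap: "h z z - h z0 z0 > 0" using False z \<open>h z0 z0 \<le> h z z\<close> by (simp add: A_def)
      \<comment> \<open>The time in which the linear term alone would use up the gap to
        \<open>h z0 z0\<close>; the quadratic term is nonnegative.\<close>
      define e where "e = (h z z - h z0 z0) / (- \<beta> z)"
      have e: "e > 0" using gap neg unfolding e_def by (intro divide_pos_pos) auto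
      have "h z0 z0 \<le> q z t" if "0 \<le> t" "t \<le> e" for t
      proof -
        have "t * (- \<beta> z) \<le> e * (- \<beta> z)" using neg that by (intro mult_right_mono) auto
        also have "\<dots> = h z z - h z0 z0" using neg by (simp add: e_def)
        finally show ?thesis using \<gamma>[of z] that by (simp add: q add_increasing2)
      qed
      then show ?thesis using False e by (intro exI[of _ e]) auto
    qed
  qed
  then obtain E where E: "\<And>z. z \<in> S \<Longrightarrow> E z > 0"
    and EA: "\<And>z s t. z \<in> S \<Longrightarrow> z \<in> A \<Longrightarrow> 0 \<le> s \<Longrightarrow> s < t \<Longrightarrow> t \<le> E z \<Longrightarrow> q z t < q z s"
    and EB: "\<And>z t. z \<in> S \<Longrightarrow> z \<notin> A \<Longrightarrow> 0 \<le> t \<Longrightarrow> t \<le> E z \<Longrightarrow> h z0 z0 \<le> q z t"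
    by metis
  \<comment> \<open>The 1 keeps \<open>e\<close> within the parameter range \<open>{0..1}\<close>
    for which \<open>S\<close> was formed.\<close>
  define e where "e = Min (insert 1 (E ` S))"
  have e: "e > 0" "e \<le> 1" "\<And>z. z \<in> S \<Longrightarrow> e \<le> E z"
    using finS E by (auto simp: e_def)
  have "q z0 0 \<le> h z0 z0" by (simp add: q)
  then have "z0 \<in> S" using z0 unfolding S_def by (auto intro!: bexI[of _ 0])
  then have z0A: "z0 \<in> A" using w by (simp add: A_def \<beta>_def)
  have finA: "finite A" using finS by (simp add: A_def)
  show ?thesis
  proof (rule that[OF w(1) e(1)])
    fix s t :: real assume st: "0 \<le> s" "s < t" "t \<le> e"
    \<comment> \<open>The shortest vector of \<open>A\<close> at time \<open>s\<close>. Its squared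
      length is at most \<open>h z0 z0\<close> at \<open>s\<close> and strictly smaller at
      \<open>t\<close>; so at \<open>t\<close> it beats the members of \<open>A\<close> at
      \<open>s\<close> by minimality, and all other vectors because those are not below
      \<open>h z0 z0\<close>.\<close>
    obtain z where z: "z \<in> A" "\<And>z'. z' \<in> A \<Longrightarrow> q z s \<le> q z' s"
      using arg_min_if_finite[OF finA, of "\<lambda>z. q z s"] z0A by (metis empty_iff not_le)
    have zS: "z \<in> S" using z by (simp add: A_def)
    have lt: "q z t < q z s" using EA[OF zS z(1) st(1,2)] e(3)[OF zS] st by simp
    have le: "q z s \<le> h z0 z0"
    proof (cases "s = 0")
      case True then show ?thesis using z by (simp add: q A_def)
    next
      case False
      then have "q z s < q z 0" using EA[OF zS z(1), of 0 s] e(3)[OF zS] st by simp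
      then show ?thesis using z by (simp add: q A_def)
    qed
    have "q z t < q z' s" if z': "z' \<in> int_lattice - {0}" for z'
    proof (cases "z' \<in> S")
      case True
      show ?thesis
      proof (cases "z' \<in> A")
        case False
        have "h z0 z0 \<le> q z' s" using EB[OF True False st(1)] e(3)[OF True] st by simp
        then show ?thesis using lt le by simp
      qed (use z lt in force)
    next
      case False
      then have "q z' s > h z0 z0" using z' st e by (force simp: S_def)
      then show ?thesis using lt le by simp
    qed
    moreover have "z \<in> int_lattice - {0}" using zS by (simp add: S_def)
    ultimately show "\<exists>z\<in>int_lattice - {0}. \<forall>z'\<in>int_lattice - {0}. transvected \<omega> w h t z z < transvected \<omega> w h s z' z'"
      unfolding q_def by blast
  qed
qed

text \<open>The lift of an isometry permutes the nonzero lattice vectors and preserves lengths. The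
  short vector is pulled back by it in one direction and pushed forward in the other.\<close>

lemma not_isometric_of_shorter_vector:
  fixes h1 h2 :: "(real^'n::finite) tensor2"
  assumes h1: "flat_metric h1" and h2: "flat_metric h2"
    and short: "\<exists>z\<in>int_lattice - {0}. \<forall>z'\<in>int_lattice - {0}. h2 z z < h1 z' z'"
  shows "\<not> isometric h1 h2" "\<not> isometric h2 h1"
proof -
  obtain z where z: "z \<in> int_lattice" "z \<noteq> 0" "\<And>z'. z' \<in> int_lattice \<Longrightarrow> z' \<noteq> 0 \<Longrightarrow> h2 z z < h1 z' z'"
    using short by auto
  show "\<not> isometric h1 h2"
  proof
    assume "isometric h1 h2"
    then obtain B where B: "linear B" "bij B" "\<And>u v. h2 (B u) (B v) = h1 u v"
      "\<And>z. B z \<in> int_lattice \<longleftrightarrow> z \<in> int_lattice" by (rule isometry_lift[OF h1 h2]) blast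
    obtain y where y: "z = B y" using B(2) by (metis bij_pointE)
    have "y \<in> int_lattice" "y \<noteq> 0" using B(4)[of y] z linear_0[OF B(1)] by (auto simp: y)
    then show False using z(3)[of y] B(3)[of y y] by (simp add: y)
  qed
  show "\<not> isometric h2 h1"
  proof
    assume "isometric h2 h1"
    then obtain B where B: "linear B" "bij B" "\<And>u v. h1 (B u) (B v) = h2 u v"
      "\<And>z. B z \<in> int_lattice \<longleftrightarrow> z \<in> int_lattice" by (rule isometry_lift[OF h2 h1]) blast
    have "inj B" using B(2) by (simp add: bij_def)
    then have "B z \<in> int_lattice" "B z \<noteq> 0"
      using B(4)[of z] z linear_injective_0[OF B(1)] by auto
    then show False using z(3)[of "B z"] B(3)[of z z] by simp
  qed
qed

section \<open>Fourier series\<close>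

definition fourier_coeff :: "(real \<Rightarrow> complex) \<Rightarrow> int \<Rightarrow> complex" where
  "fourier_coeff g n = integral {0..1} (\<lambda>s. g s * cis (- (2 * pi * n * s)))"

lemma has_vector_derivative_cis_linear:
  "((\<lambda>s. cis (a * s)) has_vector_derivative \<i> * a * cis (a * s)) (at s within S)"
  by (auto intro!: derivative_eq_intros simp: has_vector_derivative_def scaleR_conv_of_real mult_ac)

lemma cis_int_mult_2pi: "cis (2 * pi * of_int n) = 1" "cis (- (2 * pi * of_int n)) = 1"
  using cis_multiple_2pi[of "of_int n"] cis_multiple_2pi[of "- of_int n"] by auto

text \<open>Integration by parts. The boundary term is kept because the rule serves both periodic
  loops and the nonperiodic polynomials in the Riemann-Lebesgue argument.\<close>

lemma fourier_coeff_derivative: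
  assumes "\<And>s. s \<in> {0..1} \<Longrightarrow> (g has_vector_derivative g' s) (at s within {0..1})"
    and g': "continuous_on {0..1} g'"
  shows "(- 2 * pi * \<i> * n) * fourier_coeff g n = g 1 - g 0 - fourier_coeff g' n"
proof -
  define E where "E s = cis (- (2 * pi * n) * s)" for s
  have E: "(E has_vector_derivative \<i> * (- (2 * pi * n)) * E s) (at s within S)" for s S
    unfolding E_def using has_vector_derivative_cis_linear[of "- (2 * pi * n)"] by simp
  have g: "continuous_on {0..1} g"
    unfolding continuous_on_eq_continuous_within using assms(1) has_vector_derivative_continuous by blast
  have Ec: "continuous_on {0..1} E" unfolding E_def by (intro continuous_intros)
  have A: "((\<lambda>s. g s * (\<i> * (- (2 * pi * n)) * E s) + g' s * E s) has_integral g 1 * E 1 - g 0 * E 0) {0..1}"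
    by (rule fundamental_theorem_of_calculus)
      (use has_vector_derivative_mult[OF assms(1) E] in auto)
  have B: "((\<lambda>s. g' s * E s) has_integral fourier_coeff g' n) {0..1}"
    unfolding fourier_coeff_def E_def minus_mult_left
    by (intro integrable_integral integrable_continuous_interval continuous_intros g')
  have "((\<lambda>s. g s * (\<i> * (- (2 * pi * n)) * E s)) has_integral g 1 * E 1 - g 0 * E 0 - fourier_coeff g' n) {0..1}"
    using has_integral_diff[OF A B] by simp
  moreover have "((\<lambda>s. (\<i> * (- (2 * pi * n))) * (g s * E s)) has_integral (\<i> * (- (2 * pi * n))) * fourier_coeff g n) {0..1}"
    unfolding fourier_coeff_def E_def minus_mult_left
    by (intro has_integral_mult_right integrable_integral integrable_continuous_interval continuous_intros g)
  ultimately have "(\<i> * (- (2 * pi * n))) * fourier_coeff g n = g 1 * E 1 - g 0 * E 0 - fourier_coeff g' n"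
    by (intro has_integral_unique[of "\<lambda>s. (\<i> * (- (2 * pi * n))) * (g s * E s)"]) (auto simp: algebra_simps)
  moreover have "E 1 = 1" "E 0 = 1" using cis_int_mult_2pi[of n] by (auto simp: E_def)
  ultimately show ?thesis by (simp add: algebra_simps)
qed

lemma norm_fourier_coeff_le:
  assumes "continuous_on {0..1} g" "\<And>s. s \<in> {0..1} \<Longrightarrow> norm (g s) \<le> B"
  shows "norm (fourier_coeff g n) \<le> B"
proof -
  have "norm (fourier_coeff g n) \<le> B * (1 - 0)"
    unfolding fourier_coeff_def minus_mult_left
    by (rule integral_bound) (use assms in \<open>auto intro!: continuous_intros simp: norm_mult\<close>)
  then show ?thesis by simp
qed

lemma fourier_coeff_diff:
  assumes "continuous_on {0..1} f" "continuous_on {0..1} g"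
  shows "fourier_coeff (\<lambda>s. f s - g s) n = fourier_coeff f n - fourier_coeff g n"
  unfolding fourier_coeff_def left_diff_distrib minus_mult_left
  by (intro integral_diff integrable_continuous_interval continuous_intros assms)

text \<open>A polynomial uniformly close to \<open>g\<close> has coefficients of order
  \<open>1 / n\<close> by integration by parts, and uniform approximation controls all coefficients
  of the difference at once.\<close>

lemma Riemann_Lebesgue:
  assumes g: "continuous_on {0..1} g" and "\<epsilon> > 0"
  obtains N :: real where "\<And>n. \<bar>real_of_int n\<bar> > N \<Longrightarrow> norm (fourier_coeff g n) < \<epsilon>"
proof -
  obtain p where p: "polynomial_function p" "\<And>s. s \<in> {0..1} \<Longrightarrow> norm (g s - p s) < \<epsilon> / 2"
    using Stone_Weierstrass_polynomial_function[of "{0..1}" g "\<epsilon> / 2"] assms by auto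
  obtain q where q: "polynomial_function q" "\<And>s. (p has_vector_derivative q s) (at s)"
    using has_vector_derivative_polynomial_function[OF p(1)] by blast
  have pc: "continuous_on {0..1} p" "continuous_on {0..1} q"
    using p(1) q(1) by (auto intro: continuous_on_polymonial_function)
  obtain B where B: "\<And>s. s \<in> {0..1} \<Longrightarrow> norm (q s) \<le> B"
    using compact_imp_bounded[OF compact_continuous_image[OF pc(2) compact_Icc]]
    unfolding bounded_iff by blast
  define C where "C = norm (p 1) + norm (p 0) + B"
  have "B \<ge> 0" using B[of 0] norm_ge_zero[of "q 0"] by (simp del: norm_ge_zero)
  then have C: "C \<ge> 0" by (simp add: C_def)
  have "norm (fourier_coeff g n) < \<epsilon>" if n: "\<bar>real_of_int n\<bar> > max 1 (C / \<epsilon>)" for n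
  proof -
    have "C < \<bar>real_of_int n\<bar> * \<epsilon>" using n assms(2) by (simp add: pos_divide_less_eq)
    have "n \<noteq> 0" using n by auto
    have "2 * pi * \<bar>real_of_int n\<bar> * norm (fourier_coeff p n) = norm ((- 2 * pi * \<i> * n) * fourier_coeff p n)"
      by (simp add: norm_mult)
    also have "\<dots> = norm (p 1 - p 0 - fourier_coeff q n)"
      by (subst fourier_coeff_derivative[of p q n])
        (use q(2) pc \<open>n \<noteq> 0\<close> in \<open>auto intro: has_vector_derivative_at_within\<close>)
    also have "\<dots> \<le> norm (p 1) + norm (p 0) + norm (fourier_coeff q n)"
      by (meson norm_triangle_ineq4 add_mono order_refl order_trans)
    also have "\<dots> \<le> C" unfolding C_def using norm_fourier_coeff_le[OF pc(2) B] by simp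
    also have "\<dots> < \<bar>real_of_int n\<bar> * \<epsilon>" by fact
    finally have "\<bar>real_of_int n\<bar> * (2 * pi * norm (fourier_coeff p n)) < \<bar>real_of_int n\<bar> * \<epsilon>"
      by (simp add: mult_ac)
    then have "2 * pi * norm (fourier_coeff p n) < \<epsilon>"
      by (rule mult_left_less_imp_less) simp
    moreover have "2 * norm (fourier_coeff p n) \<le> 2 * pi * norm (fourier_coeff p n)"
      using pi_gt3 by (intro mult_right_mono) auto
    ultimately have "norm (fourier_coeff p n) < \<epsilon> / 2" by simp
    moreover have "norm (fourier_coeff g n - fourier_coeff p n) \<le> \<epsilon> / 2"
      unfolding fourier_coeff_diff[OF g pc(1), symmetric]
      using p(2) by (intro norm_fourier_coeff_le continuous_intros g pc less_imp_le)
    ultimately show ?thesis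
      using norm_triangle_ineq[of "fourier_coeff g n - fourier_coeff p n" "fourier_coeff p n"] by simp
  qed
  then show ?thesis by (rule that)
qed

lemma cis_eq_1_iff_interval:
  assumes "s \<in> {0<..<1}" shows "cis (2 * pi * s) \<noteq> 1"
proof
  assume "cis (2 * pi * s) = 1"
  then have "cos (2 * pi * s) = 1" by (metis cis.simps(1) one_complex.simps(1))
  then obtain k :: int where "2 * pi * s = of_int k * 2 * pi" by (auto simp: cos_one_2pi_int)
  then have "s = of_int k" by simp
  then show False using assms by auto
qed

lemma fourier_coeff_const_0: "fourier_coeff (\<lambda>_. c) 0 = c"
  by (simp add: fourier_coeff_def)

lemma fourier_coeff_const: "n \<noteq> 0 \<Longrightarrow> fourier_coeff (\<lambda>_. c) n = 0"
  using fourier_coeff_derivative[of "\<lambda>_. c" "\<lambda>_. 0" n]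
  by (auto simp: fourier_coeff_def)

lemma has_vector_derivative_quotient:
  fixes g :: "real \<Rightarrow> 'a::real_normed_vector"
  assumes "(g has_vector_derivative d) (at a)"
  shows "((\<lambda>s. (g s - g a) /\<^sub>R (s - a)) \<longlongrightarrow> d) (at a)"
proof -
  have "((\<lambda>s. norm ((1 / norm (s - a)) *\<^sub>R (g s - (g a + (s - a) *\<^sub>R d)))) \<longlongrightarrow> 0) (at a)"
    using assms unfolding has_vector_derivative_def has_derivative_at2 by (intro tendsto_norm_zero) simp
  moreover have "eventually (\<lambda>s. norm ((1 / norm (s - a)) *\<^sub>R (g s - (g a + (s - a) *\<^sub>R d))) =
      norm ((g s - g a) /\<^sub>R (s - a) - d)) (at a)"
    using eventually_neq_at_within[of a a UNIV]
  proof eventually_elim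
    case (elim s)
    have "(g s - g a) /\<^sub>R (s - a) - d = (1 / (s - a)) *\<^sub>R (g s - (g a + (s - a) *\<^sub>R d))"
    proof -
      have "(1 / (s - a)) *\<^sub>R (g s - (g a + (s - a) *\<^sub>R d)) = (1 / (s - a)) *\<^sub>R ((g s - g a) - (s - a) *\<^sub>R d)"
        by (simp add: diff_diff_eq)
      also have "\<dots> = (g s - g a) /\<^sub>R (s - a) - d"
        using elim by (simp add: scaleR_diff_right[of _ "g s - g a"] divide_inverse)
      finally show ?thesis by simp
    qed
    then show ?case by simp
  qed
  ultimately have "((\<lambda>s. norm ((g s - g a) /\<^sub>R (s - a) - d)) \<longlongrightarrow> 0) (at a)"
    by (rule Lim_transform_eventually)
  then show ?thesis by (rule LIM_zero_cancel[OF tendsto_norm_zero_cancel])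
qed

text \<open>
  Chernoff's proof: dividing \<open>g - g 0\<close> by \<open>cis (2 * pi * s) - 1\<close> turns the
  symmetric partial sums into telescoping sums.
\<close>

lemma fourier_inversion:
  assumes g: "continuous_on {0..1} g" and per: "g 1 = g 0"
    and d0: "(g has_vector_derivative d0) (at 0)" and d1: "(g has_vector_derivative d1) (at 1)"
    and sum: "(fourier_coeff g has_sum S) UNIV"
  shows "S = g 0"
proof -
  define k where "k s = cis (2 * pi * s) - 1" for s
  \<comment> \<open>The quotient of the telescoping argument. At the two zeros of \<open>k\<close>
    its values are the limits of the difference quotients; this is where \<open>d0\<close> and
    \<open>d1\<close> enter, and it makes \<open>q\<close> continuous.\<close>
  define q where "q s = (if s = 0 then d0 / (2 * pi * \<i>) else if s = 1 then d1 / (2 * pi * \<i>)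
     else (g s - g 0) / k s)" for s
  have kd: "(k has_vector_derivative 2 * pi * \<i>) (at 0)" "(k has_vector_derivative 2 * pi * \<i>) (at 1)"
    unfolding k_def using has_vector_derivative_cis_linear[of "2 * pi"]
    by (auto intro!: derivative_eq_intros)
  have k0: "k 0 = 0" "k 1 = 0" by (auto simp: k_def)
  have quot: "((\<lambda>s. (g s - g 0) / k s) \<longlongrightarrow> d / (2 * pi * \<i>)) (at a)"
    if d: "(g has_vector_derivative d) (at a)" and a: "a = 0 \<or> a = 1" for a d
  proof -
    have "((\<lambda>s. (g s - g a) /\<^sub>R (s - a)) \<longlongrightarrow> d) (at a)"
      by (rule has_vector_derivative_quotient[OF d])
    moreover have "((\<lambda>s. (k s - k a) /\<^sub>R (s - a)) \<longlongrightarrow> 2 * pi * \<i>) (at a)"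
      using a kd by (intro has_vector_derivative_quotient) auto
    ultimately have "((\<lambda>s. ((g s - g a) /\<^sub>R (s - a)) / ((k s - k a) /\<^sub>R (s - a))) \<longlongrightarrow> d / (2 * pi * \<i>)) (at a)"
      by (intro tendsto_divide) auto
    moreover have "eventually (\<lambda>s. ((g s - g a) /\<^sub>R (s - a)) / ((k s - k a) /\<^sub>R (s - a)) = (g s - g 0) / k s) (at a)"
      using eventually_neq_at_within[of a a UNIV]
    proof eventually_elim
      case (elim s)
      have "X /\<^sub>R c / (Y /\<^sub>R c) = X / Y" if "c \<noteq> 0" for X Y :: complex and c :: real
        using that by (simp add: scaleR_conv_of_real)
      moreover have "g a = g 0" "k a = 0" "s - a \<noteq> 0" using a per k0 elim by auto
      ultimately show ?case by simp
    qed
    ultimately show ?thesis by (rule Lim_transform_eventually)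
  qed
  have qc: "continuous_on {0..1} q"
  proof (rule continuous_on_eq_continuous_within[THEN iffD2], rule ballI)
    fix a :: real assume a: "a \<in> {0..1}"
    have ev: "eventually (\<lambda>s. (g s - g 0) / k s = q s) (at a within {0..1})"
    proof -
      have "eventually (\<lambda>s. s \<noteq> 0 \<or> a = 0) (at a within {0..1})"
        by (cases "a = 0") (auto intro: eventually_neq_at_within)
      moreover have "eventually (\<lambda>s. s \<noteq> 1 \<or> a = 1) (at a within {0..1})"
        by (cases "a = 1") (auto intro: eventually_neq_at_within)
      moreover have "eventually (\<lambda>s. s \<noteq> a) (at a within {0..1})" by (rule eventually_neq_at_within)
      ultimately show ?thesis by eventually_elim (auto simp: q_def)
    qed
    have "((\<lambda>s. (g s - g 0) / k s) \<longlongrightarrow> q a) (at a within {0..1})"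
    proof (cases "a = 0 \<or> a = 1")
      case True
      then show ?thesis using quot[OF d0] quot[OF d1]
        by (auto simp: q_def intro: tendsto_within_subset)
    next
      case False
      then have "k a \<noteq> 0" using cis_eq_1_iff_interval[of a] a by (auto simp: k_def)
      moreover have "(g \<longlongrightarrow> g a) (at a within {0..1})" using g a by (auto simp: continuous_on_def)
      moreover have "continuous_on {0..1} k" unfolding k_def by (intro continuous_intros)
      then have "(k \<longlongrightarrow> k a) (at a within {0..1})" using a by (auto simp: continuous_on_def)
      ultimately have "((\<lambda>s. (g s - g 0) / k s) \<longlongrightarrow> (g a - g 0) / k a) (at a within {0..1})"
        by (intro tendsto_divide tendsto_diff tendsto_const)
      then show ?thesis using False by (simp add: q_def)
    qed
    then show "continuous (at a within {0..1}) q"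
      unfolding continuous_within using ev by (rule Lim_transform_eventually)
  qed
  have gq: "g s = q s * k s + g 0" if "s \<in> {0..1}" for s
    using that cis_eq_1_iff_interval[of s] per k0 by (auto simp: q_def k_def)
  \<comment> \<open>Multiplication by \<open>cis (2 * pi * s)\<close> turns the \<open>n\<close>-th
    coefficient into the one with index \<open>n - 1\<close>, so the factor \<open>k\<close> of
    \<open>q\<close> becomes a difference of neighbouring coefficients.\<close>
  have rec: "fourier_coeff g n = fourier_coeff q (n - 1) - fourier_coeff q n + fourier_coeff (\<lambda>_. g 0) n" for n
  proof -
    let ?e = "\<lambda>n s. cis (- (2 * pi * real_of_int n * s))"
    have I: "(\<lambda>s. f s * ?e n s) integrable_on {0..1}" if "continuous_on {0..1} f" for f n
      unfolding minus_mult_left by (intro integrable_continuous_interval continuous_intros that)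
    have "fourier_coeff g n = integral {0..1} (\<lambda>s. (q s * ?e (n - 1) s - q s * ?e n s) + g 0 * ?e n s)"
      unfolding fourier_coeff_def
    proof (rule integral_cong)
      fix s :: real assume s: "s \<in> {0..1}"
      have e: "?e (n - 1) s = cis (2 * pi * s) * ?e n s"
        by (simp add: cis_mult algebra_simps)
      show "g s * ?e n s = (q s * ?e (n - 1) s - q s * ?e n s) + g 0 * ?e n s"
        unfolding e gq[OF s] k_def by (simp only: ring_distribs mult.assoc mult_1)
    qed
    also have "\<dots> = fourier_coeff q (n - 1) - fourier_coeff q n + fourier_coeff (\<lambda>_. g 0) n"
      unfolding fourier_coeff_def
      by (simp only: integral_add[OF integrable_diff[OF I[OF qc] I[OF qc]] I[OF continuous_on_const]]
          integral_diff[OF I[OF qc] I[OF qc]])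
    finally show ?thesis .
  qed
  have part: "(\<Sum>n\<in>{-int N..int N}. fourier_coeff g n) = fourier_coeff q (- int N - 1) - fourier_coeff q (int N) + g 0" for N
  proof -
    have "(\<Sum>n\<in>{-int N..int N}. fourier_coeff q (n - 1) - fourier_coeff q n) = fourier_coeff q (- int N - 1) - fourier_coeff q (int N)"
    proof (induction N)
      case (Suc N)
      have "{-int (Suc N)..int (Suc N)} = insert (- int (Suc N)) (insert (int (Suc N)) {-int N..int N})" by auto
      moreover have "fourier_coeff q (- int N - 1) = fourier_coeff q (- 1 - int N)" by (rule arg_cong) simp
      ultimately show ?case using Suc by (simp add: algebra_simps)
    qed simp
    moreover have "(\<Sum>n\<in>{-int N..int N}. fourier_coeff (\<lambda>_. g 0) n) = (\<Sum>n\<in>{0}. fourier_coeff (\<lambda>_. g 0) n)"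
      by (rule sum.mono_neutral_right) (auto simp: fourier_coeff_const)
    moreover have "(\<Sum>n\<in>{-int N..int N}. fourier_coeff g n) =
        (\<Sum>n\<in>{-int N..int N}. fourier_coeff q (n - 1) - fourier_coeff q n) + (\<Sum>n\<in>{-int N..int N}. fourier_coeff (\<lambda>_. g 0) n)"
      by (simp only: rec sum.distrib)
    ultimately show ?thesis by (simp add: fourier_coeff_const_0)
  qed
  \<comment> \<open>An unordered sum is a limit along all finite index sets. The symmetric intervals
    eventually contain each of them, so the symmetric partial sums also converge to
    \<open>S\<close>.\<close>
  have "filterlim (\<lambda>N. {-int N..int N}) (finite_subsets_at_top UNIV) sequentially"
    unfolding filterlim_finite_subsets_at_top
  proof (intro allI impI)
    fix X :: "int set" assume X: "finite X \<and> X \<subseteq> UNIV"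
    define M where "M = nat (Max (insert 0 (abs ` X)))"
    have M: "\<bar>x\<bar> \<le> int M" if "x \<in> X" for x
    proof -
      have "\<bar>x\<bar> \<le> Max (insert 0 (abs ` X))" using X that by (intro Max_ge) auto
      then show ?thesis unfolding M_def by linarith
    qed
    have "X \<subseteq> {-int N..int N}" if "M \<le> N" for N
    proof
      fix x assume "x \<in> X"
      then have "\<bar>x\<bar> \<le> int N" using M[of x] that by linarith
      then show "x \<in> {-int N..int N}" by (auto simp: abs_le_iff)
    qed
    then show "eventually (\<lambda>N. finite {-int N..int N} \<and> X \<subseteq> {-int N..int N} \<and> {-int N..int N} \<subseteq> UNIV) sequentially"
      by (intro eventually_sequentiallyI[of M]) auto
  qed
  then have lim: "(\<lambda>N. \<Sum>n\<in>{-int N..int N}. fourier_coeff g n) \<longlonglongrightarrow> S"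
    using sum unfolding has_sum_def by (rule filterlim_compose[rotated])
  have RL: "(\<lambda>N. fourier_coeff q (r N)) \<longlonglongrightarrow> 0" if r: "\<And>N. int N \<le> \<bar>r N\<bar>" for r :: "nat \<Rightarrow> int"
  proof (rule LIMSEQ_I)
    fix \<epsilon> :: real assume "\<epsilon> > 0"
    then obtain M where M: "\<And>n. \<bar>real_of_int n\<bar> > M \<Longrightarrow> norm (fourier_coeff q n) < \<epsilon>"
      using Riemann_Lebesgue[OF qc] by blast
    have "norm (fourier_coeff q (r N) - 0) < \<epsilon>" if "N \<ge> nat \<lceil>M\<rceil> + 1" for N
    proof -
      have "M < real N" using that by linarith
      also have "real N \<le> \<bar>real_of_int (r N)\<bar>" using r[of N] by linarith
      finally show ?thesis using M by simp
    qed
    then show "\<exists>N0. \<forall>N\<ge>N0. norm (fourier_coeff q (r N) - 0) < \<epsilon>" by blast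
  qed
  have "(\<lambda>N. fourier_coeff q (- int N - 1)) \<longlonglongrightarrow> 0" "(\<lambda>N. fourier_coeff q (int N)) \<longlonglongrightarrow> 0"
    by (rule RL; simp)+
  then have "(\<lambda>N. fourier_coeff q (- int N - 1) - fourier_coeff q (int N) + g 0) \<longlonglongrightarrow> 0 - 0 + g 0"
    by (intro tendsto_intros)
  then have "(\<lambda>N. \<Sum>n\<in>{-int N..int N}. fourier_coeff g n) \<longlonglongrightarrow> g 0" unfolding part by simp
  then show ?thesis by (rule LIMSEQ_unique[OF lim])
qed

section \<open>Dominated series over the integers; differentiation under integrals and sums\<close>

lemma summable_on_inverse_square_int: "(\<lambda>n::int. C / (1 + (real_of_int n)\<^sup>2)) summable_on UNIV"
proof -
  let ?f = "\<lambda>n::int. 1 / (1 + (real_of_int n)\<^sup>2)"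
  have "summable (\<lambda>n. 1 / (1 + (real n)\<^sup>2))"
  proof (rule summable_comparison_test')
    show "summable (\<lambda>n. inverse ((real n)\<^sup>2))" by (rule inverse_power_summable) simp
    show "norm (1 / (1 + (real n)\<^sup>2)) \<le> inverse ((real n)\<^sup>2)" if "n \<ge> 1" for n
      using that frac_le[of 1 1 "(real n)\<^sup>2" "1 + (real n)\<^sup>2"] by (simp add: inverse_eq_divide)
  qed
  then have s: "(\<lambda>n. 1 / (1 + (real n)\<^sup>2)) summable_on UNIV"
    by (intro norm_summable_imp_summable_on) simp
  have "?f summable_on range int" 
    by (subst summable_on_reindex) (use s in \<open>auto simp: o_def\<close>)
  moreover have "?f summable_on range (\<lambda>n. - int n)"
    by (subst summable_on_reindex) (use s in \<open>auto simp: o_def inj_on_def\<close>)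
  moreover have "x \<in> range int \<union> range (\<lambda>n. - int n)" for x
    by (cases x rule: int_cases2) auto
  then have "range int \<union> range (\<lambda>n. - int n) = UNIV" by blast
  ultimately have "?f summable_on UNIV" by (metis summable_on_union)
  then show ?thesis using summable_on_cmult_right[of ?f UNIV C] by simp
qed

lemma abs_summable_on_int:
  fixes f :: "int \<Rightarrow> 'a::banach"
  assumes "\<And>n. norm (f n) \<le> C / (1 + (real_of_int n)\<^sup>2)"
  shows "f abs_summable_on UNIV" "f summable_on UNIV"
proof -
  show "f abs_summable_on UNIV"
    by (rule summable_on_comparison_test[OF summable_on_inverse_square_int[of C]]) (use assms in auto)
  then show "f summable_on UNIV" by (rule abs_summable_summable)
qed

text \<open>The majorant gives uniform convergence, hence termwise integration. By orthogonality
  every partial sum whose index set contains \<open>n\<close> already has \<open>n\<close>-th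
  coefficient \<open>a n\<close>.\<close>

lemma fourier_coeff_series:
  assumes "\<And>m. norm (a m) \<le> C / (1 + (real_of_int m)\<^sup>2)"
  shows "fourier_coeff (\<lambda>s. \<Sum>\<^sub>\<infinity>m. a m * cis (2 * pi * of_int m * s)) n = a n"
    and "continuous_on {0..1} (\<lambda>s. \<Sum>\<^sub>\<infinity>m. a m * cis (2 * pi * of_int m * s))"
proof -
  let ?e = "\<lambda>m s. cis (2 * pi * real_of_int m * s)"
  let ?g = "\<lambda>s. \<Sum>\<^sub>\<infinity>m. a m * ?e m s"
  let ?F = "finite_subsets_at_top (UNIV :: int set)"
  have u0: "uniform_limit {0..1} (\<lambda>X s. \<Sum>m\<in>X. a m * ?e m s) ?g ?F"
    by (rule Weierstrass_m_test_general[OF _ summable_on_inverse_square_int[of C]])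
      (use assms in \<open>simp add: norm_mult\<close>)
  then show "continuous_on {0..1} ?g"
    by (rule uniform_limit_theorem[rotated])
      (auto intro!: always_eventually continuous_intros)
  have u: "uniform_limit {0..1} (\<lambda>X s. (\<Sum>m\<in>X. a m * ?e m s) * ?e (-n) s) (\<lambda>s. ?g s * ?e (-n) s) ?F"
  proof (rule uniform_limitI)
    fix \<epsilon> :: real assume "\<epsilon> > 0"
    from uniform_limitD[OF u0 this]
    show "\<forall>\<^sub>F X in ?F. \<forall>s\<in>{0..1}. dist ((\<Sum>m\<in>X. a m * ?e m s) * ?e (-n) s) (?g s * ?e (-n) s) < \<epsilon>"
      by (simp add: dist_norm norm_mult left_diff_distrib[symmetric])
  qed
  have one: "((\<lambda>s. a m * ?e m s * ?e (-n) s) has_integral (if m = n then a n else 0)) {0..1}" for m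
  proof -
    have "integral {0..1} (\<lambda>s. a m * ?e m s * ?e (-n) s) = fourier_coeff (\<lambda>_. a m) (n - m)"
      unfolding fourier_coeff_def by (rule integral_cong) (simp add: cis_mult algebra_simps)
    also have "\<dots> = (if m = n then a n else 0)"
      by (simp add: fourier_coeff_const fourier_coeff_const_0)
    finally show ?thesis
      using integrable_integral[of "\<lambda>s. a m * ?e m s * ?e (-n) s" "{0..1}"]
      by (simp add: integrable_continuous_interval continuous_intros del: of_int_minus)
  qed
  obtain I J where I: "\<And>X. ((\<lambda>s. (\<Sum>m\<in>X. a m * ?e m s) * ?e (-n) s) has_integral I X) {0..1}"
    and J: "((\<lambda>s. ?g s * ?e (-n) s) has_integral J) {0..1}" and IJ: "(I \<longlongrightarrow> J) ?F"
    by (rule uniform_limit_integral[OF u]) (auto intro!: continuous_intros)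
  have IX: "I X = a n" if "finite X" "n \<in> X" for X
  proof -
    have "((\<lambda>s. \<Sum>m\<in>X. a m * ?e m s * ?e (-n) s) has_integral (\<Sum>m\<in>X. if m = n then a n else 0)) {0..1}"
      by (intro has_integral_sum that one)
    then have "I X = (\<Sum>m\<in>X. if m = n then a n else 0)"
      by (intro has_integral_unique[OF I]) (simp add: sum_distrib_right)
    then show ?thesis using that by simp
  qed
  have "\<forall>\<^sub>F X in ?F. finite X \<and> n \<in> X"
    unfolding eventually_finite_subsets_at_top by (intro exI[of _ "{n}"]) auto
  then have "\<forall>\<^sub>F X in ?F. I X = a n" by (rule eventually_mono) (use IX in blast)
  then have "(I \<longlongrightarrow> a n) ?F" by (rule tendsto_eventually)
  then have "J = a n" using IJ tendsto_unique[OF finite_subsets_at_top_neq_bot] by blast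
  then show "fourier_coeff ?g n = a n"
    unfolding fourier_coeff_def using integral_unique[OF J] by simp
qed

text \<open>The derivative is packed into a bounded linear function for the parametric integral
  theorem. Continuity then has to be checked only for each fixed direction, since the domain is
  finite-dimensional.\<close>

lemma leibniz_has_derivative:
  fixes f :: "'a::euclidean_space \<Rightarrow> real \<Rightarrow> 'c::euclidean_space"
  assumes U: "open U" "convex U" "x \<in> U"
    and f: "\<And>x s. x \<in> U \<Longrightarrow> s \<in> {0..1} \<Longrightarrow> ((\<lambda>x. f x s) has_derivative f' x s) (at x)"
    and f': "\<And>v. continuous_on (U \<times> {0..1}) (\<lambda>(x, s). f' x s v)"
    and c: "\<And>x. x \<in> U \<Longrightarrow> continuous_on {0..1} (f x)"
  shows "((\<lambda>x. integral {0..1} (f x)) has_derivative (\<lambda>v. integral {0..1} (\<lambda>s. f' x s v))) (at x)"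
proof -
  define b where "b x s = Blinfun (f' x s)" for x s
  have b: "blinfun_apply (b y s) = f' y s" if "y \<in> U" "s \<in> {0..1}" for y s
    unfolding b_def using f[OF that] by (simp add: bounded_linear_Blinfun_apply has_derivative_bounded_linear)
  have bc: "continuous_on (U \<times> cbox 0 1) (\<lambda>(x, s). b x s)"
  proof (rule continuous_on_blinfun_componentwise)
    fix i :: 'a
    show "continuous_on (U \<times> cbox 0 1) (\<lambda>p. blinfun_apply (case p of (x, s) \<Rightarrow> b x s) i)"
      by (rule continuous_on_eq[OF f'[of i, folded cbox_interval]]) (auto simp: b)
  qed
  have "((\<lambda>x. integral (cbox 0 1) (f x)) has_derivative integral (cbox 0 1) (b x)) (at x within U)"
  proof (rule leibniz_rule[OF _ _ bc U(3,2)])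
    show "((\<lambda>x. f x s) has_derivative blinfun_apply (b y s)) (at y within U)" if "y \<in> U" "s \<in> cbox 0 1" for y s
      using f[of y s] b[of y s] that by (auto intro: has_derivative_at_withinI)
    show "f y integrable_on cbox 0 1" if "y \<in> U" for y
      using c[OF that] by (simp add: integrable_continuous_interval)
  qed
  then have "((\<lambda>x. integral {0..1} (f x)) has_derivative integral {0..1} (b x)) (at x)"
    using U by (simp add: at_within_open[OF U(3,1)])
  moreover have "blinfun_apply (integral {0..1} (b x)) = (\<lambda>v. integral {0..1} (\<lambda>s. f' x s v))"
  proof
    fix v
    have "continuous_on {0..1} (b x)"
    proof -
      have "continuous_on {0..1} (\<lambda>s::real. (x, s))" by (intro continuous_intros)
      moreover have "(\<lambda>s::real. (x, s)) ` {0..1} \<subseteq> U \<times> cbox 0 1" using U by (auto simp: cbox_interval)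
      ultimately show ?thesis using continuous_on_compose2[OF bc] by fastforce
    qed
    then have "b x integrable_on {0..1}" by (rule integrable_continuous_interval)
    then show "blinfun_apply (integral {0..1} (b x)) v = integral {0..1} (\<lambda>s. f' x s v)"
      by (subst blinfun_apply_integral) (auto intro!: integral_cong simp: b[OF U(3)])
  qed
  ultimately show ?thesis by simp
qed

text \<open>Unordered sums over the integers are turned into ordinary series by
  \<open>int_decode\<close>. The second majorant makes the tails of the differentiated series small
  relative to \<open>norm v\<close>, uniformly on \<open>S\<close>.\<close>

lemma has_derivative_infsum_int:
  fixes t :: "int \<Rightarrow> 'a::euclidean_space \<Rightarrow> 'b::banach"
  assumes S: "open S" "convex S" "x \<in> S"
    and t: "\<And>n y. y \<in> S \<Longrightarrow> (t n has_derivative t' n y) (at y)"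
    and bound: "\<And>n y. y \<in> S \<Longrightarrow> norm (t n y) \<le> C / (1 + (real_of_int n)\<^sup>2)"
    and bound': "\<And>n y v. y \<in> S \<Longrightarrow> norm (t' n y v) \<le> norm v * (A / (1 + (real_of_int n)\<^sup>2))"
  shows "((\<lambda>y. \<Sum>\<^sub>\<infinity>n. t n y) has_derivative (\<lambda>v. \<Sum>\<^sub>\<infinity>n. t' n x v)) (at x)"
proof -
  have sums: "(\<lambda>j. u (int_decode j)) sums (\<Sum>\<^sub>\<infinity>n. u n)" if "u summable_on UNIV" for u :: "int \<Rightarrow> 'b"
    by (rule has_sum_imp_sums)
      (use that has_sum_reindex_bij_betw[OF bij_int_decode, of u] in \<open>simp add: has_sum_infsum\<close>)
  define a where "a j = A / (1 + (real_of_int (int_decode j))\<^sup>2)" for j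
  have "summable a"
    unfolding a_def using summable_on_inverse_square_int[of A]
      summable_on_reindex_bij_betw[OF bij_int_decode, of "\<lambda>n. A / (1 + (real_of_int n)\<^sup>2)"]
    by (intro summable_on_imp_summable) simp
  have st: "(\<lambda>j. t (int_decode j) y) sums (\<Sum>\<^sub>\<infinity>n. t n y)" if "y \<in> S" for y
    by (rule sums) (rule abs_summable_on_int[OF bound[OF that]])
  have st': "(\<lambda>j. t' (int_decode j) y v) sums (\<Sum>\<^sub>\<infinity>n. t' n y v)" if "y \<in> S" for y v
    by (rule sums, rule abs_summable_on_int(2)[of _ "norm v * A"]) (use bound'[OF that] in simp)
  have "\<exists>g. \<forall>y\<in>S. (\<lambda>j. t (int_decode j) y) sums g y \<and>
      (g has_derivative (\<lambda>v. \<Sum>\<^sub>\<infinity>n. t' n y v)) (at y within S)"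
  proof (rule has_derivative_series[where f = "\<lambda>j. t (int_decode j)" and f' = "\<lambda>j. t' (int_decode j)", OF S(2) _ _ S(3) st[OF S(3)]])
    show "(t (int_decode j) has_derivative t' (int_decode j) y) (at y within S)" if "y \<in> S" for j y
      using t[OF that] by (rule has_derivative_at_withinI)
    fix e :: real assume "e > 0"
    then obtain N where N: "\<And>n. n \<ge> N \<Longrightarrow> norm (suminf (\<lambda>i. a (i + n))) < e"
      using suminf_exist_split[OF _ \<open>summable a\<close>] by blast
    have "norm ((\<Sum>j<n. t' (int_decode j) y v) - (\<Sum>\<^sub>\<infinity>n. t' n y v)) \<le> e * norm v"
      if n: "n \<ge> N" and y: "y \<in> S" for n y v
    proof -
      have sa: "summable (\<lambda>i. norm v * a (i + n))"
        using \<open>summable a\<close> by (intro summable_mult) (simp add: summable_iff_shift)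
      have le: "norm (t' (int_decode (i + n)) y v) \<le> norm v * a (i + n)" for i
        using bound'[OF y] by (simp add: a_def)
      have "(\<Sum>\<^sub>\<infinity>n. t' n y v) - (\<Sum>j<n. t' (int_decode j) y v) = (suminf (\<lambda>i. t' (int_decode (i + n)) y v))"
        using sums_unique[OF st'[OF y, of v]] suminf_minus_initial_segment[OF sums_summable[OF st'[OF y, of v]], of n]
        by simp
      also have "norm \<dots> \<le> (suminf (\<lambda>i. norm v * a (i + n)))"
        by (rule norm_suminf_le[OF le sa])
      also have "\<dots> = norm v * (suminf (\<lambda>i. a (i + n)))"
        using \<open>summable a\<close> by (intro suminf_mult) (simp add: summable_iff_shift)
      also have "\<dots> \<le> norm v * e" using N[OF n] by (intro mult_left_mono) auto
      finally show ?thesis by (simp add: norm_minus_commute mult.commute)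
    qed
    then show "\<forall>\<^sub>F n in sequentially. \<forall>y\<in>S. \<forall>v.
        norm ((\<Sum>j<n. t' (int_decode j) y v) - (\<Sum>\<^sub>\<infinity>n. t' n y v)) \<le> e * norm v"
      by (intro eventually_sequentiallyI[of N]) blast
  qed
  then obtain g where g: "\<And>y. y \<in> S \<Longrightarrow> (\<lambda>j. t (int_decode j) y) sums g y"
    "(g has_derivative (\<lambda>v. \<Sum>\<^sub>\<infinity>n. t' n x v)) (at x within S)" using S(3) by blast
  have "g y = (\<Sum>\<^sub>\<infinity>n. t n y)" if "y \<in> S" for y
    using sums_unique2[OF g(1) st] that by blast
  then show ?thesis
    using has_derivative_transform_within_open[OF _ S(1) S(3), of g] g(2) at_within_open[OF S(3) S(1)] by fastforce
qed

section \<open>Quasi-periodic functions and the Schroedinger propagator\<close>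

text \<open>The covariant derivative in the symmetric gauge; its commutators are
  \<open>- 2 pi i \<beta>(u, v)\<close>, which is constant.\<close>

definition mag_deriv :: "(real^'n) tensor2 \<Rightarrow> real^'n \<Rightarrow> (real^'n \<Rightarrow> complex) \<Rightarrow> real^'n \<Rightarrow> complex" where
  "mag_deriv \<beta> v f x = frechet_derivative f (at x) v - \<i> * of_real (pi * \<beta> x v) * f x"

text \<open>
  Sections of the \<open>k\<close>-th power of a prequantum line bundle, pulled back to \<open>R\<^sup>n\<close> and expressed
  in a frame in which the connection is \<open>d - i pi \<beta>(x, \<cdot>)\<close>, where \<open>\<beta> = k \<omega>\<close>.
\<close>

definition quasi_periodic :: "(real^'n) tensor2 \<Rightarrow> (real^'n \<Rightarrow> complex) \<Rightarrow> (real^'n::finite \<Rightarrow> complex) set" where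
  "quasi_periodic \<beta> c = {f. smooth_on UNIV f \<and>
     (\<forall>z\<in>int_lattice. \<forall>x. f (x + z) = c z * cis (pi * \<beta> z x) * f x)}"

text \<open>
  The values of \<open>f\<close> along the closed loop from \<open>x\<close> in direction \<open>w\<close>, in a frame in which
  the covariant derivative is \<open>d/ds + 2 pi i (\<gamma> - \<beta> x w)\<close>.
\<close>

definition loop :: "(real^'n) tensor2 \<Rightarrow> real^'n \<Rightarrow> real \<Rightarrow> (real^'n \<Rightarrow> complex) \<Rightarrow> real^'n \<Rightarrow> real \<Rightarrow> complex" where
  "loop \<beta> w \<gamma> f x s = f (x + s *\<^sub>R w) * cis (pi * (\<beta> x w - 2 * \<gamma>) * s)"

definition mode :: "(real^'n) tensor2 \<Rightarrow> real^'n \<Rightarrow> real \<Rightarrow> int \<Rightarrow> (real^'n \<Rightarrow> complex) \<Rightarrow> real^'n \<Rightarrow> complex" where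
  "mode \<beta> w \<gamma> n f x = fourier_coeff (loop \<beta> w \<gamma> f x) n"

text \<open>The Schroedinger propagator \<open>exp (- i r \<nabla>\<^sub>w\<^sup>2 / (4 pi\<^sup>2))\<close> in direction \<open>w\<close>.\<close>

definition propagator :: "(real^'n) tensor2 \<Rightarrow> real^'n \<Rightarrow> real \<Rightarrow> real \<Rightarrow> (real^'n \<Rightarrow> complex) \<Rightarrow> real^'n \<Rightarrow> complex" where
  "propagator \<beta> w \<gamma> r f x = (\<Sum>\<^sub>\<infinity>n. cis (r * (of_int n + \<gamma> - \<beta> x w)\<^sup>2) * mode \<beta> w \<gamma> n f x)"

lemma has_derivative_cis_real:
  assumes "(g has_derivative g') (at x)"
  shows "((\<lambda>x. cis (g x)) has_derivative (\<lambda>v. \<i> * of_real (g' v) * cis (g x))) (at x)"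
  using has_derivative_cis[OF assms] by (simp add: scaleR_conv_of_real mult_ac)

lemma has_derivative_translate:
  assumes "(f has_derivative f') (at (x + a))"
  shows "((\<lambda>y. f (y + a)) has_derivative f') (at x)"
proof -
  have "((\<lambda>y. y + a) has_derivative (\<lambda>v. v)) (at x)" by (auto intro!: derivative_eq_intros)
  from has_derivative_compose[OF this, of f f'] assms show ?thesis by simp
qed

context
  fixes \<beta> :: "(real^'n::finite) tensor2"
  assumes \<beta>: "bilinear \<beta>" "\<And>u. \<beta> u u = 0"
begin

lemma skew: "\<beta> u v = - \<beta> v u"
proof -
  have "\<beta> (u + v) (u + v) = 0" by (rule \<beta>)
  then show ?thesis using \<beta>(2)[of u] \<beta>(2)[of v]
    by (simp add: bilinear_ladd[OF \<beta>(1)] bilinear_radd[OF \<beta>(1)])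
qed

lemma bounded_linear_left: "bounded_linear (\<lambda>x. \<beta> x v)"
  and bounded_linear_right: "bounded_linear (\<lambda>x. \<beta> v x)"
  using \<beta>(1) by (simp_all add: bilinear_def linear_conv_bounded_linear)

lemma continuous_on_form [continuous_intros]:
  "continuous_on S g \<Longrightarrow> continuous_on S (\<lambda>x. \<beta> (g x) v)"
  using bounded_linear.continuous_on[OF bounded_linear_left] .

lemma smooth_mult_form:
  assumes "smooth_on UNIV f"
  shows "smooth_on UNIV (\<lambda>x. \<i> * of_real (pi * \<beta> x v) * f x)"
proof -
  have "bounded_linear (\<lambda>x. \<i> * complex_of_real (pi * \<beta> x v))"
    by (intro bounded_linear_const_mult bounded_linear_of_real[THEN bounded_linear_compose] bounded_linear_left)
  then show ?thesis by (intro smooth_on_mult smooth_on_linear assms) auto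
qed

lemma smooth_mag_deriv: "smooth_on UNIV f \<Longrightarrow> smooth_on UNIV (mag_deriv \<beta> v f)"
  unfolding mag_deriv_def[abs_def] by (intro smooth_on_diff smooth_on_derivative smooth_mult_form) auto

lemma has_derivative_mag_deriv:
  assumes "smooth_on UNIV f"
  shows "(f has_derivative (\<lambda>v. mag_deriv \<beta> v f x + \<i> * of_real (pi * \<beta> x v) * f x)) (at x)"
  using smooth_on_has_derivative[OF assms open_UNIV, of x] by (simp add: mag_deriv_def)

text \<open>The total derivatives below are computed in the form
  \<open>g v + i pi \<beta>(x, v) f x\<close>; this rule reads the covariant derivative off from
  it.\<close>

lemma mag_deriv_eqI:
  assumes "(f has_derivative (\<lambda>v. g v + \<i> * of_real (pi * \<beta> x v) * f x)) (at x)"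
  shows "mag_deriv \<beta> v f x = g v"
  by (simp add: mag_deriv_def frechet_derivative_eqI[OF assms])

lemma mag_deriv_add:
  assumes "smooth_on UNIV f" shows "mag_deriv \<beta> (u + v) f x = mag_deriv \<beta> u f x + mag_deriv \<beta> v f x"
  using linear_add[OF has_derivative_linear[OF smooth_on_has_derivative[OF assms open_UNIV UNIV_I]]]
  by (simp add: mag_deriv_def bilinear_simps[OF \<beta>(1)] algebra_simps)

lemma mag_deriv_scale:
  assumes "smooth_on UNIV f" shows "mag_deriv \<beta> (a *\<^sub>R v) f x = of_real a * mag_deriv \<beta> v f x"
  using linear_cmul[OF has_derivative_linear[OF smooth_on_has_derivative[OF assms open_UNIV UNIV_I]]]
  by (simp add: mag_deriv_def bilinear_simps[OF \<beta>(1)] scaleR_conv_of_real[where 'a = complex] algebra_simps)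

lemma quasi_periodic_smooth: "f \<in> quasi_periodic \<beta> c \<Longrightarrow> smooth_on UNIV f"
  by (simp add: quasi_periodic_def)

text \<open>The derivative of the factor \<open>cis (pi * \<beta> z x)\<close> cancels the change of
  the potential from \<open>x\<close> to \<open>x + z\<close>.\<close>

lemma mag_deriv_quasi_periodic:
  assumes f: "f \<in> quasi_periodic \<beta> c"
  shows "mag_deriv \<beta> v f \<in> quasi_periodic \<beta> c"
proof -
  note sm = quasi_periodic_smooth[OF f]
  have "mag_deriv \<beta> v f (x + z) = c z * cis (pi * \<beta> z x) * mag_deriv \<beta> v f x" if z: "z \<in> int_lattice" for z x
  proof -
    have eq: "(\<lambda>y. f (y + z)) = (\<lambda>y. c z * (cis (pi * \<beta> z y) * f y))"
      using f z by (auto simp: quasi_periodic_def)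
    have "((\<lambda>y. f (y + z)) has_derivative frechet_derivative f (at (x + z))) (at x)"
      by (intro has_derivative_translate smooth_on_has_derivative[OF sm]) auto
    moreover have "((\<lambda>y. c z * (cis (pi * \<beta> z y) * f y)) has_derivative
        (\<lambda>v. c z * (cis (pi * \<beta> z x) * frechet_derivative f (at x) v + \<i> * of_real (pi * \<beta> z v) * cis (pi * \<beta> z x) * f x))) (at x)"
      by (intro has_derivative_mult_right has_derivative_mult has_derivative_cis_real
          bounded_linear_imp_has_derivative bounded_linear_right smooth_on_has_derivative[OF sm]) auto
    ultimately have "frechet_derivative f (at (x + z)) =
       (\<lambda>v. c z * (cis (pi * \<beta> z x) * frechet_derivative f (at x) v + \<i> * of_real (pi * \<beta> z v) * cis (pi * \<beta> z x) * f x))"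
      unfolding eq by (rule has_derivative_unique)
    moreover have "f (x + z) = c z * (cis (pi * \<beta> z x) * f x)" using eq by meson
    ultimately show ?thesis
      by (simp add: mag_deriv_def bilinear_ladd[OF \<beta>(1)] algebra_simps)
  qed
  then show ?thesis using smooth_mag_deriv[OF sm] by (auto simp: quasi_periodic_def)
qed

lemma continuous_on_loop:
  assumes "smooth_on UNIV f" shows "continuous_on S (loop \<beta> w \<gamma> f x)"
  unfolding loop_def
  by (intro continuous_intros continuous_on_compose2[OF smooth_on_continuous[OF assms]]) auto

lemma mode_linear:
  assumes f: "smooth_on UNIV f" and g: "smooth_on UNIV g"
  shows "mode \<beta> w \<gamma> n (\<lambda>x. a * f x + b * g x) x = a * mode \<beta> w \<gamma> n f x + b * mode \<beta> w \<gamma> n g x"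
proof -
  let ?e = "\<lambda>s. cis (- (2 * pi * n * s))"
  have I: "(\<lambda>s. loop \<beta> w \<gamma> h x s * ?e s) integrable_on {0..1}" if "smooth_on UNIV h" for h
    unfolding minus_mult_left by (intro integrable_continuous_interval continuous_intros continuous_on_loop that)
  have "mode \<beta> w \<gamma> n (\<lambda>x. a * f x + b * g x) x =
      integral {0..1} (\<lambda>s. a * (loop \<beta> w \<gamma> f x s * ?e s) + b * (loop \<beta> w \<gamma> g x s * ?e s))"
    unfolding mode_def fourier_coeff_def by (rule integral_cong) (simp add: loop_def algebra_simps)
  also have "\<dots> = a * mode \<beta> w \<gamma> n f x + b * mode \<beta> w \<gamma> n g x"
    using I[OF f] I[OF g] by (simp add: mode_def fourier_coeff_def integral_add integrable_on_mult_right)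
  finally show ?thesis .
qed

lemma mode_mag_deriv_add:
  assumes "smooth_on UNIV f"
  shows "mode \<beta> w \<gamma> n (mag_deriv \<beta> (v + a *\<^sub>R u) f) x =
     mode \<beta> w \<gamma> n (mag_deriv \<beta> v f) x + of_real a * mode \<beta> w \<gamma> n (mag_deriv \<beta> u f) x"
proof -
  have eq: "mag_deriv \<beta> (v + a *\<^sub>R u) f = (\<lambda>x. 1 * mag_deriv \<beta> v f x + of_real a * mag_deriv \<beta> u f x)"
    by (simp add: fun_eq_iff mag_deriv_add[OF assms] mag_deriv_scale[OF assms])
  show ?thesis unfolding eq mode_linear[OF smooth_mag_deriv smooth_mag_deriv, OF assms assms] by simp
qed

text \<open>Covariant differentiation in any direction passes through the mode. At parameter
  \<open>s\<close> the potential at \<open>x + s w\<close> exceeds the one at \<open>x\<close> by a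
  multiple of \<open>s \<beta>(w, v)\<close>, and the frame factor in \<open>loop\<close>
  contributes the same multiple of \<open>s \<beta>(v, w)\<close>; these cancel by
  skew-symmetry.\<close>

lemma mode_has_derivative:
  assumes f: "smooth_on UNIV f"
  shows "(mode \<beta> w \<gamma> n f has_derivative
     (\<lambda>v. mode \<beta> w \<gamma> n (mag_deriv \<beta> v f) x + \<i> * of_real (pi * \<beta> x v) * mode \<beta> w \<gamma> n f x)) (at x)"
proof -
  let ?e = "\<lambda>s. cis (- (2 * pi * n) * s)"
  define t' where "t' x s v = (loop \<beta> w \<gamma> (mag_deriv \<beta> v f) x s + \<i> * of_real (pi * \<beta> x v) * loop \<beta> w \<gamma> f x s) * ?e s" for x s v
  have jc: "continuous_on S (\<lambda>(x, s). loop \<beta> w \<gamma> g x s)" if "smooth_on UNIV g" for g S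
    unfolding loop_def split_beta
    by (intro continuous_intros continuous_on_compose2[OF smooth_on_continuous[OF that]]) auto
  have D: "((\<lambda>x. loop \<beta> w \<gamma> f x s * ?e s) has_derivative t' y s) (at y)" for s y
  proof -
    have "((\<lambda>x. f (x + s *\<^sub>R w)) has_derivative
        (\<lambda>v. mag_deriv \<beta> v f (y + s *\<^sub>R w) + \<i> * of_real (pi * \<beta> (y + s *\<^sub>R w) v) * f (y + s *\<^sub>R w))) (at y)"
      by (rule has_derivative_translate[OF has_derivative_mag_deriv[OF f]])
    moreover have "((\<lambda>x. cis (pi * (\<beta> x w - 2 * \<gamma>) * s)) has_derivative
        (\<lambda>v. \<i> * of_real (pi * \<beta> v w * s) * cis (pi * (\<beta> y w - 2 * \<gamma>) * s))) (at y)"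
      by (rule has_derivative_cis_real)
        (auto intro!: derivative_eq_intros bounded_linear_imp_has_derivative bounded_linear_left simp: algebra_simps)
    ultimately have "((\<lambda>x. loop \<beta> w \<gamma> f x s) has_derivative
       (\<lambda>v. f (y + s *\<^sub>R w) * (\<i> * of_real (pi * \<beta> v w * s) * cis (pi * (\<beta> y w - 2 * \<gamma>) * s)) +
          (mag_deriv \<beta> v f (y + s *\<^sub>R w) + \<i> * of_real (pi * \<beta> (y + s *\<^sub>R w) v) * f (y + s *\<^sub>R w)) * cis (pi * (\<beta> y w - 2 * \<gamma>) * s))) (at y)"
      unfolding loop_def by (rule has_derivative_mult)
    then have "((\<lambda>x. loop \<beta> w \<gamma> f x s * ?e s) has_derivative
       (\<lambda>v. (f (y + s *\<^sub>R w) * (\<i> * of_real (pi * \<beta> v w * s) * cis (pi * (\<beta> y w - 2 * \<gamma>) * s)) +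
          (mag_deriv \<beta> v f (y + s *\<^sub>R w) + \<i> * of_real (pi * \<beta> (y + s *\<^sub>R w) v) * f (y + s *\<^sub>R w)) * cis (pi * (\<beta> y w - 2 * \<gamma>) * s)) * ?e s)) (at y)"
      by (rule has_derivative_mult_left)
    moreover have "(\<lambda>v. (f (y + s *\<^sub>R w) * (\<i> * of_real (pi * \<beta> v w * s) * cis (pi * (\<beta> y w - 2 * \<gamma>) * s)) +
          (mag_deriv \<beta> v f (y + s *\<^sub>R w) + \<i> * of_real (pi * \<beta> (y + s *\<^sub>R w) v) * f (y + s *\<^sub>R w)) * cis (pi * (\<beta> y w - 2 * \<gamma>) * s)) * ?e s) = t' y s"
    proof
      fix v
      have "\<beta> v w = - \<beta> w v" by (rule skew)
      then show "(f (y + s *\<^sub>R w) * (\<i> * of_real (pi * \<beta> v w * s) * cis (pi * (\<beta> y w - 2 * \<gamma>) * s)) +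
          (mag_deriv \<beta> v f (y + s *\<^sub>R w) + \<i> * of_real (pi * \<beta> (y + s *\<^sub>R w) v) * f (y + s *\<^sub>R w)) * cis (pi * (\<beta> y w - 2 * \<gamma>) * s)) * ?e s = t' y s v"
        by (simp add: t'_def loop_def bilinear_simps[OF \<beta>(1)] ring_distribs mult_ac)
    qed
    ultimately show ?thesis by simp
  qed
  have "((\<lambda>x. integral {0..1} (\<lambda>s. loop \<beta> w \<gamma> f x s * ?e s)) has_derivative (\<lambda>v. integral {0..1} (\<lambda>s. t' x s v))) (at x)"
  proof (rule leibniz_has_derivative[of UNIV])
    show "continuous_on (UNIV \<times> {0..1}) (\<lambda>(x, s). t' x s v)" for v
      using jc[OF f] jc[OF smooth_mag_deriv[OF f]] unfolding t'_def split_beta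
      by (intro continuous_intros) auto
    show "continuous_on {0..1} (\<lambda>s. loop \<beta> w \<gamma> f x s * ?e s)" for x
      by (intro continuous_intros continuous_on_loop f)
  qed (use D in auto)
  moreover have "integral {0..1} (\<lambda>s. t' x s v) =
      mode \<beta> w \<gamma> n (mag_deriv \<beta> v f) x + \<i> * of_real (pi * \<beta> x v) * mode \<beta> w \<gamma> n f x" for v
  proof -
    have I: "(\<lambda>s. loop \<beta> w \<gamma> h x s * ?e s) integrable_on {0..1}" if "smooth_on UNIV h" for h
      by (intro integrable_continuous_interval continuous_intros continuous_on_loop that)
    have "integral {0..1} (\<lambda>s. t' x s v) =
        integral {0..1} (\<lambda>s. loop \<beta> w \<gamma> (mag_deriv \<beta> v f) x s * ?e s + \<i> * of_real (pi * \<beta> x v) * (loop \<beta> w \<gamma> f x s * ?e s))"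
      by (rule integral_cong) (simp add: t'_def algebra_simps)
    also have "\<dots> = integral {0..1} (\<lambda>s. loop \<beta> w \<gamma> (mag_deriv \<beta> v f) x s * ?e s) + integral {0..1} (\<lambda>s. \<i> * of_real (pi * \<beta> x v) * (loop \<beta> w \<gamma> f x s * ?e s))"
      by (rule integral_add[OF I[OF smooth_mag_deriv[OF f]] integrable_on_mult_right[OF I[OF f]]])
    finally show ?thesis by (simp add: mode_def fourier_coeff_def)
  qed
  moreover have "mode \<beta> w \<gamma> n f = (\<lambda>x. integral {0..1} (\<lambda>s. loop \<beta> w \<gamma> f x s * ?e s))"
    by (simp add: fun_eq_iff mode_def fourier_coeff_def)
  ultimately show ?thesis by simp
qed

lemma loop_has_vector_derivative:
  assumes f: "smooth_on UNIV f"
  shows "(loop \<beta> w \<gamma> f x has_vector_derivative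
     loop \<beta> w \<gamma> (mag_deriv \<beta> w f) x s - 2 * pi * \<i> * of_real (\<gamma> - \<beta> x w) * loop \<beta> w \<gamma> f x s) (at s within S)"
proof -
  have "((\<lambda>s. x + s *\<^sub>R w) has_vector_derivative w) (at s within S)"
    by (auto intro!: derivative_eq_intros)
  moreover have "(f has_derivative (\<lambda>v. mag_deriv \<beta> v f (x + s *\<^sub>R w) + \<i> * of_real (pi * \<beta> (x + s *\<^sub>R w) v) * f (x + s *\<^sub>R w)))
      (at (x + s *\<^sub>R w) within (\<lambda>s. x + s *\<^sub>R w) ` S)"
    by (rule has_derivative_at_withinI[OF has_derivative_mag_deriv[OF f]])
  ultimately have "((\<lambda>s. f (x + s *\<^sub>R w)) has_vector_derivative
      mag_deriv \<beta> w f (x + s *\<^sub>R w) + \<i> * of_real (pi * \<beta> (x + s *\<^sub>R w) w) * f (x + s *\<^sub>R w)) (at s within S)"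
    using vector_derivative_diff_chain_within[of "\<lambda>s. x + s *\<^sub>R w" w s S f] by (simp add: o_def)
  from has_vector_derivative_mult[OF this has_vector_derivative_cis_linear[of "pi * (\<beta> x w - 2 * \<gamma>)"]]
  show ?thesis
    unfolding loop_def by (rule has_vector_derivative_eq_rhs)
      (simp add: bilinear_simps[OF \<beta>(1)] \<beta>(2) algebra_simps)
qed

end

section \<open>Modes along closed loops and the propagator\<close>

context
  fixes \<beta> :: "(real^'n::finite) tensor2" and w :: "real^'n" and c :: "real^'n \<Rightarrow> complex" and \<gamma> :: real
  assumes \<beta>: "bilinear \<beta>" "\<And>u. \<beta> u u = 0"
    and w: "w \<in> int_lattice" "c w = cis (2 * pi * \<gamma>)"
begin

text \<open>The phase \<open>\<gamma>\<close> is a logarithm of the multiplier of \<open>w\<close>,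
  so the frame factor in \<open>loop\<close> undoes the quasi-periodicity after one turn.\<close>

lemma loop_periodic:
  assumes "f \<in> quasi_periodic \<beta> c" shows "loop \<beta> w \<gamma> f x 1 = loop \<beta> w \<gamma> f x 0"
proof -
  have "f (x + w) = c w * cis (pi * \<beta> w x) * f x" using assms w(1) by (simp add: quasi_periodic_def)
  moreover have "cis (2 * pi * \<gamma>) * cis (pi * \<beta> w x) * cis (pi * (\<beta> x w - 2 * \<gamma>)) = 1"
    using skew[OF \<beta>, of w x] by (simp add: cis_mult algebra_simps)
  ultimately show ?thesis by (simp add: loop_def w(2) mult_ac)
qed

text \<open>Integration by parts without boundary term, since the loop closes: the derivative along
  \<open>w\<close> is diagonal in the modes.\<close>

lemma mode_mag_deriv:
  assumes f: "f \<in> quasi_periodic \<beta> c"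
  shows "mode \<beta> w \<gamma> n (mag_deriv \<beta> w f) x = 2 * pi * \<i> * of_real (of_int n + \<gamma> - \<beta> x w) * mode \<beta> w \<gamma> n f x"
proof -
  note sm = quasi_periodic_smooth[OF \<beta> f]
  let ?a = "2 * pi * \<i> * of_real (\<gamma> - \<beta> x w)"
  let ?g = "loop \<beta> w \<gamma> f x" and ?g' = "loop \<beta> w \<gamma> (mag_deriv \<beta> w f) x"
  note c = continuous_on_loop[OF \<beta> sm] continuous_on_loop[OF \<beta> smooth_mag_deriv[OF \<beta> sm]]
  have "(- 2 * pi * \<i> * n) * fourier_coeff ?g n = ?g 1 - ?g 0 - fourier_coeff (\<lambda>s. ?g' s - ?a * ?g s) n"
    by (rule fourier_coeff_derivative[OF loop_has_vector_derivative[OF \<beta> sm]])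
      (intro continuous_intros c)
  also have "fourier_coeff (\<lambda>s. ?g' s - ?a * ?g s) n = fourier_coeff ?g' n - fourier_coeff (\<lambda>s. ?a * ?g s) n"
    by (intro fourier_coeff_diff continuous_intros c)
  also have "fourier_coeff (\<lambda>s. ?a * ?g s) n = ?a * fourier_coeff ?g n"
    by (simp add: fourier_coeff_def mult.assoc)
  finally show ?thesis by (simp add: mode_def loop_periodic[OF f] algebra_simps)
qed

text \<open>Two derivatives along \<open>w\<close> multiply the mode by \<open>u\<^sup>2\<close> up
  to a constant, where \<open>u = n + \<gamma> - \<beta>(x, w)\<close>, while the modes of any
  smooth function are bounded uniformly in \<open>n\<close> on bounded sets. For bounded
  \<open>x\<close>, \<open>u\<close> and \<open>n\<close> differ by a bounded amount, whence
  quadratic decay in \<open>n\<close>, locally uniformly in \<open>x\<close>.\<close>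

lemma mode_bound:
  assumes f: "f \<in> quasi_periodic \<beta> c"
  obtains C where "\<And>n x. norm x \<le> R \<Longrightarrow> norm (mode \<beta> w \<gamma> n f x) \<le> C / (1 + (real_of_int n)\<^sup>2)"
proof -
  let ?K = "cball (0 :: real^'n) (\<bar>R\<bar> + norm w)"
  have bnd: "\<exists>M\<ge>0. \<forall>n x. norm x \<le> R \<longrightarrow> norm (mode \<beta> w \<gamma> n g x) \<le> M" if g: "smooth_on UNIV g" for g
  proof -
    have "bounded (g ` ?K)"
      by (intro compact_imp_bounded compact_continuous_image
          continuous_on_subset[OF smooth_on_continuous[OF g]]) auto
    then obtain M where M: "\<And>y. y \<in> ?K \<Longrightarrow> norm (g y) \<le> M" unfolding bounded_iff by blast
    have "norm (mode \<beta> w \<gamma> n g x) \<le> M" if "norm x \<le> R" for n x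
      unfolding mode_def
    proof (rule norm_fourier_coeff_le[OF continuous_on_loop[OF \<beta> g]])
      fix s :: real assume s: "s \<in> {0..1}"
      have "norm (x + s *\<^sub>R w) \<le> norm x + s * norm w" using norm_triangle_ineq[of x "s *\<^sub>R w"] s by simp
      also have "\<dots> \<le> \<bar>R\<bar> + 1 * norm w" using s that by (intro add_mono mult_right_mono) auto
      finally have "x + s *\<^sub>R w \<in> ?K" by simp
      then show "norm (loop \<beta> w \<gamma> g x s) \<le> M" using M by (simp add: loop_def norm_mult)
    qed
    moreover have "0 \<in> ?K" by simp
    then have "M \<ge> 0" using M norm_ge_zero order_trans by blast
    ultimately show ?thesis by blast
  qed
  note sm = quasi_periodic_smooth[OF \<beta> f]
  note q1 = mag_deriv_quasi_periodic[OF \<beta> f]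
  obtain M1 where M1: "M1 \<ge> 0" "\<And>n x. norm x \<le> R \<Longrightarrow> norm (mode \<beta> w \<gamma> n f x) \<le> M1" using bnd[OF sm] by blast
  obtain M2 where M2: "M2 \<ge> 0" "\<And>n x. norm x \<le> R \<Longrightarrow> norm (mode \<beta> w \<gamma> n (mag_deriv \<beta> w (mag_deriv \<beta> w f)) x) \<le> M2"
    using bnd[OF smooth_mag_deriv[OF \<beta> smooth_mag_deriv[OF \<beta> sm]]] by blast
  have "bounded ((\<lambda>x. \<gamma> - \<beta> x w) ` cball 0 R)"
    by (intro compact_imp_bounded compact_continuous_image continuous_intros continuous_on_form[OF \<beta>]) auto
  then obtain T where T: "\<And>x. norm x \<le> R \<Longrightarrow> \<bar>\<gamma> - \<beta> x w\<bar> \<le> T" unfolding bounded_iff by fastforce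
  have "norm (mode \<beta> w \<gamma> n f x) \<le> (M1 + 2 * M2 + 2 * T\<^sup>2 * M1) / (1 + (real_of_int n)\<^sup>2)" if x: "norm x \<le> R" for n x
  proof -
    define m where "m = norm (mode \<beta> w \<gamma> n f x)"
    define u where "u = of_int n + \<gamma> - \<beta> x w"
    define th where "th = \<gamma> - \<beta> x w"
    have m: "0 \<le> m" "m \<le> M1" using M1(2)[OF x] by (auto simp: m_def)
    have nn: "norm (2 * pi * \<i> * of_real u * X) = 2 * pi * \<bar>u\<bar> * norm X" for X by (simp add: norm_mult)
    have "norm (mode \<beta> w \<gamma> n (mag_deriv \<beta> w (mag_deriv \<beta> w f)) x) = (2 * pi * \<bar>u\<bar>) * (2 * pi * \<bar>u\<bar> * m)"
      unfolding mode_mag_deriv[OF q1, where n = n and x = x, folded u_def] mode_mag_deriv[OF f, where n = n and x = x, folded u_def] nn m_def ..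
    also have "\<dots> = (2 * pi)\<^sup>2 * (u\<^sup>2 * m)" by (simp add: power2_eq_square)
    finally have "(2 * pi)\<^sup>2 * (u\<^sup>2 * m) \<le> M2" using M2(2)[OF x] by metis
    moreover have "1 * (u\<^sup>2 * m) \<le> (2 * pi)\<^sup>2 * (u\<^sup>2 * m)"
      using pi_gt3 m by (intro mult_right_mono one_le_power) auto
    ultimately have um: "u\<^sup>2 * m \<le> M2" by simp
    have "th\<^sup>2 \<le> T\<^sup>2" using T[OF x] by (simp add: th_def abs_le_square_iff[symmetric])
    then have tm: "th\<^sup>2 * m \<le> T\<^sup>2 * M1" using m by (intro mult_mono) auto
    have "(real_of_int n)\<^sup>2 = (u - th)\<^sup>2" by (simp add: u_def th_def)
    also have "\<dots> \<le> 2 * u\<^sup>2 + 2 * th\<^sup>2"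
      using zero_le_power2[of "u + th"] by (simp add: power2_eq_square algebra_simps)
    finally have "(real_of_int n)\<^sup>2 * m \<le> (2 * u\<^sup>2 + 2 * th\<^sup>2) * m" using m by (intro mult_right_mono)
    then have "(1 + (real_of_int n)\<^sup>2) * m \<le> M1 + 2 * M2 + 2 * T\<^sup>2 * M1"
      using um tm m by (simp add: algebra_simps)
    then show ?thesis by (simp add: m_def pos_le_divide_eq add_pos_nonneg mult.commute)
  qed
  then show ?thesis by (rule that)
qed

lemma propagator_summable:
  assumes "f \<in> quasi_periodic \<beta> c"
  shows "(\<lambda>n. cis (a n) * mode \<beta> w \<gamma> n f x) summable_on UNIV"
proof -
  obtain C where "\<And>n y. norm y \<le> norm x \<Longrightarrow> norm (mode \<beta> w \<gamma> n f y) \<le> C / (1 + (real_of_int n)\<^sup>2)"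
    using mode_bound[OF assms, of "norm x"] by blast
  then show ?thesis by (intro abs_summable_on_int(2)[of _ C]) (simp add: norm_mult)
qed

text \<open>Termwise, the derivative of the phase contributes
  \<open>- 2 i r u \<beta>(v, w)\<close>, with \<open>u\<close> the frequency. By
  \<open>mode_mag_deriv\<close> this is \<open>- (r / pi) \<beta>(v, w)\<close> times the action of
  the derivative along \<open>w\<close>, so that it combines with the derivative along
  \<open>v\<close> into the one along the transvected direction.\<close>

lemma propagator_has_derivative:
  assumes f: "f \<in> quasi_periodic \<beta> c"
  shows "(propagator \<beta> w \<gamma> r f has_derivative
    (\<lambda>v. propagator \<beta> w \<gamma> r (mag_deriv \<beta> (transvection \<beta> w (- (r / pi)) v) f) x
        + \<i> * of_real (pi * \<beta> x v) * propagator \<beta> w \<gamma> r f x)) (at x)"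
proof -
  note sm = quasi_periodic_smooth[OF \<beta> f]
  define B where "B v = transvection \<beta> w (- (r / pi)) v" for v
  \<comment> \<open>Any bounded convex neighbourhood of \<open>x\<close> would do; the decay of the
    modes is uniform on bounded sets only.\<close>
  let ?S = "ball (0 :: real^'n) (norm x + 1)"
  let ?R = "norm x + 1"
  define u where "u n y = cis (r * (of_int n + \<gamma> - \<beta> y w)\<^sup>2)" for n y
  define t where "t n y = u n y * mode \<beta> w \<gamma> n f y" for n y
  define t' where "t' n y v = u n y * mode \<beta> w \<gamma> n (mag_deriv \<beta> (B v) f) y + \<i> * of_real (pi * \<beta> y v) * t n y" for n y v
  have D: "(t n has_derivative t' n y) (at y)" for n y
  proof -
    have "(u n has_derivative (\<lambda>v. \<i> * of_real (r * (2 * (of_int n + \<gamma> - \<beta> y w) * - \<beta> v w)) * u n y)) (at y)"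
      unfolding u_def
      by (rule has_derivative_cis_real)
        (auto intro!: derivative_eq_intros bounded_linear_imp_has_derivative bounded_linear_left[OF \<beta>])
    from has_derivative_mult[OF this mode_has_derivative[OF \<beta> sm]]
    have "(t n has_derivative (\<lambda>v. u n y * (mode \<beta> w \<gamma> n (mag_deriv \<beta> v f) y + \<i> * of_real (pi * \<beta> y v) * mode \<beta> w \<gamma> n f y)
        + \<i> * of_real (r * (2 * (of_int n + \<gamma> - \<beta> y w) * - \<beta> v w)) * u n y * mode \<beta> w \<gamma> n f y)) (at y)"
      unfolding t_def .
    moreover have "u n y * (mode \<beta> w \<gamma> n (mag_deriv \<beta> v f) y + \<i> * of_real (pi * \<beta> y v) * mode \<beta> w \<gamma> n f y)
        + \<i> * of_real (r * (2 * (of_int n + \<gamma> - \<beta> y w) * - \<beta> v w)) * u n y * mode \<beta> w \<gamma> n f y = t' n y v" for v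
    proof -
      have "mode \<beta> w \<gamma> n (mag_deriv \<beta> (B v) f) y = mode \<beta> w \<gamma> n (mag_deriv \<beta> v f) y
          + of_real (- (r / pi) * \<beta> v w) * (2 * pi * \<i> * of_real (of_int n + \<gamma> - \<beta> y w) * mode \<beta> w \<gamma> n f y)"
        unfolding B_def transvection_def mode_mag_deriv_add[OF \<beta> sm] mode_mag_deriv[OF f] ..
      also have "of_real (- (r / pi) * \<beta> v w) * (2 * pi * \<i> * of_real (of_int n + \<gamma> - \<beta> y w) * mode \<beta> w \<gamma> n f y)
          = \<i> * of_real (r * (2 * (of_int n + \<gamma> - \<beta> y w) * - \<beta> v w)) * mode \<beta> w \<gamma> n f y"
        by simp
      finally show ?thesis by (simp only: t'_def t_def) (simp only: ring_distribs mult_ac add_ac)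
    qed
    ultimately show ?thesis by simp
  qed
  obtain C where C: "\<And>n y. norm y \<le> ?R \<Longrightarrow> norm (mode \<beta> w \<gamma> n f y) \<le> C / (1 + (real_of_int n)\<^sup>2)"
    using mode_bound[OF f, of ?R] by blast
  have "\<exists>C. \<forall>n y. norm y \<le> ?R \<longrightarrow> norm (mode \<beta> w \<gamma> n (mag_deriv \<beta> (B v) f) y) \<le> C / (1 + (real_of_int n)\<^sup>2)" for v
    using mode_bound[OF mag_deriv_quasi_periodic[OF \<beta> f], of ?R "B v"] by blast
  then obtain C' where C': "\<And>v n y. norm y \<le> ?R \<Longrightarrow> norm (mode \<beta> w \<gamma> n (mag_deriv \<beta> (B v) f) y) \<le> C' v / (1 + (real_of_int n)\<^sup>2)"
    by metis
  have "\<exists>K\<ge>0. \<forall>y. norm y \<le> ?R \<longrightarrow> \<bar>\<beta> y v\<bar> \<le> K" for v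
  proof -
    have "bounded ((\<lambda>x. \<beta> x v) ` cball 0 ?R)"
      by (intro compact_imp_bounded compact_continuous_image continuous_intros continuous_on_form[OF \<beta>]) auto
    then obtain K where "\<And>y. y \<in> cball 0 ?R \<Longrightarrow> \<bar>\<beta> y v\<bar> \<le> K" unfolding bounded_iff by fastforce
    then show ?thesis by (intro exI[of _ "\<bar>K\<bar>"]) force
  qed
  then obtain K where K: "\<And>v. K v \<ge> 0" "\<And>v y. norm y \<le> ?R \<Longrightarrow> \<bar>\<beta> y v\<bar> \<le> K v" by metis
  \<comment> \<open>The bounds \<open>C'\<close> and \<open>K\<close> depend on the direction.
    Summing them over the basis gives one constant that works for all directions by
    linearity.\<close>
  define A where "A = (\<Sum>b\<in>Basis. C' b + pi * K b * C)"
  have bound': "norm (t' n y v) \<le> norm v * (A / (1 + (real_of_int n)\<^sup>2))" if y: "y \<in> ?S" for n y v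
  proof -
    have yR: "norm y \<le> ?R" using y by simp
    have lin: "linear (t' n y)" by (rule has_derivative_linear[OF D])
    let ?d = "1 + (real_of_int n)\<^sup>2"
    have "t' n y v = t' n y (\<Sum>b\<in>Basis. (v \<bullet> b) *\<^sub>R b)" by (simp add: euclidean_representation)
    also have "\<dots> = (\<Sum>b\<in>Basis. (v \<bullet> b) *\<^sub>R t' n y b)" by (simp add: linear_sum[OF lin] linear_cmul[OF lin])
    also have "norm \<dots> \<le> (\<Sum>b\<in>Basis. norm v * ((C' b + pi * K b * C) / ?d))"
    proof (rule sum_norm_le)
      fix b :: "real^'n" assume b: "b \<in> Basis"
      have "norm (t' n y b) \<le> norm (u n y * mode \<beta> w \<gamma> n (mag_deriv \<beta> (B b) f) y) + norm (\<i> * of_real (pi * \<beta> y b) * t n y)"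
        unfolding t'_def by (rule norm_triangle_ineq)
      also have "\<dots> = norm (mode \<beta> w \<gamma> n (mag_deriv \<beta> (B b) f) y) + pi * \<bar>\<beta> y b\<bar> * norm (mode \<beta> w \<gamma> n f y)"
        by (simp add: norm_mult t_def u_def abs_mult)
      also have "\<dots> \<le> C' b / ?d + pi * K b * (C / ?d)"
        using K(2)[OF yR, of b] C[OF yR, of n] C'[OF yR, of n b] K(1)[of b]
        by (intro add_mono mult_mono mult_left_mono) auto
      also have "\<dots> = (C' b + pi * K b * C) / ?d" by (simp add: add_divide_distrib)
      finally have tb: "norm (t' n y b) \<le> (C' b + pi * K b * C) / ?d" .
      have "norm ((v \<bullet> b) *\<^sub>R t' n y b) = \<bar>v \<bullet> b\<bar> * norm (t' n y b)" by simp
      also have "\<dots> \<le> norm v * ((C' b + pi * K b * C) / ?d)"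
        using Basis_le_norm[OF b, of v] tb by (intro mult_mono) auto
      finally show "norm ((v \<bullet> b) *\<^sub>R t' n y b) \<le> norm v * ((C' b + pi * K b * C) / ?d)" .
    qed
    also have "\<dots> = norm v * (A / ?d)"
      by (simp add: A_def sum_distrib_left sum_divide_distrib)
    finally show ?thesis .
  qed
  have "((\<lambda>y. \<Sum>\<^sub>\<infinity>n. t n y) has_derivative (\<lambda>v. \<Sum>\<^sub>\<infinity>n. t' n x v)) (at x)"
  proof (rule has_derivative_infsum_int[OF open_ball convex_ball _ D _ bound'])
    show "norm (t n y) \<le> C / (1 + (real_of_int n)\<^sup>2)" if "y \<in> ?S" for n y
      using C[of y n] that by (simp add: t_def u_def norm_mult)
  qed auto
  moreover have "(\<Sum>\<^sub>\<infinity>n. t' n x v) = propagator \<beta> w \<gamma> r (mag_deriv \<beta> (B v) f) x + \<i> * of_real (pi * \<beta> x v) * propagator \<beta> w \<gamma> r f x" for v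
    unfolding t'_def t_def u_def propagator_def
    by (subst infsum_add)
      (auto intro!: propagator_summable f mag_deriv_quasi_periodic[OF \<beta>] summable_on_cmult_right simp: infsum_cmult_right')
  ultimately show ?thesis
    by (simp add: B_def propagator_def[abs_def] t_def u_def)
qed

lemma mag_deriv_propagator:
  assumes "f \<in> quasi_periodic \<beta> c"
  shows "mag_deriv \<beta> v (propagator \<beta> w \<gamma> r f) = propagator \<beta> w \<gamma> r (mag_deriv \<beta> (transvection \<beta> w (- (r / pi)) v) f)"
  by (rule ext) (rule mag_deriv_eqI[OF \<beta> propagator_has_derivative[OF assms]])

text \<open>Bootstrapping: the derivative of a propagated function consists of another propagated
  quasi-periodic function and a linear function times the original. The induction hypothesis must
  therefore hold for all quasi-periodic functions.\<close>

lemma smooth_propagator: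
  assumes "f \<in> quasi_periodic \<beta> c"
  shows "smooth_on UNIV (propagator \<beta> w \<gamma> r f)"
proof -
  have "Ck_on k UNIV (propagator \<beta> w \<gamma> r f)" for k
    using assms
  proof (induction k arbitrary: f)
    case 0
    then show ?case
      by (auto intro!: continuous_at_imp_continuous_on has_derivative_continuous[OF propagator_has_derivative])
  next
    case (Suc k)
    have "bounded_linear (\<lambda>x. \<i> * complex_of_real (pi * \<beta> x v))" for v
      by (intro bounded_linear_const_mult bounded_linear_of_real[THEN bounded_linear_compose] bounded_linear_left[OF \<beta>])
    then show ?case
      by (intro Ck_on_SucI[OF open_UNIV propagator_has_derivative[OF Suc.prems]] Ck_on_add Ck_on_mult
          Ck_on_linear Suc.IH mag_deriv_quasi_periodic[OF \<beta>] Suc.prems) auto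
  qed
  then show ?thesis by (simp add: smooth_on_def)
qed

text \<open>Moving the base point by \<open>z\<close> changes the frame of the loop by a factor
  winding \<open>p\<close> times, which shifts the Fourier index.\<close>

lemma mode_translate:
  assumes f: "f \<in> quasi_periodic \<beta> c" and z: "z \<in> int_lattice" and p: "\<beta> z w = of_int p"
  shows "mode \<beta> w \<gamma> n f (x + z) = c z * cis (pi * \<beta> z x) * mode \<beta> w \<gamma> (n - p) f x"
proof -
  have "mode \<beta> w \<gamma> n f (x + z) =
      integral {0..1} (\<lambda>s. c z * cis (pi * \<beta> z x) * (loop \<beta> w \<gamma> f x s * cis (- (2 * pi * (n - p) * s))))"
    unfolding mode_def fourier_coeff_def
  proof (rule integral_cong)
    fix s :: real
    have xz: "x + z + s *\<^sub>R w = x + s *\<^sub>R w + z" by simp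
    have "f (x + z + s *\<^sub>R w) = c z * cis (pi * \<beta> z (x + s *\<^sub>R w)) * f (x + s *\<^sub>R w)"
      unfolding xz using f z unfolding quasi_periodic_def by blast
    moreover have "cis (pi * \<beta> z (x + s *\<^sub>R w)) * (cis (pi * (\<beta> (x + z) w - 2 * \<gamma>) * s) * cis (- (2 * pi * n * s))) =
       cis (pi * \<beta> z x) * (cis (pi * (\<beta> x w - 2 * \<gamma>) * s) * cis (- (2 * pi * (n - p) * s)))"
      by (simp add: cis_mult bilinear_simps[OF \<beta>(1)] p algebra_simps)
    ultimately show "loop \<beta> w \<gamma> f (x + z) s * cis (- (2 * pi * n * s)) =
      c z * cis (pi * \<beta> z x) * (loop \<beta> w \<gamma> f x s * cis (- (2 * pi * (n - p) * s)))"
      by (simp add: loop_def mult_ac)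
  qed
  then show ?thesis by (simp add: mode_def fourier_coeff_def)
qed

text \<open>At \<open>x + z\<close> the frequency of index \<open>n\<close> equals the frequency at
  \<open>x\<close> of index \<open>n - p\<close>, so the phases follow the shift of the modes and
  the sum is merely reindexed.\<close>

lemma propagator_quasi_periodic:
  assumes f: "f \<in> quasi_periodic \<beta> c" and int: "\<And>z. z \<in> int_lattice \<Longrightarrow> \<beta> z w \<in> \<int>"
  shows "propagator \<beta> w \<gamma> r f \<in> quasi_periodic \<beta> c"
proof -
  have "propagator \<beta> w \<gamma> r f (x + z) = c z * cis (pi * \<beta> z x) * propagator \<beta> w \<gamma> r f x" if z: "z \<in> int_lattice" for x z
  proof -
    obtain p where p: "\<beta> z w = of_int p" using int[OF z] by (auto elim: Ints_cases)
    let ?t = "\<lambda>n. cis (r * (of_int n + \<gamma> - \<beta> x w)\<^sup>2) * mode \<beta> w \<gamma> n f x"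
    have "propagator \<beta> w \<gamma> r f (x + z) = (\<Sum>\<^sub>\<infinity>n. c z * cis (pi * \<beta> z x) * ?t (n - p))"
      unfolding propagator_def mode_translate[OF f z p]
      by (intro infsum_cong) (simp add: bilinear_simps[OF \<beta>(1)] p algebra_simps)
    also have "\<dots> = c z * cis (pi * \<beta> z x) * (\<Sum>\<^sub>\<infinity>n. ?t (n - p))" by (rule infsum_cmult_right')
    also have "(\<Sum>\<^sub>\<infinity>n. ?t (n - p)) = (\<Sum>\<^sub>\<infinity>n. ?t n)"
    proof (rule infsum_reindex_bij_betw)
      show "bij_betw (\<lambda>n. n - p) UNIV UNIV"
        by (rule bij_betw_byWitness[of _ "\<lambda>n. n + p"]) auto
    qed
    finally show ?thesis by (simp add: propagator_def)
  qed
  then show ?thesis using smooth_propagator[OF f] by (auto simp: quasi_periodic_def)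
qed

text \<open>Along the loop the mode solves the scalar equation \<open>y' = i a y\<close> with
  constant \<open>a\<close>, because \<open>\<beta> w w = 0\<close>.\<close>

lemma mode_flow:
  assumes f: "f \<in> quasi_periodic \<beta> c"
  shows "mode \<beta> w \<gamma> m f (x + s *\<^sub>R w) * cis (pi * (\<beta> x w - 2 * \<gamma>) * s) = mode \<beta> w \<gamma> m f x * cis (2 * pi * of_int m * s)"
proof -
  note sm = quasi_periodic_smooth[OF \<beta> f]
  define a where "a = pi * (2 * of_int m + 2 * \<gamma> - \<beta> x w)"
  define y where "y s = mode \<beta> w \<gamma> m f (x + s *\<^sub>R w)" for s
  have y: "(y has_vector_derivative \<i> * a * y s) (at s within UNIV)" for s
  proof -
    have "((\<lambda>s. x + s *\<^sub>R w) has_vector_derivative w) (at s)"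
      by (auto intro!: derivative_eq_intros)
    from vector_derivative_diff_chain_within[OF this has_derivative_at_withinI[OF mode_has_derivative[OF \<beta> sm]]]
    have "(y has_vector_derivative mode \<beta> w \<gamma> m (mag_deriv \<beta> w f) (x + s *\<^sub>R w) + \<i> * of_real (pi * \<beta> (x + s *\<^sub>R w) w) * y s) (at s)"
      unfolding o_def y_def .
    then show ?thesis
      by (rule has_vector_derivative_eq_rhs)
        (simp add: mode_mag_deriv[OF f] y_def a_def bilinear_simps[OF \<beta>(1)] \<beta>(2) algebra_simps)
  qed
  have "((\<lambda>s. y s * cis (- a * s)) has_vector_derivative 0) (at s within UNIV)" for s
    using has_vector_derivative_mult[OF y has_vector_derivative_cis_linear[of "- a"]]
    by (rule has_vector_derivative_eq_rhs) (simp add: algebra_simps)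
  then have Z: "((\<lambda>s. y s * cis (- a * s)) has_vector_derivative 0) (at s within UNIV)" if "s \<in> UNIV" for s .
  obtain k where k: "\<And>s. s \<in> UNIV \<Longrightarrow> y s * cis (- a * s) = k"
    by (rule has_vector_derivative_zero_constant[OF convex_UNIV Z]) (assumption, rule that)
  have "y s * cis (- a * s) = y 0 * cis (- a * 0)" using k[of s] k[of 0] by simp
  then have "y s * (cis (- a * s) * cis (a * s)) = y 0 * cis (a * s)" by simp
  then have "y s = mode \<beta> w \<gamma> m f x * cis (a * s)" by (simp add: cis_mult y_def)
  moreover have "cis (a * s) * cis (pi * (\<beta> x w - 2 * \<gamma>) * s) = cis (2 * pi * of_int m * s)"
    by (simp add: cis_mult a_def algebra_simps)
  ultimately show ?thesis by (simp add: y_def mult.assoc)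
qed

text \<open>The phases are constant along the loop. By \<open>mode_flow\<close> the loop of the
  propagated function is thus a Fourier series with explicit, quadratically decaying coefficients,
  which can be read off.\<close>

lemma mode_propagator:
  assumes f: "f \<in> quasi_periodic \<beta> c"
  shows "mode \<beta> w \<gamma> n (propagator \<beta> w \<gamma> r f) x = cis (r * (of_int n + \<gamma> - \<beta> x w)\<^sup>2) * mode \<beta> w \<gamma> n f x"
proof -
  let ?a = "\<lambda>n. cis (r * (of_int n + \<gamma> - \<beta> x w)\<^sup>2) * mode \<beta> w \<gamma> n f x"
  have "loop \<beta> w \<gamma> (propagator \<beta> w \<gamma> r f) x s = (\<Sum>\<^sub>\<infinity>m. ?a m * cis (2 * pi * of_int m * s))" for s
  proof -
    have "loop \<beta> w \<gamma> (propagator \<beta> w \<gamma> r f) x s =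
        (\<Sum>\<^sub>\<infinity>m. cis (r * (of_int m + \<gamma> - \<beta> x w)\<^sup>2) * mode \<beta> w \<gamma> m f (x + s *\<^sub>R w) * cis (pi * (\<beta> x w - 2 * \<gamma>) * s))"
      by (simp add: loop_def propagator_def infsum_cmult_left' bilinear_simps[OF \<beta>(1)] \<beta>(2))
    also have "\<dots> = (\<Sum>\<^sub>\<infinity>m. ?a m * cis (2 * pi * of_int m * s))"
    proof (rule infsum_cong)
      fix m
      have "X * Y * Z = X * Y' * Z'" if "Y * Z = Y' * Z'" for X Y Z Y' Z' :: complex
        using that by (simp add: mult.assoc)
      then show "cis (r * (of_int m + \<gamma> - \<beta> x w)\<^sup>2) * mode \<beta> w \<gamma> m f (x + s *\<^sub>R w) * cis (pi * (\<beta> x w - 2 * \<gamma>) * s) =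
          ?a m * cis (2 * pi * of_int m * s)"
        using mode_flow[OF f] by blast
    qed
    finally show ?thesis .
  qed
  then have eq: "loop \<beta> w \<gamma> (propagator \<beta> w \<gamma> r f) x = (\<lambda>s. \<Sum>\<^sub>\<infinity>m. ?a m * cis (2 * pi * of_int m * s))" by blast
  obtain C where "\<And>n y. norm y \<le> norm x \<Longrightarrow> norm (mode \<beta> w \<gamma> n f y) \<le> C / (1 + (real_of_int n)\<^sup>2)"
    using mode_bound[OF f, of "norm x"] by blast
  then have bound: "norm (?a n) \<le> C / (1 + (real_of_int n)\<^sup>2)" for n by (simp add: norm_mult)
  show ?thesis
    unfolding mode_def[of _ _ _ _ "propagator _ _ _ _ _"] eq by (rule fourier_coeff_series(1)[of ?a, OF bound])
qed

text \<open>The opposite phases cancel, leaving the sum of the Fourier coefficients of the loop;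
  Fourier inversion at parameter 0 returns \<open>f x\<close>.\<close>

lemma propagator_inverse:
  assumes f: "f \<in> quasi_periodic \<beta> c"
  shows "propagator \<beta> w \<gamma> (- r) (propagator \<beta> w \<gamma> r f) = f"
proof
  fix x
  note sm = quasi_periodic_smooth[OF \<beta> f]
  have "propagator \<beta> w \<gamma> (- r) (propagator \<beta> w \<gamma> r f) x = (\<Sum>\<^sub>\<infinity>n. fourier_coeff (loop \<beta> w \<gamma> f x) n)"
    unfolding propagator_def[of _ _ _ "- r"] mode_propagator[OF f]
    by (intro infsum_cong) (simp add: mode_def mult.assoc[symmetric] cis_mult)
  also have "\<dots> = loop \<beta> w \<gamma> f x 0"
  proof (rule fourier_inversion)
    show "continuous_on {0..1} (loop \<beta> w \<gamma> f x)" by (rule continuous_on_loop[OF \<beta> sm])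
    show "(fourier_coeff (loop \<beta> w \<gamma> f x) has_sum (\<Sum>\<^sub>\<infinity>n. fourier_coeff (loop \<beta> w \<gamma> f x) n)) UNIV"
      using propagator_summable[OF f, of "\<lambda>_. 0" x] by (simp add: mode_def)
  qed (rule loop_periodic[OF f] loop_has_vector_derivative[OF \<beta> sm])+
  finally show "propagator \<beta> w \<gamma> (- r) (propagator \<beta> w \<gamma> r f) x = f x" by (simp add: loop_def)
qed

lemma propagator_linear:
  assumes "f \<in> quasi_periodic \<beta> c" "g \<in> quasi_periodic \<beta> c"
  shows "propagator \<beta> w \<gamma> r (\<lambda>x. a * f x + b * g x) x = a * propagator \<beta> w \<gamma> r f x + b * propagator \<beta> w \<gamma> r g x"
proof -
  note s = propagator_summable[OF assms(1)] propagator_summable[OF assms(2)]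
  have "propagator \<beta> w \<gamma> r (\<lambda>x. a * f x + b * g x) x =
      (\<Sum>\<^sub>\<infinity>n. a * (cis (r * (of_int n + \<gamma> - \<beta> x w)\<^sup>2) * mode \<beta> w \<gamma> n f x) + b * (cis (r * (of_int n + \<gamma> - \<beta> x w)\<^sup>2) * mode \<beta> w \<gamma> n g x))"
    unfolding propagator_def
    by (simp add: mode_linear[OF \<beta> quasi_periodic_smooth[OF \<beta> assms(1)] quasi_periodic_smooth[OF \<beta> assms(2)]] algebra_simps)
  also have "\<dots> = a * propagator \<beta> w \<gamma> r f x + b * propagator \<beta> w \<gamma> r g x"
    unfolding propagator_def by (subst infsum_add) (auto intro!: summable_on_cmult_right s simp: infsum_cmult_right')
  finally show ?thesis .
qed

end

section \<open>Parallel frames of prequantum line bundles\<close>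

text \<open>The Poincare lemma on a ball: the primitive at \<open>y\<close> is the integral of the
  form along the segment from \<open>p\<close> to \<open>y\<close>.\<close>

lemma closed_form_exact:
  fixes \<alpha> :: "'a::euclidean_space \<Rightarrow> 'a \<Rightarrow> 'b::euclidean_space"
  assumes lin: "\<And>y. y \<in> ball p e \<Longrightarrow> linear (\<alpha> y)"
    and sm: "\<And>v. smooth_on (ball p e) (\<lambda>y. \<alpha> y v)"
    and closed: "\<And>y u v. y \<in> ball p e \<Longrightarrow>
      frechet_derivative (\<lambda>y. \<alpha> y v) (at y) u = frechet_derivative (\<lambda>y. \<alpha> y u) (at y) v"
  obtains \<psi> where "\<And>y. y \<in> ball p e \<Longrightarrow> (\<psi> has_derivative \<alpha> y) (at y)"
proof -
  let ?B = "ball p e"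
  define D where "D v y u = frechet_derivative (\<lambda>y. \<alpha> y v) (at y) u" for v y u
  have D: "((\<lambda>y. \<alpha> y v) has_derivative D v y) (at y)" if "y \<in> ?B" for v y
    using smooth_on_has_derivative[OF sm _ that] by (simp add: D_def[abs_def])
  have smD: "smooth_on ?B (\<lambda>y. D v y u)" for u v
    unfolding D_def by (rule smooth_on_derivative[OF sm])
  have exp\<alpha>: "\<alpha> y u = (\<Sum>b\<in>Basis. (u \<bullet> b) *\<^sub>R \<alpha> y b)" if "y \<in> ?B" for y u
  proof -
    have "\<alpha> y u = \<alpha> y (\<Sum>b\<in>Basis. (u \<bullet> b) *\<^sub>R b)" by (simp add: euclidean_representation)
    then show ?thesis by (simp add: linear_sum[OF lin[OF that]] linear_cmul[OF lin[OF that]])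
  qed
  have expD: "D v y u = (\<Sum>b\<in>Basis. (u \<bullet> b) *\<^sub>R D v y b)" if "y \<in> ?B" for y u v
  proof -
    note l = has_derivative_linear[OF D[OF that, of v]]
    have "D v y u = D v y (\<Sum>b\<in>Basis. (u \<bullet> b) *\<^sub>R b)" by (simp add: euclidean_representation)
    then show ?thesis by (simp add: linear_sum[OF l] linear_cmul[OF l])
  qed
  have q: "p + s *\<^sub>R (y - p) \<in> ?B" if "y \<in> ?B" "s \<in> {0..1}" for s y
  proof -
    have "p + s *\<^sub>R (y - p) = (1 - s) *\<^sub>R p + s *\<^sub>R y" by (simp add: algebra_simps)
    moreover have "p \<in> ?B" using that(1) by (metis ball_eq_empty centre_in_ball empty_iff not_le)
    ultimately show ?thesis using that convexD_alt[OF convex_ball, of p p e y s] by simp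
  qed
  \<comment> \<open>The integrand \<open>\<alpha> (p + s (y - p)) (y - p)\<close>, expanded in the
    basis because smoothness is given for each fixed argument of the form.\<close>
  define f where "f y s = (\<Sum>b\<in>Basis. ((y - p) \<bullet> b) *\<^sub>R \<alpha> (p + s *\<^sub>R (y - p)) b)" for y s
  define f' where "f' y s v = \<alpha> (p + s *\<^sub>R (y - p)) v + s *\<^sub>R D v (p + s *\<^sub>R (y - p)) (y - p)" for y s v
  have fd: "((\<lambda>y. f y s) has_derivative f' y s) (at y)" if y: "y \<in> ?B" and s: "s \<in> {0..1}" for y s
  proof -
    let ?q = "p + s *\<^sub>R (y - p)"
    note qB = q[OF y s]
    have "((\<lambda>y. p + s *\<^sub>R (y - p)) has_derivative (\<lambda>v. s *\<^sub>R v)) (at y)"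
      by (auto intro!: derivative_eq_intros)
    from has_derivative_compose[OF this D[OF qB]]
    have "((\<lambda>y. \<alpha> (p + s *\<^sub>R (y - p)) b) has_derivative (\<lambda>v. D b ?q (s *\<^sub>R v))) (at y)" for b .
    moreover have "((\<lambda>y. (y - p) \<bullet> b) has_derivative (\<lambda>v. v \<bullet> b)) (at y)" for b
      by (auto intro!: derivative_eq_intros)
    ultimately have "((\<lambda>y. f y s) has_derivative
        (\<lambda>v. \<Sum>b\<in>Basis. ((y - p) \<bullet> b) *\<^sub>R D b ?q (s *\<^sub>R v) + (v \<bullet> b) *\<^sub>R \<alpha> ?q b)) (at y)"
      unfolding f_def by (intro has_derivative_sum has_derivative_scaleR)
    moreover have "(\<Sum>b\<in>Basis. ((y - p) \<bullet> b) *\<^sub>R D b ?q (s *\<^sub>R v) + (v \<bullet> b) *\<^sub>R \<alpha> ?q b) = f' y s v" for v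
    proof -
      have "D b ?q (s *\<^sub>R v) = s *\<^sub>R D v ?q b" for b
        using linear_cmul[OF has_derivative_linear[OF D[OF qB, of b]], of s v] closed[OF qB, of b v]
        by (simp add: D_def)
      then have "(\<Sum>b\<in>Basis. ((y - p) \<bullet> b) *\<^sub>R D b ?q (s *\<^sub>R v)) = s *\<^sub>R (\<Sum>b\<in>Basis. ((y - p) \<bullet> b) *\<^sub>R D v ?q b)"
        by (simp add: scaleR_sum_right mult.commute)
      then show ?thesis
        unfolding sum.distrib f'_def expD[OF qB, of v "y - p", symmetric] exp\<alpha>[OF qB, of v, symmetric] by simp
    qed
    ultimately show ?thesis by simp
  qed
  have cq: "continuous_on (?B \<times> {0..1}) (\<lambda>x. p + snd x *\<^sub>R (fst x - p))"
    by (intro continuous_intros)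
  have qim: "(\<lambda>x. p + snd x *\<^sub>R (fst x - p)) ` (?B \<times> {0..1}) \<subseteq> ?B" using q by auto
  note cc = continuous_on_compose2[OF smooth_on_continuous cq qim]
  have f'c: "continuous_on (?B \<times> {0..1}) (\<lambda>(y, s). f' y s v)" for v
  proof -
    have "continuous_on (?B \<times> {0..1}) (\<lambda>x. \<alpha> (p + snd x *\<^sub>R (fst x - p)) v +
        snd x *\<^sub>R (\<Sum>b\<in>Basis. ((fst x - p) \<bullet> b) *\<^sub>R D v (p + snd x *\<^sub>R (fst x - p)) b))"
      by (intro continuous_intros cc[OF sm] cc[OF smD])
    then show ?thesis
      by (rule continuous_on_eq) (use expD[OF q] in \<open>auto simp: f'_def\<close>)
  qed
  have fc: "continuous_on {0..1} (f y)" if "y \<in> ?B" for y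
  proof -
    have "continuous_on {0..1} (\<lambda>s. p + s *\<^sub>R (y - p))" by (intro continuous_intros)
    moreover have "(\<lambda>s. p + s *\<^sub>R (y - p)) ` {0..1} \<subseteq> ?B" using q[OF that] by auto
    ultimately show ?thesis unfolding f_def
      by (intro continuous_intros continuous_on_compose2[OF smooth_on_continuous[OF sm]])
  qed
  have "((\<lambda>y. integral {0..1} (f y)) has_derivative \<alpha> y) (at y)" if y: "y \<in> ?B" for y
  proof -
    have "((\<lambda>y. integral {0..1} (f y)) has_derivative (\<lambda>v. integral {0..1} (\<lambda>s. f' y s v))) (at y)"
      by (rule leibniz_has_derivative[OF open_ball convex_ball y fd f'c fc])
    moreover have "integral {0..1} (\<lambda>s. f' y s v) = \<alpha> y v" for v
    proof (rule integral_unique)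
      \<comment> \<open>Closedness has brought the differentiated integrand into the form of the
        \<open>s\<close>-derivative of
        \<open>s *\<^sub>R \<alpha> (p + s *\<^sub>R (y - p)) v\<close>.\<close>
      have "((\<lambda>s. f' y s v) has_integral 1 *\<^sub>R \<alpha> (p + 1 *\<^sub>R (y - p)) v - 0 *\<^sub>R \<alpha> (p + 0 *\<^sub>R (y - p)) v) {0..1}"
      proof (rule fundamental_theorem_of_calculus)
        fix s :: real assume s: "s \<in> {0..1}"
        have "((\<lambda>s. p + s *\<^sub>R (y - p)) has_vector_derivative y - p) (at s within {0..1})"
          by (auto intro!: derivative_eq_intros)
        from vector_derivative_diff_chain_within[OF this has_derivative_at_withinI[OF D[OF q[OF y s]]]]
        have "((\<lambda>s. \<alpha> (p + s *\<^sub>R (y - p)) v) has_vector_derivative D v (p + s *\<^sub>R (y - p)) (y - p)) (at s within {0..1})"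
          by (simp add: o_def)
        moreover have "((\<lambda>s. s) has_real_derivative 1) (at s within {0..1})" by (rule DERIV_ident)
        ultimately have "((\<lambda>s. s *\<^sub>R \<alpha> (p + s *\<^sub>R (y - p)) v) has_vector_derivative
            s *\<^sub>R D v (p + s *\<^sub>R (y - p)) (y - p) + 1 *\<^sub>R \<alpha> (p + s *\<^sub>R (y - p)) v) (at s within {0..1})"
          by (intro has_vector_derivative_scaleR)
        then show "((\<lambda>s. s *\<^sub>R \<alpha> (p + s *\<^sub>R (y - p)) v) has_vector_derivative f' y s v) (at s within {0..1})"
          by (simp add: f'_def add.commute)
      qed simp
      then show "((\<lambda>s. f' y s v) has_integral \<alpha> y v) {0..1}" by simp
    qed
    ultimately show ?thesis by simp
  qed
  then show ?thesis by (rule that)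
qed

section \<open>Derivatives on the torus and neighbourhoods of segments\<close>

lemma proj_translate: "z \<in> int_lattice \<Longrightarrow> proj (y + z) = proj y"
  by (simp add: proj_eq_iff_lattice)

lemma torus_rep_proj:
  obtains z where "z \<in> int_lattice" "torus_rep (proj y) = y + z"
proof -
  have "proj (torus_rep (proj y)) = proj y" by simp
  then have "torus_rep (proj y) - y \<in> int_lattice" by (simp only: proj_eq_iff_lattice)
  then show ?thesis using that[of "torus_rep (proj y) - y"] by simp
qed

text \<open>The definition differentiates at the chosen representative; by periodicity every other
  lift of the point gives the same derivative.\<close>

lemma torus_deriv_proj: "torus_deriv f (proj y) v = frechet_derivative (\<lambda>y. f (proj y)) (at y) v"
proof -
  obtain z where z: "z \<in> int_lattice" "torus_rep (proj y) = y + z" by (rule torus_rep_proj)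
  have "((\<lambda>y. f (proj y)) has_derivative D) (at (y + z)) \<longleftrightarrow> ((\<lambda>y. f (proj y)) has_derivative D) (at y)" for D
    using has_derivative_translate[of "\<lambda>y. f (proj y)" D y z]
      has_derivative_translate[of "\<lambda>y. f (proj y)" D "y + z" "- z"]
      proj_translate[OF z(1)] proj_translate[OF int_lattice_closed(4)[OF z(1)]] by auto
  then show ?thesis by (simp add: torus_deriv_def z(2) frechet_derivative_def)
qed

text \<open>A neighbourhood of the part of the ray through \<open>y\<close> with parameters in
  \<open>{a..b}\<close>. It is convex, so two such sets meet in a connected set, as gluing of frames
  requires.\<close>

definition tube :: "'a::real_normed_vector \<Rightarrow> real \<Rightarrow> real \<Rightarrow> real \<Rightarrow> 'a set" where
  "tube y d a b = (\<Union>s\<in>{a..b}. ball (s *\<^sub>R y) d)"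

lemma open_tube: "open (tube y d a b)"
  by (simp add: tube_def open_UN)

lemma tube_mono: "d \<le> d' \<Longrightarrow> tube y d a b \<subseteq> tube y d' a b"
  unfolding tube_def by (intro UN_mono subset_ball) auto

lemma mem_tube: "d > 0 \<Longrightarrow> s \<in> {a..b} \<Longrightarrow> s *\<^sub>R y \<in> tube y d a b"
  unfolding tube_def by force

text \<open>The tube is the Minkowski sum of a segment and a ball.\<close>

lemma convex_tube: "convex (tube y d a b)"
proof -
  have "tube y d a b = (\<Union>x\<in>(\<lambda>s. s *\<^sub>R y) ` {a..b}. \<Union>z\<in>ball 0 d. {x + z})"
  proof (intro equalityI subsetI)
    fix x assume "x \<in> tube y d a b"
    then obtain s where s: "s \<in> {a..b}" "x \<in> ball (s *\<^sub>R y) d" by (auto simp: tube_def)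
    then have "x - s *\<^sub>R y \<in> ball 0 d" by (simp add: dist_norm norm_minus_commute)
    moreover have "x = s *\<^sub>R y + (x - s *\<^sub>R y)" by simp
    ultimately show "x \<in> (\<Union>x\<in>(\<lambda>s. s *\<^sub>R y) ` {a..b}. \<Union>z\<in>ball 0 d. {x + z})" using s(1) by blast
  next
    fix x assume "x \<in> (\<Union>x\<in>(\<lambda>s. s *\<^sub>R y) ` {a..b}. \<Union>z\<in>ball 0 d. {x + z})"
    then obtain s z where s: "s \<in> {a..b}" "norm z < d" "x = s *\<^sub>R y + z" by auto
    have "x \<in> ball (s *\<^sub>R y) d" using s(2) by (simp add: s(3) dist_norm)
    then show "x \<in> tube y d a b" using s(1) unfolding tube_def by blast
  qed
  moreover have "convex ((\<lambda>s. s *\<^sub>R y) ` {a..b})"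
    by (intro convex_linear_image convex_real_interval bounded_linear.linear bounded_linear_scaleR_left)
  ultimately show ?thesis by (simp only: convex_sums convex_ball)
qed

text \<open>
  A parallel frame of the pullback of the bundle to \<open>R\<^sup>n\<close>, for the flat connection which is
  the difference of the given one and the standard one \<open>d - i pi \<omega>(x, \<cdot>)\<close>.
\<close>

definition parallel_frame :: "(real^'n) tensor2 \<Rightarrow> 'n::finite cover \<Rightarrow> 'n transition \<Rightarrow> 'n connection \<Rightarrow>
    (real^'n) set \<Rightarrow> ('n torus \<Rightarrow> real^'n \<Rightarrow> complex) \<Rightarrow> bool" where
  "parallel_frame \<omega> U g \<theta> W \<phi> \<longleftrightarrow> (\<forall>a. \<forall>y\<in>W. proj y \<in> U a \<longrightarrow>
     cmod (\<phi> a y) = 1 \<and>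
     (\<phi> a has_derivative (\<lambda>v. (- \<i> * of_real (pi * \<omega> y v) - \<theta> a (proj y) v) * \<phi> a y)) (at y) \<and>
     (\<forall>b. proj y \<in> U b \<longrightarrow> \<phi> a y = g a b (proj y) * \<phi> b y))"

lemma parallel_frameD:
  assumes "parallel_frame \<omega> U g \<theta> W \<phi>" "y \<in> W" "proj y \<in> U a"
  shows "cmod (\<phi> a y) = 1"
    "(\<phi> a has_derivative (\<lambda>v. (- \<i> * of_real (pi * \<omega> y v) - \<theta> a (proj y) v) * \<phi> a y)) (at y)"
    "proj y \<in> U b \<Longrightarrow> \<phi> a y = g a b (proj y) * \<phi> b y"
  using assms unfolding parallel_frame_def by blast+

context
  fixes \<omega> :: "(real^'n::finite) tensor2" and U :: "'n cover" and g :: "'n transition" and \<theta> :: "'n connection"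
  assumes \<omega>: "bilinear \<omega>" "\<And>u. \<omega> u u = 0"
    and preq: "prequantum_bundle \<omega> U g \<theta>"
begin

lemma cover: "open (U a)" "a \<in> U a"
  and transition_smooth: "torus_smooth_on (U a \<inter> U b) (g a b)"
  and transition_norm: "x \<in> U a \<Longrightarrow> x \<in> U b \<Longrightarrow> cmod (g a b x) = 1"
  and transition_cocycle: "x \<in> U a \<Longrightarrow> x \<in> U b \<Longrightarrow> x \<in> U d \<Longrightarrow> g a b x * g b d x = g a d x"
  using preq by (auto simp: prequantum_bundle_def hermitian_line_bundle_def)

lemma connection_linear: "x \<in> U a \<Longrightarrow> linear (\<theta> a x)"
  and connection_smooth: "torus_smooth_on (U a) (\<lambda>x. \<theta> a x v)"
  and connection_imaginary: "x \<in> U a \<Longrightarrow> Re (\<theta> a x v) = 0"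
  and connection_transition: "x \<in> U a \<Longrightarrow> x \<in> U b \<Longrightarrow> \<theta> b x v = \<theta> a x v + torus_deriv (g a b) x v / g a b x"
  and curvature: "proj y \<in> U a \<Longrightarrow> ext_deriv (\<lambda>z. \<theta> a (proj z)) y u v = - 2 * of_real pi * \<i> * of_real (\<omega> u v)"
  using preq unfolding prequantum_bundle_def hermitian_connection_def has_curvature_def by blast+

lemma open_chart: "open (proj -` U a)"
  by (rule open_vimage_proj[OF cover(1)])

lemma frame_cong:
  assumes "open W" "parallel_frame \<omega> U g \<theta> W \<phi>"
    and "\<And>a y. y \<in> W \<Longrightarrow> proj y \<in> U a \<Longrightarrow> \<phi>' a y = \<phi> a y"
  shows "parallel_frame \<omega> U g \<theta> W \<phi>'"
  unfolding parallel_frame_def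
proof (intro allI ballI impI conjI)
  fix a y assume y: "y \<in> W" "proj y \<in> U a"
  note eq = assms(3)[OF y]
  show "cmod (\<phi>' a y) = 1" using parallel_frameD(1)[OF assms(2) y] eq by simp
  show "(\<phi>' a has_derivative (\<lambda>v. (- \<i> * of_real (pi * \<omega> y v) - \<theta> a (proj y) v) * \<phi>' a y)) (at y)"
    unfolding eq
    by (rule has_derivative_transform_within_open[OF parallel_frameD(2)[OF assms(2) y], of "W \<inter> proj -` U a"])
      (use y assms(1) open_chart assms(3) in auto)
  show "\<phi>' a y = g a b (proj y) * \<phi>' b y" if "proj y \<in> U b" for b
    using parallel_frameD(3)[OF assms(2) y that] eq assms(3)[OF y(1) that] by simp
qed

lemma frame_subset: "parallel_frame \<omega> U g \<theta> W \<phi> \<Longrightarrow> V \<subseteq> W \<Longrightarrow> parallel_frame \<omega> U g \<theta> V \<phi>"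
  unfolding parallel_frame_def by blast

lemma frame_union:
  "parallel_frame \<omega> U g \<theta> V \<phi> \<Longrightarrow> parallel_frame \<omega> U g \<theta> W \<phi> \<Longrightarrow> parallel_frame \<omega> U g \<theta> (V \<union> W) \<phi>"
  unfolding parallel_frame_def by blast

lemma frame_scale:
  assumes "parallel_frame \<omega> U g \<theta> W \<phi>" "cmod k = 1"
  shows "parallel_frame \<omega> U g \<theta> W (\<lambda>a y. k * \<phi> a y)"
  unfolding parallel_frame_def
proof (intro allI ballI impI conjI)
  fix a y assume y: "y \<in> W" "proj y \<in> U a"
  show "cmod (k * \<phi> a y) = 1" using parallel_frameD(1)[OF assms(1) y] assms(2) by (simp add: norm_mult)
  show "((\<lambda>y. k * \<phi> a y) has_derivative (\<lambda>v. (- \<i> * of_real (pi * \<omega> y v) - \<theta> a (proj y) v) * (k * \<phi> a y))) (at y)"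
    using has_derivative_mult_right[OF parallel_frameD(2)[OF assms(1) y], of k] by (simp add: mult_ac)
  show "k * \<phi> a y = g a b (proj y) * (k * \<phi> b y)" if "proj y \<in> U b" for b
    using parallel_frameD(3)[OF assms(1) y that] by simp
qed

text \<open>The ratio of two frames does not depend on the chart, since the transition functions are
  unitary. It is locally constant, since both frames solve the same linear equation with imaginary
  coefficient.\<close>

lemma frame_unique:
  assumes W: "open W" "connected W" "W \<noteq> {}"
    and \<phi>: "parallel_frame \<omega> U g \<theta> W \<phi>" "parallel_frame \<omega> U g \<theta> W \<phi>'"
  obtains k where "cmod k = 1" "\<And>a y. y \<in> W \<Longrightarrow> proj y \<in> U a \<Longrightarrow> \<phi>' a y = k * \<phi> a y"
proof -
  \<comment> \<open>The frames have modulus 1, so conjugation replaces division and keeps the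
    derivative computation simple. The chart at \<open>proj y\<close> serves as a canonical
    choice.\<close>
  define \<rho> where "\<rho> y = \<phi>' (proj y) y * cnj (\<phi> (proj y) y)" for y
  have unit: "x * cnj x = 1" if "cmod x = 1" for x using that complex_norm_square[of x] by simp
  have \<rho>: "\<rho> y = \<phi>' a y * cnj (\<phi> a y)" if y: "y \<in> W" "proj y \<in> U a" for a y
  proof -
    have "\<phi>' a y * cnj (\<phi> a y) = (g a (proj y) (proj y) * cnj (g a (proj y) (proj y))) * \<rho> y"
      unfolding \<rho>_def parallel_frameD(3)[OF \<phi>(1) y cover(2)] parallel_frameD(3)[OF \<phi>(2) y cover(2)] by simp
    then show ?thesis using unit[OF transition_norm[OF y(2) cover(2)]] by simp
  qed
  have \<phi>': "\<phi>' a y = \<rho> y * \<phi> a y" if y: "y \<in> W" "proj y \<in> U a" for a y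
    using unit[OF parallel_frameD(1)[OF \<phi>(1) y]] by (simp add: \<rho>[OF y] mult.assoc mult.commute[of "cnj _"])
  have const: "\<rho> x = \<rho> y" if "x \<in> W" "y \<in> W" for x y
  proof (rule locally_constant_eq[OF W(2) _ that])
    fix y0 assume y0: "y0 \<in> W"
    let ?a = "proj y0"
    have "open (W \<inter> proj -` U ?a)" "y0 \<in> W \<inter> proj -` U ?a" using W open_chart y0 cover by auto
    then obtain e where e: "e > 0" "ball y0 e \<subseteq> W \<inter> proj -` U ?a" using openE by blast
    have c0: "(\<lambda>y. \<phi>' ?a y * cnj (\<phi> ?a y)) y = (\<lambda>y. \<phi>' ?a y * cnj (\<phi> ?a y)) y0" if y: "y \<in> ball y0 e" for y
    proof (rule has_derivative_zero_unique[of "ball y0 e"])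
      fix y assume "y \<in> ball y0 e"
      then have y: "y \<in> W" "proj y \<in> U ?a" using e by auto
      define m where "m v = - \<i> * of_real (pi * \<omega> y v) - \<theta> ?a (proj y) v" for v
      have m: "cnj (m v) = - m v" for v
        using connection_imaginary[OF y(2), of v] by (simp add: m_def complex_eq_iff)
      have "((\<lambda>y. \<phi>' ?a y * cnj (\<phi> ?a y)) has_derivative
          (\<lambda>v. \<phi>' ?a y * cnj (m v * \<phi> ?a y) + m v * \<phi>' ?a y * cnj (\<phi> ?a y))) (at y)"
        using parallel_frameD(2)[OF \<phi>(1) y] parallel_frameD(2)[OF \<phi>(2) y] unfolding m_def
        by (intro has_derivative_mult has_derivative_cnj)
      moreover have "(\<lambda>v. \<phi>' ?a y * cnj (m v * \<phi> ?a y) + m v * \<phi>' ?a y * cnj (\<phi> ?a y)) = (\<lambda>v. 0)"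
        by (simp add: m)
      ultimately show "((\<lambda>y. \<phi>' ?a y * cnj (\<phi> ?a y)) has_derivative (\<lambda>v. 0)) (at y within ball y0 e)"
        by (simp add: has_derivative_at_withinI)
    qed (use y e in auto)
    have r: "\<rho> y = \<phi>' ?a y * cnj (\<phi> ?a y)" if "y \<in> ball y0 e" for y
      by (rule \<rho>) (use e that in auto)
    have y0B: "y0 \<in> ball y0 e" using e by simp
    have "\<rho> y = \<rho> y0" if "y \<in> ball y0 e" for y
      unfolding r[OF that] r[OF y0B] by (rule c0[OF that])
    then show "\<exists>T. open T \<and> y0 \<in> T \<and> (\<forall>x\<in>T. \<rho> x = \<rho> y0)" using open_ball y0B by blast
  qed
  obtain y0 where y0: "y0 \<in> W" using W(3) by blast
  have "cmod (\<rho> y0) = 1"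
    using parallel_frameD(1)[OF \<phi>(1) y0 cover(2)] parallel_frameD(1)[OF \<phi>(2) y0 cover(2)]
    by (simp add: \<rho>_def norm_mult)
  moreover have "\<phi>' a y = \<rho> y0 * \<phi> a y" if "y \<in> W" "proj y \<in> U a" for a y
    using \<phi>'[OF that] const[OF that(1) y0] by simp
  ultimately show ?thesis by (rule that)
qed

text \<open>On the connected overlap the frames differ by one constant; after rescaling the first by
  it, they agree there.\<close>

lemma frame_glue:
  assumes W: "open V" "open W" "connected (V \<inter> W)" "V \<inter> W \<noteq> {}"
    and \<phi>: "parallel_frame \<omega> U g \<theta> V \<phi>" "parallel_frame \<omega> U g \<theta> W \<phi>'"
  shows "\<exists>\<phi>. parallel_frame \<omega> U g \<theta> (V \<union> W) \<phi>"
proof -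
  have "parallel_frame \<omega> U g \<theta> (V \<inter> W) \<phi>" "parallel_frame \<omega> U g \<theta> (V \<inter> W) \<phi>'"
    using \<phi> frame_subset by blast+
  then obtain k where k: "cmod k = 1" "\<And>a y. y \<in> V \<inter> W \<Longrightarrow> proj y \<in> U a \<Longrightarrow> \<phi>' a y = k * \<phi> a y"
    using frame_unique[of "V \<inter> W" \<phi> \<phi>'] W by blast
  let ?\<phi> = "\<lambda>a y. if y \<in> V then k * \<phi> a y else \<phi>' a y"
  have "parallel_frame \<omega> U g \<theta> V ?\<phi>"
    by (rule frame_cong[OF W(1) frame_scale[OF \<phi>(1) k(1)]]) simp
  moreover have "parallel_frame \<omega> U g \<theta> W ?\<phi>"
    by (rule frame_cong[OF W(2) \<phi>(2)]) (simp add: k(2))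
  ultimately show ?thesis using frame_union by blast
qed

text \<open>In one chart the frame is \<open>cis \<psi>\<close>, where the differential of
  \<open>\<psi>\<close> has to be the difference of the two connection forms divided by the
  imaginary unit. The curvatures coincide, so that difference is closed and has a primitive on a
  ball.\<close>

lemma local_frame: "\<exists>e>0. \<exists>\<phi>. parallel_frame \<omega> U g \<theta> (ball y0 e) \<phi>"
proof -
  define a0 where "a0 = proj y0"
  have "y0 \<in> proj -` U a0" using cover(2) by (simp add: a0_def)
  then obtain e where e: "e > 0" "ball y0 e \<subseteq> proj -` U a0" using openE[OF open_chart] by blast
  let ?B = "ball y0 e"
  have B: "proj y \<in> U a0" if "y \<in> ?B" for y using e that by auto
  define \<alpha> where "\<alpha> y v = - (pi * \<omega> y v) - Im (\<theta> a0 (proj y) v)" for y v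
  have sm\<theta>: "smooth_on ?B (\<lambda>y. \<theta> a0 (proj y) v)" for v
    using connection_smooth[of a0 v] e unfolding torus_smooth_on_def by (blast intro: smooth_on_subset)
  have bl: "bounded_linear (\<lambda>y. - (pi * \<omega> y v))" for v
    by (intro bounded_linear_minus bounded_linear_const_mult bounded_linear_left[OF \<omega>])
  have D\<alpha>: "((\<lambda>y. \<alpha> y v) has_derivative (\<lambda>u. - (pi * \<omega> u v) - Im (frechet_derivative (\<lambda>y. \<theta> a0 (proj y) v) (at y) u))) (at y)"
    if "y \<in> ?B" for y v
    unfolding \<alpha>_def
    by (intro has_derivative_diff bounded_linear_imp_has_derivative bl has_derivative_Im smooth_on_has_derivative[OF sm\<theta>] that) simp
  obtain \<psi> where \<psi>: "\<And>y. y \<in> ?B \<Longrightarrow> (\<psi> has_derivative \<alpha> y) (at y)"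
  proof (rule closed_form_exact[of y0 e \<alpha>])
    show "linear (\<alpha> y)" if "y \<in> ?B" for y
      using connection_linear[OF B[OF that]] unfolding \<alpha>_def
      by (intro linearI) (simp_all add: linear_add linear_cmul bilinear_simps[OF \<omega>(1)] algebra_simps)
    show "smooth_on ?B (\<lambda>y. \<alpha> y v)" for v
      unfolding \<alpha>_def
      by (intro smooth_on_diff smooth_on_linear bl smooth_on_compose_linear[OF _ bounded_linear_Im] sm\<theta>) auto
    show "frechet_derivative (\<lambda>y. \<alpha> y v) (at y) u = frechet_derivative (\<lambda>y. \<alpha> y u) (at y) v" if "y \<in> ?B" for y u v
    proof -
      have "frechet_derivative (\<lambda>z. \<theta> a0 (proj z) v) (at y) u - frechet_derivative (\<lambda>z. \<theta> a0 (proj z) u) (at y) v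
         = - 2 * of_real pi * \<i> * of_real (\<omega> u v)"
        using curvature[OF B[OF that], of u v] by (simp add: ext_deriv_def)
      from arg_cong[OF this, of Im]
      have "Im (frechet_derivative (\<lambda>z. \<theta> a0 (proj z) v) (at y) u) - Im (frechet_derivative (\<lambda>z. \<theta> a0 (proj z) u) (at y) v)
        = - 2 * pi * \<omega> u v" by simp
      then show ?thesis
        unfolding frechet_derivative_eqI[OF D\<alpha>[OF that]] using skew[OF \<omega>, of v u] by simp
    qed
  qed blast
  \<comment> \<open>Over the other charts the frame is dictated by the transition functions; their
    cocycle identity and the transformation law of the connection forms yield the conditions
    there.\<close>
  define \<phi> where "\<phi> a y = g a a0 (proj y) * cis (\<psi> y)" for a y
  have "parallel_frame \<omega> U g \<theta> ?B \<phi>"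
    unfolding parallel_frame_def
  proof (intro allI ballI impI conjI)
    fix a y assume y: "y \<in> ?B" "proj y \<in> U a"
    note y0 = B[OF y(1)]
    have nz: "g a a0 (proj y) \<noteq> 0" using transition_norm[OF y(2) y0] by auto
    show "cmod (\<phi> a y) = 1" using transition_norm[OF y(2) y0] by (simp add: \<phi>_def norm_mult)
    show "\<phi> a y = g a b (proj y) * \<phi> b y" if "proj y \<in> U b" for b
      using transition_cocycle[OF y(2) that y0] by (simp add: \<phi>_def)
    have "smooth_on (proj -` (U a \<inter> U a0)) (\<lambda>y. g a a0 (proj y))"
      using transition_smooth[of a a0] by (simp add: torus_smooth_on_def)
    then have Dg: "((\<lambda>y. g a a0 (proj y)) has_derivative torus_deriv (g a a0) (proj y)) (at y)"
      using smooth_on_has_derivative[of "proj -` (U a \<inter> U a0)" "\<lambda>y. g a a0 (proj y)" y] open_chart y y0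
      by (simp add: torus_deriv_proj[abs_def] vimage_Int open_Int)
    have tg: "torus_deriv (g a a0) (proj y) v = (\<theta> a0 (proj y) v - \<theta> a (proj y) v) * g a a0 (proj y)" for v
      using connection_transition[OF y(2) y0, of v] nz by (simp add: field_simps)
    have \<alpha>: "\<i> * of_real (\<alpha> y v) = - \<i> * of_real (pi * \<omega> y v) - \<theta> a0 (proj y) v" for v
      using connection_imaginary[OF y0, of v] by (simp add: \<alpha>_def complex_eq_iff)
    have "(\<phi> a has_derivative (\<lambda>v. g a a0 (proj y) * (\<i> * of_real (\<alpha> y v) * cis (\<psi> y)) + torus_deriv (g a a0) (proj y) v * cis (\<psi> y))) (at y)"
      unfolding \<phi>_def by (intro has_derivative_mult Dg has_derivative_cis_real \<psi> y)
    moreover have "g a a0 (proj y) * (\<i> * of_real (\<alpha> y v) * cis (\<psi> y)) + torus_deriv (g a a0) (proj y) v * cis (\<psi> y)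
       = (- \<i> * of_real (pi * \<omega> y v) - \<theta> a (proj y) v) * \<phi> a y" for v
      unfolding \<alpha> tg \<phi>_def by (simp add: algebra_simps)
    ultimately show "(\<phi> a has_derivative (\<lambda>v. (- \<i> * of_real (pi * \<omega> y v) - \<theta> a (proj y) v) * \<phi> a y)) (at y)"
      by simp
  qed
  then show ?thesis using e(1) by blast
qed

text \<open>Compactness of the segment in the form of bisection: frames exist on tubes around short
  pieces, and tubes around adjacent pieces can be glued after shrinking to a common radius.\<close>

lemma segment_frame: "\<exists>d>0. \<exists>\<phi>. parallel_frame \<omega> U g \<theta> (tube y d 0 1) \<phi>"
proof -
  define P where "P a b \<longleftrightarrow> (\<exists>d>0. \<exists>\<phi>. parallel_frame \<omega> U g \<theta> (tube y d a b) \<phi>)" for a b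
  have "P 0 1"
  proof (rule Bolzano)
    fix a b c :: real assume ab: "P a b" and bc: "P b c" and le: "a \<le> b" "b \<le> c"
    obtain d1 \<phi>1 where 1: "d1 > 0" "parallel_frame \<omega> U g \<theta> (tube y d1 a b) \<phi>1" using ab by (auto simp: P_def)
    obtain d2 \<phi>2 where 2: "d2 > 0" "parallel_frame \<omega> U g \<theta> (tube y d2 b c) \<phi>2" using bc by (auto simp: P_def)
    define d where "d = min d1 d2"
    have d: "d > 0" "d \<le> d1" "d \<le> d2" using 1 2 by (auto simp: d_def)
    have "b *\<^sub>R y \<in> tube y d a b \<inter> tube y d b c" using d le by (auto intro!: mem_tube)
    then have "\<exists>\<phi>. parallel_frame \<omega> U g \<theta> (tube y d a b \<union> tube y d b c) \<phi>"
      using frame_subset[OF 1(2) tube_mono[OF d(2)]] frame_subset[OF 2(2) tube_mono[OF d(3)]]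
      by (intro frame_glue open_tube convex_connected convex_Int convex_tube) blast+
    moreover have "tube y d a b \<union> tube y d b c = tube y d a c"
      using le ivl_disj_un_two_touch(4)[of a b c] by (simp add: tube_def flip: UN_Un)
    ultimately show "P a c" using d(1) unfolding P_def by auto
  next
    fix x :: real
    obtain e \<phi> where e: "e > 0" "parallel_frame \<omega> U g \<theta> (ball (x *\<^sub>R y) e) \<phi>" using local_frame by blast
    define n where "n = norm y + 1"
    \<comment> \<open>Pieces with parameter length below \<open>d\<close> are at most
      \<open>e / 2\<close> long, so a tube of radius \<open>e / 2\<close> around them lies in the
      ball of radius \<open>e\<close>.\<close>
    define d where "d = e / (2 * n)"
    have n: "n > 0" by (simp add: n_def add_nonneg_pos)
    have d: "d > 0" "d * norm y \<le> e / 2"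
    proof -
      show "d > 0" using e n by (simp add: d_def)
      then have "d * norm y \<le> d * n" by (intro mult_left_mono) (auto simp: n_def)
      also have "\<dots> = e / 2" using n by (simp add: d_def)
      finally show "d * norm y \<le> e / 2" .
    qed
    have "P a b" if ab: "a \<le> x" "x \<le> b" "b - a < d" for a b
    proof -
      have "tube y (e / 2) a b \<subseteq> ball (x *\<^sub>R y) e"
      proof
        fix p assume "p \<in> tube y (e / 2) a b"
        then obtain s where s: "s \<in> {a..b}" "dist (s *\<^sub>R y) p < e / 2" by (auto simp: tube_def)
        have "\<bar>x - s\<bar> \<le> d" using s ab by auto
        then have "\<bar>x - s\<bar> * norm y \<le> d * norm y" by (intro mult_right_mono) auto
        then have "dist (x *\<^sub>R y) (s *\<^sub>R y) \<le> e / 2"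
          using d by (simp add: dist_norm flip: scaleR_left_diff_distrib)
        then show "p \<in> ball (x *\<^sub>R y) e"
          using s dist_triangle[of "x *\<^sub>R y" p "s *\<^sub>R y"] by simp
      qed
      then have "parallel_frame \<omega> U g \<theta> (tube y (e / 2) a b) \<phi>" using frame_subset[OF e(2)] by blast
      then show ?thesis using e(1) unfolding P_def by (intro exI[of _ "e / 2"]) auto
    qed
    then show "\<exists>d>0. \<forall>a b. a \<le> x \<and> x \<le> b \<and> b - a < d \<longrightarrow> P a b" using d(1) by blast
  qed simp
  then show ?thesis by (simp add: P_def)
qed

text \<open>Parallel transport along rays from the origin. All tubes are convex and contain
  \<open>0\<close>, so two frames normalised at \<open>0\<close> agree on the whole intersection of
  their tubes; hence the diagonal choice \<open>\<phi> x a x\<close> is again a frame near every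
  point.\<close>

lemma ex_parallel_frame: "\<exists>\<phi>. parallel_frame \<omega> U g \<theta> UNIV \<phi>"
proof -
  have "\<exists>d \<phi>. d > 0 \<and> parallel_frame \<omega> U g \<theta> (tube y d 0 1) \<phi> \<and> \<phi> (proj 0) 0 = 1" for y
  proof -
    obtain d \<phi> where d: "d > 0" and \<phi>: "parallel_frame \<omega> U g \<theta> (tube y d 0 1) \<phi>" using segment_frame by blast
    have 0: "0 \<in> tube y d 0 1" using mem_tube[OF d, of 0 0 1 y] by simp
    have n: "cmod (\<phi> (proj 0) 0) = 1" by (rule parallel_frameD(1)[OF \<phi> 0 cover(2)])
    let ?k = "inverse (\<phi> (proj 0) 0)"
    have "parallel_frame \<omega> U g \<theta> (tube y d 0 1) (\<lambda>a y. ?k * \<phi> a y)"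
      by (rule frame_scale[OF \<phi>]) (simp add: norm_inverse n)
    moreover have "?k * \<phi> (proj 0) 0 = 1" using n by (intro left_inverse) auto
    ultimately show ?thesis using d by blast
  qed
  then obtain d \<phi> where d: "\<And>y. d y > 0" and \<phi>: "\<And>y. parallel_frame \<omega> U g \<theta> (tube y (d y) 0 1) (\<phi> y)"
    and norm: "\<And>y. \<phi> y (proj 0) 0 = 1" by metis
  define T where "T y = tube y (d y) 0 1" for y
  have T: "0 \<in> T y" "y \<in> T y" "open (T y)" "convex (T y)" for y
    using mem_tube[OF d, of 0 0 1 y] mem_tube[OF d, of 1 0 1 y] by (auto simp: T_def open_tube convex_tube)
  note \<phi> = \<phi>[folded T_def]
  have "\<phi> y' a y' = \<phi> y a y'" if y': "y' \<in> T y" "proj y' \<in> U a" for y y' a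
  proof -
    have "0 \<in> T y \<inter> T y'" "y' \<in> T y \<inter> T y'" using T y' by auto
    moreover have "parallel_frame \<omega> U g \<theta> (T y \<inter> T y') (\<phi> y)" "parallel_frame \<omega> U g \<theta> (T y \<inter> T y') (\<phi> y')"
      using frame_subset[OF \<phi>] by auto
    moreover have "open (T y \<inter> T y')" using T by auto
    moreover have "connected (T y \<inter> T y')" by (intro convex_connected convex_Int T)
    ultimately obtain k where k: "\<And>a x. x \<in> T y \<inter> T y' \<Longrightarrow> proj x \<in> U a \<Longrightarrow> \<phi> y' a x = k * \<phi> y a x"
      using frame_unique[of "T y \<inter> T y'" "\<phi> y" "\<phi> y'"] by blast
    have "k = 1" using k[OF \<open>0 \<in> T y \<inter> T y'\<close> cover(2)] norm by simp
    then show ?thesis using k[OF \<open>y' \<in> T y \<inter> T y'\<close> y'(2)] by simp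
  qed
  then have "parallel_frame \<omega> U g \<theta> (T y) (\<lambda>a x. \<phi> x a x)" for y
    by (rule frame_cong[OF T(3) \<phi>])
  then have "parallel_frame \<omega> U g \<theta> UNIV (\<lambda>a x. \<phi> x a x)"
    using T(2) unfolding parallel_frame_def by blast
  then show ?thesis by blast
qed

text \<open>The lattice translate of a frame is parallel for the standard connection recentred at
  the shifted origin; the factor \<open>cis (pi * \<omega> z y)\<close> compensates for this.
  Uniqueness of parallel frames provides the constant \<open>c z\<close>.\<close>

lemma ex_multiplier:
  assumes \<phi>: "parallel_frame \<omega> U g \<theta> UNIV \<phi>"
  obtains c where "\<And>z. z \<in> int_lattice \<Longrightarrow> cmod (c z) = 1"
    "\<And>z a y. z \<in> int_lattice \<Longrightarrow> proj y \<in> U a \<Longrightarrow> \<phi> a y = c z * cis (pi * \<omega> z y) * \<phi> a (y + z)"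
proof -
  have "\<exists>k. cmod k = 1 \<and> (\<forall>a y. proj y \<in> U a \<longrightarrow> \<phi> a y = k * cis (pi * \<omega> z y) * \<phi> a (y + z))"
    if z: "z \<in> int_lattice" for z
  proof -
    let ?\<phi> = "\<lambda>a y. cis (pi * \<omega> z y) * \<phi> a (y + z)"
    have "parallel_frame \<omega> U g \<theta> UNIV ?\<phi>"
      unfolding parallel_frame_def
    proof (intro allI ballI impI conjI)
      fix a y assume y: "proj y \<in> U a"
      then have yz: "proj (y + z) \<in> U a" by (simp add: proj_translate[OF z])
      show "cmod (?\<phi> a y) = 1" using parallel_frameD(1)[OF \<phi> UNIV_I yz] by (simp add: norm_mult)
      show "?\<phi> a y = g a b (proj y) * ?\<phi> b y" if "proj y \<in> U b" for b
        using parallel_frameD(3)[OF \<phi> UNIV_I yz, of b] that by (simp add: proj_translate[OF z])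
      have "((\<lambda>y. cis (pi * \<omega> z y)) has_derivative (\<lambda>v. \<i> * of_real (pi * \<omega> z v) * cis (pi * \<omega> z y))) (at y)"
        by (intro has_derivative_cis_real bounded_linear_imp_has_derivative bounded_linear_const_mult bounded_linear_right[OF \<omega>])
      from has_derivative_mult[OF this has_derivative_translate[OF parallel_frameD(2)[OF \<phi> UNIV_I yz]]]
      show "(?\<phi> a has_derivative (\<lambda>v. (- \<i> * of_real (pi * \<omega> y v) - \<theta> a (proj y) v) * ?\<phi> a y)) (at y)"
        by (rule has_derivative_eq_rhs)
          (simp add: fun_eq_iff proj_translate[OF z] bilinear_simps[OF \<omega>(1)] algebra_simps)
    qed
    from frame_unique[OF open_UNIV connected_UNIV UNIV_not_empty this \<phi>] show ?thesis
      by (metis UNIV_I mult.assoc)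
  qed
  then show ?thesis using that by metis
qed

end

section \<open>Sections as quasi-periodic functions\<close>

definition section_of :: "'n::finite cover \<Rightarrow> ('n torus \<Rightarrow> real^'n \<Rightarrow> complex) \<Rightarrow> nat \<Rightarrow> (real^'n \<Rightarrow> complex) \<Rightarrow> 'n lb_section" where
  "section_of U \<phi> k f = (\<lambda>a x. if x \<in> U a then \<phi> a (torus_rep x) ^ k * f (torus_rep x) else 0)"

definition model_hamiltonian :: "nat \<Rightarrow> (real^'n) tensor2 \<Rightarrow> (real^'n) tensor2 \<Rightarrow> (real^'n::finite \<Rightarrow> complex) \<Rightarrow> real^'n \<Rightarrow> complex" where
  "model_hamiltonian k h \<beta> f x = of_real ((1 / real k)\<^sup>2 / 2) *
     - (\<Sum>u\<in>Basis. \<Sum>v\<in>Basis. of_real (cometric h u v) * mag_deriv \<beta> u (mag_deriv \<beta> v f) x)"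

definition model_eigenspace :: "nat \<Rightarrow> (real^'n) tensor2 \<Rightarrow> (real^'n) tensor2 \<Rightarrow> (real^'n \<Rightarrow> complex) \<Rightarrow> complex \<Rightarrow>
    (real^'n::finite \<Rightarrow> complex) set" where
  "model_eigenspace k h \<beta> c E = {f \<in> quasi_periodic \<beta> c. \<forall>x. model_hamiltonian k h \<beta> f x = E * f x}"

definition scaled :: "nat \<Rightarrow> (real^'n) tensor2 \<Rightarrow> (real^'n) tensor2" where
  "scaled k \<omega> u v = real k * \<omega> u v"

lemma scaled_form:
  assumes "bilinear \<omega>" "\<And>u. \<omega> u u = 0"
  shows "bilinear (scaled k \<omega>)" "scaled k \<omega> u u = 0"
  using assms(2) unfolding bilinear_def scaled_def[abs_def] linear_iff
  by (auto simp: bilinear_simps[OF assms(1)] algebra_simps)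

lemma cis_scaled: "cis (pi * scaled k \<omega> u v) = cis (pi * \<omega> u v) ^ k"
  unfolding scaled_def Complex.DeMoivre by (simp add: mult.left_commute)

lemma quasi_periodic_add:
  "f \<in> quasi_periodic \<beta> c \<Longrightarrow> f' \<in> quasi_periodic \<beta> c \<Longrightarrow> (\<lambda>x. f x + f' x) \<in> quasi_periodic \<beta> c"
  by (simp add: quasi_periodic_def smooth_on_add algebra_simps)

lemma quasi_periodic_mult: "f \<in> quasi_periodic \<beta> c \<Longrightarrow> (\<lambda>x. a * f x) \<in> quasi_periodic \<beta> c"
  by (simp add: quasi_periodic_def smooth_on_mult smooth_on_const)

lemma quasi_periodic_sum:
  "(\<And>i. i \<in> A \<Longrightarrow> F i \<in> quasi_periodic \<beta> c) \<Longrightarrow> (\<lambda>x. \<Sum>i\<in>A. F i x) \<in> quasi_periodic \<beta> c"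
proof (induction A rule: infinite_finite_induct)
  case (insert x A)
  then show ?case using quasi_periodic_add[of "F x" \<beta> c "\<lambda>y. \<Sum>i\<in>A. F i y"] by simp
qed (simp_all add: quasi_periodic_def smooth_on_const)

lemma model_hamiltonian_quasi_periodic:
  assumes "bilinear \<beta>" "\<And>u. \<beta> u u = 0" "f \<in> quasi_periodic \<beta> c"
  shows "model_hamiltonian k h \<beta> f \<in> quasi_periodic \<beta> c"
proof -
  have "(\<lambda>x. of_real ((1 / real k)\<^sup>2 / 2) * (- 1 * (\<Sum>u\<in>Basis. \<Sum>v\<in>Basis. of_real (cometric h u v) * mag_deriv \<beta> u (mag_deriv \<beta> v f) x)))
      \<in> quasi_periodic \<beta> c"
    by (intro quasi_periodic_mult quasi_periodic_sum mag_deriv_quasi_periodic assms)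
  then show ?thesis by (simp add: model_hamiltonian_def[abs_def])
qed

context
  fixes \<omega> :: "(real^'n::finite) tensor2" and U :: "'n cover" and g :: "'n transition" and \<theta> :: "'n connection"
    and \<phi> :: "'n torus \<Rightarrow> real^'n \<Rightarrow> complex" and c :: "real^'n \<Rightarrow> complex"
  assumes \<omega>: "bilinear \<omega>" "\<And>u. \<omega> u u = 0"
    and preq: "prequantum_bundle \<omega> U g \<theta>"
    and \<phi>: "parallel_frame \<omega> U g \<theta> UNIV \<phi>"
    and c: "\<And>z. z \<in> int_lattice \<Longrightarrow> cmod (c z) = 1"
      "\<And>z a y. z \<in> int_lattice \<Longrightarrow> proj y \<in> U a \<Longrightarrow> \<phi> a y = c z * cis (pi * \<omega> z y) * \<phi> a (y + z)"
begin

abbreviation "periodic_fns k \<equiv> quasi_periodic (scaled k \<omega>) (\<lambda>z. c z ^ k)"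

text \<open>Compares translation by \<open>z + z'\<close> with translation by \<open>z\<close>
  followed by \<open>z'\<close>. The multiplier is a character twisted by
  \<open>\<omega>\<close>.\<close>

lemma multiplier_add:
  assumes z: "z \<in> int_lattice" and z': "z' \<in> int_lattice"
  shows "c (z + z') = c z * c z' * cis (pi * \<omega> z' z)"
proof -
  let ?a = "proj 0"
  have a: "proj 0 \<in> U ?a" by (rule cover(2)[OF \<omega> preq])
  then have az: "proj (0 + z) \<in> U ?a" by (simp only: proj_translate[OF z])
  have azz: "proj (0 + z + z') \<in> U ?a" by (simp only: proj_translate[OF z'] az)
  have "c (z + z') * \<phi> ?a (0 + (z + z')) = \<phi> ?a 0"
    using c(2)[OF int_lattice_closed(2)[OF z z'] a] by (simp add: bilinear_simps[OF \<omega>(1)])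
  also have "\<dots> = c z * (c z' * cis (pi * \<omega> z' z) * \<phi> ?a (0 + z + z'))"
    using c(2)[OF z a] c(2)[OF z' az] by (simp add: bilinear_simps[OF \<omega>(1)])
  finally have "c (z + z') * \<phi> ?a (z + z') = (c z * c z' * cis (pi * \<omega> z' z)) * \<phi> ?a (z + z')" by (simp add: mult.assoc)
  moreover have "\<phi> ?a (z + z') \<noteq> 0" using parallel_frameD(1)[OF \<phi> UNIV_I azz] by auto
  ultimately show ?thesis by simp
qed

text \<open>The twisted identity of \<open>multiplier_add\<close> must be symmetric in
  \<open>z\<close> and \<open>z'\<close>, which forces
  \<open>cis (2 * pi * \<omega> z z') = 1\<close>.\<close>

lemma integral_on_lattice:
  assumes z: "z \<in> int_lattice" and z': "z' \<in> int_lattice"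
  shows "\<omega> z z' \<in> \<int>"
proof -
  have "c z * c z' \<noteq> 0" using c(1)[OF z] c(1)[OF z'] by auto
  moreover have "c z * c z' * cis (pi * \<omega> z' z) = c z * c z' * cis (pi * \<omega> z z')"
    using multiplier_add[OF z z'] multiplier_add[OF z' z] by (simp add: add.commute mult_ac)
  ultimately have "cis (pi * \<omega> z' z) = cis (pi * \<omega> z z')" by simp
  then have "cis (pi * \<omega> z z') * cis (pi * \<omega> z z') = cis (pi * \<omega> z z') * cis (pi * \<omega> z' z)" by simp
  then have "cis (2 * pi * \<omega> z z') = 1" using skew[OF \<omega>, of z' z] by (simp add: cis_mult mult.assoc)
  then have "cos (2 * pi * \<omega> z z') = 1" by (metis cis.simps(1) one_complex.simps(1))
  then obtain n :: int where "2 * pi * \<omega> z z' = of_int n * 2 * pi" by (auto simp: cos_one_2pi_int)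
  then show ?thesis by simp
qed

lemma frame_unit: "proj y \<in> U a \<Longrightarrow> \<phi> a y * cnj (\<phi> a y) = 1"
  using parallel_frameD(1)[OF \<phi> UNIV_I] complex_norm_square[of "\<phi> a y"] by simp

lemma smooth_frame: "smooth_on (proj -` U a) (\<phi> a)"
proof (rule smooth_on_linear_system[OF open_chart[OF \<omega> preq], where f = "\<phi> a" and p = "\<lambda>v y. - \<i> * of_real (pi * \<omega> y v) - \<theta> a (proj y) v"])
  show "(\<phi> a has_derivative (\<lambda>v. (- \<i> * of_real (pi * \<omega> y v) - \<theta> a (proj y) v) * \<phi> a y)) (at y)" if "y \<in> proj -` U a" for y
    using parallel_frameD(2)[OF \<phi> UNIV_I, of y a] that by simp
  show "smooth_on (proj -` U a) (\<lambda>y. - \<i> * of_real (pi * \<omega> y v) - \<theta> a (proj y) v)" for v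
  proof (rule smooth_on_diff[OF open_chart[OF \<omega> preq]])
    show "smooth_on (proj -` U a) (\<lambda>y. - \<i> * of_real (pi * \<omega> y v))"
      by (intro smooth_on_linear open_chart[OF \<omega> preq] bounded_linear_const_mult
          bounded_linear_of_real[THEN bounded_linear_compose] bounded_linear_left[OF \<omega>])
    show "smooth_on (proj -` U a) (\<lambda>y. \<theta> a (proj y) v)"
      using connection_smooth[OF \<omega> preq, of a v] by (simp add: torus_smooth_on_def)
  qed
qed

text \<open>The multipliers of \<open>\<phi> a\<close> to the power \<open>k\<close> and of
  \<open>f\<close> cancel, so any lift may replace the chosen representative.\<close>

lemma section_of_proj:
  assumes f: "f \<in> periodic_fns k" and y: "proj y \<in> U a"
  shows "section_of U \<phi> k f a (proj y) = \<phi> a y ^ k * f y"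
proof -
  obtain z where z: "z \<in> int_lattice" "torus_rep (proj y) = y + z" by (rule torus_rep_proj)
  have "f (y + z) = c z ^ k * cis (pi * \<omega> z y) ^ k * f y"
    using f z by (simp add: quasi_periodic_def cis_scaled)
  then have "section_of U \<phi> k f a (proj y) = (c z * cis (pi * \<omega> z y) * \<phi> a (y + z)) ^ k * f y"
    using y by (simp add: section_of_def z(2) power_mult_distrib mult_ac)
  then show ?thesis using c(2)[OF z(1) y] by simp
qed

lemma section_of_smooth:
  assumes f: "f \<in> periodic_fns k"
  shows "section_of U \<phi> k f \<in> smooth_sections U (transition_power k g)"
  unfolding smooth_sections_def
proof (safe)
  note o = open_chart[OF \<omega> preq]
  fix a
  have "smooth_on (proj -` U a) (\<lambda>y. \<phi> a y ^ k * f y)"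
    by (intro smooth_on_mult smooth_on_power smooth_frame o smooth_on_subset[OF o subset_UNIV]
        quasi_periodic_smooth[OF scaled_form[OF \<omega>] f])
  then show "torus_smooth_on (U a) (section_of U \<phi> k f a)"
    unfolding torus_smooth_on_def
    by (subst smooth_on_cong[OF o, of _ _ "\<lambda>y. \<phi> a y ^ k * f y"]) (auto simp: section_of_proj[OF f])
next
  fix a b x assume x: "x \<in> U a" "x \<in> U b"
  have "\<phi> a (torus_rep x) = g a b x * \<phi> b (torus_rep x)"
    using parallel_frameD(3)[OF \<phi> UNIV_I, of "torus_rep x" a b] x by simp
  then show "section_of U \<phi> k f a x = transition_power k g a b x * section_of U \<phi> k f b x"
    using x by (simp add: section_of_def transition_power_def power_mult_distrib)
next
  show "section_of U \<phi> k f a x = 0" if "x \<notin> U a" for a x using that by (simp add: section_of_def)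
qed

text \<open>Differentiating the \<open>k\<close>-th power of the frame cancels the connection form
  \<open>k \<theta>\<close> of the bundle power and leaves the standard potential for
  \<open>k \<omega>\<close>.\<close>

lemma cov_deriv_section_of:
  assumes f: "f \<in> periodic_fns k"
  shows "cov_deriv U (connection_power k \<theta>) v (section_of U \<phi> k f) = section_of U \<phi> k (mag_deriv (scaled k \<omega>) v f)"
proof (intro ext)
  fix a x
  show "cov_deriv U (connection_power k \<theta>) v (section_of U \<phi> k f) a x = section_of U \<phi> k (mag_deriv (scaled k \<omega>) v f) a x"
  proof (cases "x \<in> U a")
    case True
    define y where "y = torus_rep x"
    have y: "proj y \<in> U a" "proj y = x" using True by (auto simp: y_def)
    let ?m = "\<lambda>v. - \<i> * of_real (pi * \<omega> y v) - \<theta> a x v"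
    let ?D = "frechet_derivative f (at y)"
    have Dk: "((\<lambda>y. \<phi> a y ^ k) has_derivative (\<lambda>v. of_nat k * ?m v * \<phi> a y ^ k)) (at y)"
    proof (cases k)
      case (Suc j)
      show ?thesis
        using has_derivative_power[OF parallel_frameD(2)[OF \<phi> UNIV_I y(1)], of k]
        by (rule has_derivative_eq_rhs) (simp add: Suc y(2) fun_eq_iff mult_ac)
    qed simp
    have "((\<lambda>y. \<phi> a y ^ k * f y) has_derivative (\<lambda>v. \<phi> a y ^ k * ?D v + (of_nat k * ?m v * \<phi> a y ^ k) * f y)) (at y)"
      by (intro has_derivative_mult Dk smooth_on_has_derivative[OF quasi_periodic_smooth[OF scaled_form[OF \<omega>] f]]) auto
    then have "((\<lambda>y. section_of U \<phi> k f a (proj y)) has_derivative (\<lambda>v. \<phi> a y ^ k * ?D v + (of_nat k * ?m v * \<phi> a y ^ k) * f y)) (at y)"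
      by (rule has_derivative_transform_within_open[OF _ open_chart[OF \<omega> preq, of a]])
        (use y section_of_proj[OF f] in auto)
    then have "torus_deriv (section_of U \<phi> k f a) x v = \<phi> a y ^ k * ?D v + (of_nat k * ?m v * \<phi> a y ^ k) * f y"
      using torus_deriv_proj[of "section_of U \<phi> k f a" y v] by (simp add: y(2) frechet_derivative_eqI)
    then show ?thesis
      using True by (simp add: cov_deriv_def section_of_def connection_power_def mag_deriv_def scaled_def y_def[symmetric] algebra_simps)
  qed (simp add: cov_deriv_def section_of_def)
qed

lemma quantum_hamiltonian_section_of:
  assumes f: "f \<in> periodic_fns k"
  shows "quantum_hamiltonian k h U \<theta> (section_of U \<phi> k f) a x = section_of U \<phi> k (model_hamiltonian k h (scaled k \<omega>) f) a x"
  unfolding quantum_hamiltonian_def bochner_laplacian_def cov_deriv_section_of[OF f]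
    cov_deriv_section_of[OF mag_deriv_quasi_periodic[OF scaled_form[OF \<omega>] f]]
  by (simp add: section_of_def model_hamiltonian_def sum_distrib_left mult_ac)

lemma section_of_inj:
  assumes "f \<in> periodic_fns k" "f' \<in> periodic_fns k" "section_of U \<phi> k f = section_of U \<phi> k f'"
  shows "f = f'"
proof
  fix y
  have y: "proj y \<in> U (proj y)" by (rule cover(2)[OF \<omega> preq])
  have "\<phi> (proj y) y \<noteq> 0" using frame_unit[OF y] by auto
  moreover have "\<phi> (proj y) y ^ k * f y = \<phi> (proj y) y ^ k * f' y"
    unfolding section_of_proj[OF assms(1) y, symmetric] section_of_proj[OF assms(2) y, symmetric] assms(3) ..
  ultimately show "f y = f' y" by simp
qed

text \<open>Divide the section by the frame power, that is, multiply by conjugates of modulus 1.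
  Every chart around the point gives the same quotient, so smoothness can be checked in a fixed
  chart locally.\<close>

lemma section_of_surj:
  assumes s: "s \<in> smooth_sections U (transition_power k g)"
  obtains f where "f \<in> periodic_fns k" "section_of U \<phi> k f = s"
proof -
  define f where "f y = s (proj y) (proj y) * cnj (\<phi> (proj y) y) ^ k" for y
  have s1: "torus_smooth_on (U a) (s a)" "x \<notin> U a \<Longrightarrow> s a x = 0" for a x
    using s by (auto simp: smooth_sections_def)
  have s2: "s a x = g a b x ^ k * s b x" if "x \<in> U a" "x \<in> U b" for a b x
    using s that unfolding smooth_sections_def transition_power_def by blast
  have f: "f y = s a (proj y) * cnj (\<phi> a y) ^ k" if y: "proj y \<in> U a" for a y
  proof -
    note y' = cover(2)[OF \<omega> preq, of "proj y"]
    let ?g = "g (proj y) a (proj y)"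
    have "?g * cnj ?g = 1" using transition_norm[OF \<omega> preq y' y] complex_norm_square[of ?g] by simp
    then have "(?g * cnj ?g) ^ k = 1" by simp
    moreover have "f y = (?g * cnj ?g) ^ k * (s a (proj y) * cnj (\<phi> a y) ^ k)"
      unfolding f_def s2[OF y' y] parallel_frameD(3)[OF \<phi> UNIV_I y' y] by (simp add: power_mult_distrib mult_ac)
    ultimately show ?thesis by simp
  qed
  have "smooth_on UNIV f"
  proof (rule smooth_on_local)
    fix y0 :: "real^'n"
    let ?a = "proj y0"
    note o = open_chart[OF \<omega> preq, of ?a]
    have "smooth_on (proj -` U ?a) (\<lambda>y. s ?a (proj y) * cnj (\<phi> ?a y) ^ k)"
      using s1(1)[of ?a] unfolding torus_smooth_on_def
      by (intro smooth_on_mult smooth_on_power smooth_on_compose_linear[OF _ bounded_linear_cnj] smooth_frame o)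
    then have "smooth_on (proj -` U ?a) f"
      by (subst smooth_on_cong[OF o, of _ "\<lambda>y. s ?a (proj y) * cnj (\<phi> ?a y) ^ k"]) (auto simp: f)
    then show "\<exists>V. open V \<and> y0 \<in> V \<and> V \<subseteq> UNIV \<and> smooth_on V f"
      using o cover(2)[OF \<omega> preq, of ?a] by (intro exI[of _ "proj -` U ?a"]) auto
  qed
  moreover have "f (y + z) = c z ^ k * cis (pi * scaled k \<omega> z y) * f y" if z: "z \<in> int_lattice" for z y
  proof -
    let ?a = "proj y"
    note y = cover(2)[OF \<omega> preq, of ?a]
    have yz: "proj (y + z) \<in> U ?a" using y by (simp add: proj_translate[OF z])
    have cc: "c z * cnj (c z) = 1" using c(1)[OF z] complex_norm_square[of "c z"] by simp
    have ee: "cis (pi * \<omega> z y) * cnj (cis (pi * \<omega> z y)) = 1" by (simp add: cis_cnj cis_mult)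
    have "c z * cis (pi * \<omega> z y) * cnj (\<phi> ?a y)
        = (c z * cnj (c z)) * (cis (pi * \<omega> z y) * cnj (cis (pi * \<omega> z y))) * cnj (\<phi> ?a (y + z))"
      unfolding c(2)[OF z y] by (simp add: mult_ac)
    then have "cnj (\<phi> ?a (y + z)) = c z * cis (pi * \<omega> z y) * cnj (\<phi> ?a y)" unfolding cc ee by simp
    then show ?thesis
      unfolding f[OF y] f[OF yz] by (simp add: proj_translate[OF z] power_mult_distrib cis_scaled mult_ac)
  qed
  ultimately have fQ: "f \<in> periodic_fns k" by (auto simp: quasi_periodic_def)
  have "section_of U \<phi> k f a x = s a x" for a x
  proof (cases "x \<in> U a")
    case True
    then have x: "proj (torus_rep x) \<in> U a" by simp
    have "section_of U \<phi> k f a x = (\<phi> a (torus_rep x) * cnj (\<phi> a (torus_rep x))) ^ k * s a x"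
      using True f[OF x] by (simp add: section_of_def power_mult_distrib mult_ac)
    then show ?thesis using frame_unit[OF x] by simp
  qed (simp add: section_of_def s1)
  then show ?thesis using that[OF fQ] by blast
qed

lemma bij_betw_section_of:
  "bij_betw (section_of U \<phi> k) (model_eigenspace k h (scaled k \<omega>) (\<lambda>z. c z ^ k) E) (eigenspace k h U g \<theta> E)"
proof -
  have iff: "(\<forall>a x. quantum_hamiltonian k h U \<theta> (section_of U \<phi> k f) a x = E * section_of U \<phi> k f a x) \<longleftrightarrow>
      (\<forall>x. model_hamiltonian k h (scaled k \<omega>) f x = E * f x)" if f: "f \<in> periodic_fns k" for f
  proof
    assume L: "\<forall>a x. quantum_hamiltonian k h U \<theta> (section_of U \<phi> k f) a x = E * section_of U \<phi> k f a x"
    show "\<forall>x. model_hamiltonian k h (scaled k \<omega>) f x = E * f x"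
    proof
      fix y :: "real^'n"
      have y: "proj y \<in> U (proj y)" by (rule cover(2)[OF \<omega> preq])
      have mh: "model_hamiltonian k h (scaled k \<omega>) f \<in> periodic_fns k"
        by (rule model_hamiltonian_quasi_periodic[OF scaled_form[OF \<omega>] f])
      have "section_of U \<phi> k (model_hamiltonian k h (scaled k \<omega>) f) (proj y) (proj y) = E * section_of U \<phi> k f (proj y) (proj y)"
        using L unfolding quantum_hamiltonian_section_of[OF f] by blast
      then have "\<phi> (proj y) y ^ k * model_hamiltonian k h (scaled k \<omega>) f y = \<phi> (proj y) y ^ k * (E * f y)"
        unfolding section_of_proj[OF mh y] section_of_proj[OF f y] by (simp only: mult.left_commute)
      moreover have "\<phi> (proj y) y \<noteq> 0" using frame_unit[OF y] by auto
      ultimately show "model_hamiltonian k h (scaled k \<omega>) f y = E * f y" by simp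
    qed
  next
    assume "\<forall>x. model_hamiltonian k h (scaled k \<omega>) f x = E * f x"
    then show "\<forall>a x. quantum_hamiltonian k h U \<theta> (section_of U \<phi> k f) a x = E * section_of U \<phi> k f a x"
      unfolding quantum_hamiltonian_section_of[OF f] by (simp add: section_of_def)
  qed
  show ?thesis
    unfolding bij_betw_def
  proof
    show "inj_on (section_of U \<phi> k) (model_eigenspace k h (scaled k \<omega>) (\<lambda>z. c z ^ k) E)"
      by (rule inj_onI) (auto simp: model_eigenspace_def intro: section_of_inj)
    show "section_of U \<phi> k ` model_eigenspace k h (scaled k \<omega>) (\<lambda>z. c z ^ k) E = eigenspace k h U g \<theta> E"
    proof (intro equalityI subsetI)
      fix s assume "s \<in> eigenspace k h U g \<theta> E"
      then have s: "s \<in> smooth_sections U (transition_power k g)" "\<forall>a x. quantum_hamiltonian k h U \<theta> s a x = E * s a x"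
        by (auto simp: eigenspace_def)
      obtain f where f: "f \<in> periodic_fns k" "section_of U \<phi> k f = s" by (rule section_of_surj[OF s(1)])
      then have "f \<in> model_eigenspace k h (scaled k \<omega>) (\<lambda>z. c z ^ k) E"
        using iff[OF f(1)] s(2) by (simp add: model_eigenspace_def)
      then show "s \<in> section_of U \<phi> k ` model_eigenspace k h (scaled k \<omega>) (\<lambda>z. c z ^ k) E" using f(2) by blast
    qed (use iff section_of_smooth in \<open>auto simp: eigenspace_def model_eigenspace_def\<close>)
  qed
qed

end

section \<open>Spectra\<close>

text \<open>\<open>T\<close> is linear only on \<open>V\<close>, so it is replaced by a linear map
  \<open>g\<close> on the whole space that agrees with it on a basis of \<open>V\<close>. The
  dimension is a cardinality in the sense of \<open>card\<close>; infinite bases on both sides give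
  0.\<close>

lemma linear_bijection_dim:
  fixes s1 :: "complex \<Rightarrow> 'v::ab_group_add \<Rightarrow> 'v" and s2 :: "complex \<Rightarrow> 'w::ab_group_add \<Rightarrow> 'w"
  assumes "vector_space s1" "vector_space s2"
    and V: "0 \<in> V" "\<And>x y. x \<in> V \<Longrightarrow> y \<in> V \<Longrightarrow> x + y \<in> V" "\<And>a x. x \<in> V \<Longrightarrow> s1 a x \<in> V"
    and T: "bij_betw T V W" "\<And>x y. x \<in> V \<Longrightarrow> y \<in> V \<Longrightarrow> T (x + y) = T x + T y"
      "\<And>a x. x \<in> V \<Longrightarrow> T (s1 a x) = s2 a (T x)"
  shows "vector_space.dim s2 W = vector_space.dim s1 V" "W = {0} \<longleftrightarrow> V = {0}"
proof -
  interpret V: vector_space s1 by fact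
  interpret W: vector_space s2 by fact
  interpret VW: vector_space_pair s1 s2 ..
  have T0: "T 0 = 0" using T(3)[OF V(1), of 0] by simp
  have WT: "W = T ` V" and inj: "inj_on T V" using T(1) by (auto simp: bij_betw_def)
  show "W = {0} \<longleftrightarrow> V = {0}"
  proof
    assume "W = {0}"
    then have "x = 0" if "x \<in> V" for x using inj_onD[OF inj, of x 0] that V(1) T0 WT by auto
    then show "V = {0}" using V(1) by blast
  qed (simp add: WT T0)
  have sub: "V.subspace V" using V by (intro V.subspaceI)
  obtain B where B: "B \<subseteq> V" "V.independent B" "V \<subseteq> V.span B" "card B = V.dim V"
    using V.basis_exists by blast
  have span: "V.span B = V" using B V.span_minimal[OF B(1) sub] by blast
  obtain g where g: "Vector_Spaces.linear s1 s2 g" "\<And>x. x \<in> B \<Longrightarrow> g x = T x"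
    using VW.linear_independent_extend[OF B(2)] by blast
  have gT: "x \<in> V \<and> g x = T x" if "x \<in> V.span B" for x
  proof (rule V.span_induct[OF that])
    show "V.subspace {x. x \<in> V \<and> g x = T x}"
      using V T T0 VW.linear_0[OF g(1)] VW.linear_add[OF g(1)] VW.linear_scale[OF g(1)]
      by (intro V.subspaceI) auto
  qed (use B(1) g(2) in auto)
  have injg: "inj_on g (V.span B)" using inj gT unfolding span inj_on_def by metis
  have "W = g ` V.span B" unfolding WT using gT span by (intro image_cong) auto
  also have "\<dots> = W.span (g ` B)" by (rule VW.linear_span_image[OF g(1), symmetric])
  finally have WB: "W = W.span (g ` B)" .
  have "W.dim W = card (g ` B)"
  proof (rule W.dim_eq_card)
    show "W.span (g ` B) = W.span W" using WB W.span_span[of "g ` B"] by metis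
    show "W.independent (g ` B)" by (rule VW.linear_independent_injective_image[OF g(1) B(2) injg])
  qed
  also have "\<dots> = card B" using inj_on_subset[OF injg, of B] V.span_superset by (intro card_image) auto
  finally show "W.dim W = V.dim V" using B(4) by simp
qed

section \<open>Magnetic translations and the algebra of the model operators\<close>

definition gauge_translation :: "(real^'n) tensor2 \<Rightarrow> real^'n \<Rightarrow> (real^'n \<Rightarrow> complex) \<Rightarrow> real^'n \<Rightarrow> complex" where
  "gauge_translation \<beta> a f x = cis (pi * \<beta> x a) * f (x + a)"

lemma quasi_periodic_cong:
  "(\<And>z. z \<in> int_lattice \<Longrightarrow> c z = c' z) \<Longrightarrow> quasi_periodic \<beta> c = quasi_periodic \<beta> c'"
  by (auto simp: quasi_periodic_def)

context
  fixes \<beta> :: "(real^'n::finite) tensor2"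
  assumes \<beta>: "bilinear \<beta>" "\<And>u. \<beta> u u = 0"
begin

text \<open>The phase of a magnetic translation compensates for the change of the potential between
  \<open>x\<close> and \<open>x + a\<close>; therefore it commutes with all covariant
  derivatives.\<close>

lemma gauge_translation_has_derivative:
  assumes f: "smooth_on UNIV f"
  shows "(gauge_translation \<beta> a f has_derivative
    (\<lambda>v. gauge_translation \<beta> a (mag_deriv \<beta> v f) x + \<i> * of_real (pi * \<beta> x v) * gauge_translation \<beta> a f x)) (at x)"
proof -
  have "((\<lambda>x. cis (pi * \<beta> x a)) has_derivative (\<lambda>v. \<i> * of_real (pi * \<beta> v a) * cis (pi * \<beta> x a))) (at x)"
    by (intro has_derivative_cis_real bounded_linear_imp_has_derivative bounded_linear_const_mult bounded_linear_left[OF \<beta>])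
  from has_derivative_mult[OF this has_derivative_translate[OF has_derivative_mag_deriv[OF \<beta> f]]]
  show ?thesis
    unfolding gauge_translation_def
  proof (rule has_derivative_eq_rhs, intro ext)
    fix v
    have "\<beta> v a = - \<beta> a v" by (rule skew[OF \<beta>])
    then show "cis (pi * \<beta> x a) * (mag_deriv \<beta> v f (x + a) + \<i> * of_real (pi * \<beta> (x + a) v) * f (x + a)) +
        \<i> * of_real (pi * \<beta> v a) * cis (pi * \<beta> x a) * f (x + a) =
        cis (pi * \<beta> x a) * mag_deriv \<beta> v f (x + a) + \<i> * of_real (pi * \<beta> x v) * (cis (pi * \<beta> x a) * f (x + a))"
      by (simp add: bilinear_simps[OF \<beta>(1)] algebra_simps)
  qed
qed

lemma mag_deriv_gauge_translation:
  "smooth_on UNIV f \<Longrightarrow> mag_deriv \<beta> v (gauge_translation \<beta> a f) = gauge_translation \<beta> a (mag_deriv \<beta> v f)"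
  by (rule ext) (rule mag_deriv_eqI[OF \<beta> gauge_translation_has_derivative])

lemma smooth_gauge_translation:
  assumes "smooth_on UNIV f" shows "smooth_on UNIV (gauge_translation \<beta> a f)"
proof -
  have "smooth_on UNIV (\<lambda>x. cis (pi * \<beta> x a))"
  proof (rule smooth_on_linear_system[OF open_UNIV, where p = "\<lambda>v x. \<i> * of_real (pi * \<beta> v a)"])
    show "((\<lambda>x. cis (pi * \<beta> x a)) has_derivative (\<lambda>v. \<i> * of_real (pi * \<beta> v a) * cis (pi * \<beta> x a))) (at x)" for x
      by (intro has_derivative_cis_real bounded_linear_imp_has_derivative bounded_linear_const_mult bounded_linear_left[OF \<beta>])
  qed (intro smooth_on_const open_UNIV)
  then show ?thesis unfolding gauge_translation_def[abs_def]
    by (intro smooth_on_mult smooth_on_translate[of UNIV UNIV] assms) auto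
qed

text \<open>Magnetic translations change the multiplier by a character of the lattice; this is what
  matches two different bundles with the same curvature.\<close>

lemma gauge_translation_quasi_periodic:
  assumes f: "f \<in> quasi_periodic \<beta> c"
  shows "gauge_translation \<beta> a f \<in> quasi_periodic \<beta> (\<lambda>z. c z * cis (2 * pi * \<beta> z a))"
proof -
  have "gauge_translation \<beta> a f (x + z) = c z * cis (2 * pi * \<beta> z a) * cis (pi * \<beta> z x) * gauge_translation \<beta> a f x"
    if z: "z \<in> int_lattice" for x z
  proof -
    have xz: "x + z + a = x + a + z" by simp
    have "f (x + z + a) = c z * cis (pi * \<beta> z (x + a)) * f (x + a)"
      unfolding xz using f z unfolding quasi_periodic_def by blast
    moreover have "cis (pi * \<beta> (x + z) a) * cis (pi * \<beta> z (x + a)) = cis (2 * pi * \<beta> z a) * (cis (pi * \<beta> z x) * cis (pi * \<beta> x a))"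
      by (simp add: cis_mult bilinear_simps[OF \<beta>(1)] algebra_simps)
    ultimately show ?thesis by (simp add: gauge_translation_def mult_ac)
  qed
  then show ?thesis
    using smooth_gauge_translation[OF quasi_periodic_smooth[OF \<beta> f]] by (auto simp: quasi_periodic_def)
qed

lemma gauge_translation_inverse: "gauge_translation \<beta> a (gauge_translation \<beta> (- a) f) = f"
proof
  fix x
  have "cis (pi * \<beta> x a) * cis (pi * \<beta> (x + a) (- a)) = 1"
    by (simp add: cis_mult bilinear_simps[OF \<beta>(1)] \<beta>(2))
  then show "gauge_translation \<beta> a (gauge_translation \<beta> (- a) f) x = f x"
    by (simp add: gauge_translation_def mult.assoc[symmetric])
qed

lemma model_hamiltonian_gauge_translation:
  assumes "smooth_on UNIV f"
  shows "model_hamiltonian k h \<beta> (gauge_translation \<beta> a f) = gauge_translation \<beta> a (model_hamiltonian k h \<beta> f)"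
  by (rule ext)
    (simp add: model_hamiltonian_def mag_deriv_gauge_translation assms smooth_mag_deriv[OF \<beta>]
      gauge_translation_def sum_distrib_left mult_ac)

lemma gauge_translation_eigenspace:
  assumes "f \<in> model_eigenspace k h \<beta> c E"
  shows "gauge_translation \<beta> a f \<in> model_eigenspace k h \<beta> (\<lambda>z. c z * cis (2 * pi * \<beta> z a)) E"
proof -
  have f: "f \<in> quasi_periodic \<beta> c" "\<And>x. model_hamiltonian k h \<beta> f x = E * f x"
    using assms by (auto simp: model_eigenspace_def)
  have "model_hamiltonian k h \<beta> (gauge_translation \<beta> a f) x = E * gauge_translation \<beta> a f x" for x
    unfolding model_hamiltonian_gauge_translation[OF quasi_periodic_smooth[OF \<beta> f(1)]]
    by (simp add: gauge_translation_def f(2))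
  then show ?thesis using gauge_translation_quasi_periodic[OF f(1)] by (simp add: model_eigenspace_def)
qed

lemma bij_betw_gauge_translation:
  "bij_betw (gauge_translation \<beta> a) (model_eigenspace k h \<beta> c E)
    (model_eigenspace k h \<beta> (\<lambda>z. c z * cis (2 * pi * \<beta> z a)) E)"
proof (rule bij_betw_byWitness[where f' = "gauge_translation \<beta> (- a)"])
  have "(\<lambda>z. c z * cis (2 * pi * \<beta> z a) * cis (2 * pi * \<beta> z (- a))) = c"
    by (rule ext) (simp add: mult.assoc cis_mult bilinear_simps[OF \<beta>(1)])
  then show "gauge_translation \<beta> (- a) ` model_eigenspace k h \<beta> (\<lambda>z. c z * cis (2 * pi * \<beta> z a)) E \<subseteq> model_eigenspace k h \<beta> c E"
    using gauge_translation_eigenspace[of _ k h "\<lambda>z. c z * cis (2 * pi * \<beta> z a)" E "- a"] by auto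
  show "gauge_translation \<beta> a ` model_eigenspace k h \<beta> c E \<subseteq> model_eigenspace k h \<beta> (\<lambda>z. c z * cis (2 * pi * \<beta> z a)) E"
    using gauge_translation_eigenspace by blast
qed (use gauge_translation_inverse[of a] gauge_translation_inverse[of "- a"] in auto)

lemma mag_deriv_plus:
  assumes "smooth_on UNIV f" "smooth_on UNIV f'"
  shows "mag_deriv \<beta> v (\<lambda>x. f x + f' x) x = mag_deriv \<beta> v f x + mag_deriv \<beta> v f' x"
proof (rule mag_deriv_eqI[OF \<beta>])
  show "((\<lambda>x. f x + f' x) has_derivative (\<lambda>v. (mag_deriv \<beta> v f x + mag_deriv \<beta> v f' x) + \<i> * of_real (pi * \<beta> x v) * (f x + f' x))) (at x)"
    using has_derivative_add[OF assms[THEN has_derivative_mag_deriv[OF \<beta>]]]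
    by (rule has_derivative_eq_rhs) (simp add: algebra_simps)
qed

lemma mag_deriv_cmult:
  assumes "smooth_on UNIV f"
  shows "mag_deriv \<beta> v (\<lambda>x. a * f x) x = a * mag_deriv \<beta> v f x"
proof (rule mag_deriv_eqI[OF \<beta>])
  show "((\<lambda>x. a * f x) has_derivative (\<lambda>v. a * mag_deriv \<beta> v f x + \<i> * of_real (pi * \<beta> x v) * (a * f x))) (at x)"
    using has_derivative_mult_right[OF has_derivative_mag_deriv[OF \<beta> assms], of a]
    by (rule has_derivative_eq_rhs) (simp add: algebra_simps)
qed

lemma model_hamiltonian_linear:
  assumes f: "smooth_on UNIV f" and f': "smooth_on UNIV f'"
  shows "model_hamiltonian k h \<beta> (\<lambda>x. f x + f' x) x = model_hamiltonian k h \<beta> f x + model_hamiltonian k h \<beta> f' x"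
    and "model_hamiltonian k h \<beta> (\<lambda>x. a * f x) x = a * model_hamiltonian k h \<beta> f x"
proof -
  have "mag_deriv \<beta> u (mag_deriv \<beta> v (\<lambda>x. f x + f' x)) x = mag_deriv \<beta> u (mag_deriv \<beta> v f) x + mag_deriv \<beta> u (mag_deriv \<beta> v f') x" for u v
    by (simp add: mag_deriv_plus[OF f f', abs_def] mag_deriv_plus[OF smooth_mag_deriv[OF \<beta> f] smooth_mag_deriv[OF \<beta> f']])
  then show "model_hamiltonian k h \<beta> (\<lambda>x. f x + f' x) x = model_hamiltonian k h \<beta> f x + model_hamiltonian k h \<beta> f' x"
    by (simp add: model_hamiltonian_def sum.distrib ring_distribs)
  have "mag_deriv \<beta> u (mag_deriv \<beta> v (\<lambda>x. a * f x)) x = a * mag_deriv \<beta> u (mag_deriv \<beta> v f) x" for u v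
    by (simp add: mag_deriv_cmult[OF f, abs_def] mag_deriv_cmult[OF smooth_mag_deriv[OF \<beta> f]])
  then show "model_hamiltonian k h \<beta> (\<lambda>x. a * f x) x = a * model_hamiltonian k h \<beta> f x"
    by (simp add: model_hamiltonian_def sum_distrib_left mult_ac)
qed

lemma model_eigenspace_closed:
  "f \<in> model_eigenspace k h \<beta> c E \<Longrightarrow> f' \<in> model_eigenspace k h \<beta> c E \<Longrightarrow> (\<lambda>x. f x + f' x) \<in> model_eigenspace k h \<beta> c E"
  "f \<in> model_eigenspace k h \<beta> c E \<Longrightarrow> (\<lambda>x. a * f x) \<in> model_eigenspace k h \<beta> c E"
  using model_hamiltonian_linear[OF quasi_periodic_smooth[OF \<beta>] quasi_periodic_smooth[OF \<beta>]]
  by (auto simp: model_eigenspace_def quasi_periodic_add quasi_periodic_mult algebra_simps)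

lemma mag_deriv_expand:
  assumes f: "smooth_on UNIV f"
  shows "mag_deriv \<beta> v f x = (\<Sum>p\<in>Basis. of_real (v \<bullet> p) * mag_deriv \<beta> p f x)"
proof -
  have lin: "linear (\<lambda>v. mag_deriv \<beta> v f x)"
    by (intro linearI) (simp_all add: mag_deriv_add[OF \<beta> f] mag_deriv_scale[OF \<beta> f] scaleR_conv_of_real[where 'a = complex])
  have "mag_deriv \<beta> v f x = mag_deriv \<beta> (\<Sum>p\<in>Basis. (v \<bullet> p) *\<^sub>R p) f x" by (simp add: euclidean_representation)
  then show ?thesis by (simp add: linear_sum[OF lin] linear_cmul[OF lin] scaleR_conv_of_real[where 'a = complex])
qed

lemma smooth_on_sum: "(\<And>i. i \<in> A \<Longrightarrow> smooth_on UNIV (F i)) \<Longrightarrow> smooth_on UNIV (\<lambda>x. \<Sum>i\<in>A. F i x :: complex)"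
proof (induction A rule: infinite_finite_induct)
  case (insert x A)
  then show ?case using smooth_on_add[of UNIV "F x" "\<lambda>y. \<Sum>i\<in>A. F i y"] by simp
qed (simp_all add: smooth_on_const)

lemma mag_deriv_sum:
  fixes F :: "'i \<Rightarrow> real^'n \<Rightarrow> complex"
  assumes "finite A" "\<And>i. i \<in> A \<Longrightarrow> smooth_on UNIV (F i)"
  shows "mag_deriv \<beta> v (\<lambda>x. \<Sum>i\<in>A. F i x) x = (\<Sum>i\<in>A. mag_deriv \<beta> v (F i) x)"
  using assms
proof (induction A)
  case empty
  have "mag_deriv \<beta> v (\<lambda>x. 0 * 0) x = 0 * mag_deriv \<beta> v (\<lambda>x. 0) x"
    by (rule mag_deriv_cmult) (simp_all add: smooth_on_const)
  then show ?case by simp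
next
  case (insert i A)
  then show ?case
    using mag_deriv_plus[of "F i" "\<lambda>x. \<Sum>i\<in>A. F i x" v x] by (simp add: smooth_on_sum)
qed

text \<open>Transvected basis vectors are no longer basis vectors; the expansion expresses second
  derivatives along them by those in the original basis directions.\<close>

lemma mag_deriv_expand2:
  assumes f: "smooth_on UNIV f"
  shows "mag_deriv \<beta> u (mag_deriv \<beta> v f) x =
    (\<Sum>p\<in>Basis. \<Sum>q\<in>Basis. of_real ((u \<bullet> p) * (v \<bullet> q)) * mag_deriv \<beta> p (mag_deriv \<beta> q f) x)"
proof -
  have "mag_deriv \<beta> p (mag_deriv \<beta> v f) x = (\<Sum>q\<in>Basis. of_real (v \<bullet> q) * mag_deriv \<beta> p (mag_deriv \<beta> q f) x)" for p
  proof -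
    have "mag_deriv \<beta> v f = (\<lambda>x. \<Sum>q\<in>Basis. of_real (v \<bullet> q) * mag_deriv \<beta> q f x)"
      by (rule ext) (rule mag_deriv_expand[OF f])
    then have "mag_deriv \<beta> p (mag_deriv \<beta> v f) x = (\<Sum>q\<in>Basis. mag_deriv \<beta> p (\<lambda>x. of_real (v \<bullet> q) * mag_deriv \<beta> q f x) x)"
      by (simp add: mag_deriv_sum smooth_on_mult smooth_on_const smooth_mag_deriv[OF \<beta> f])
    then show ?thesis
      by (simp add: mag_deriv_cmult[OF smooth_mag_deriv[OF \<beta> f]])
  qed
  then show ?thesis
    unfolding mag_deriv_expand[OF smooth_mag_deriv[OF \<beta> f], of u] by (simp add: sum_distrib_left mult_ac)
qed

end

section \<open>Conjugating the Hamiltonian by the propagator\<close>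

lemma propagator_sum:
  fixes F :: "'i \<Rightarrow> real^'n::finite \<Rightarrow> complex"
  assumes \<beta>: "bilinear \<beta>" "\<And>u. \<beta> u u = 0" and w: "w \<in> int_lattice" "c w = cis (2 * pi * \<gamma>)"
    and "finite A" "\<And>i. i \<in> A \<Longrightarrow> F i \<in> quasi_periodic \<beta> c"
  shows "propagator \<beta> w \<gamma> r (\<lambda>x. \<Sum>i\<in>A. a i * F i x) x = (\<Sum>i\<in>A. a i * propagator \<beta> w \<gamma> r (F i) x)"
  using assms(5,6)
proof (induction A)
  case empty
  have z: "(\<lambda>_. 0) \<in> quasi_periodic \<beta> c" by (simp add: quasi_periodic_def smooth_on_const)
  show ?case using propagator_linear[where c = c, OF \<beta> w z z, of r 0 0 x] by simp
next
  case (insert i A)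
  have "(\<lambda>x. \<Sum>i\<in>A. a i * F i x) \<in> quasi_periodic \<beta> c"
    using insert.prems by (intro quasi_periodic_sum quasi_periodic_mult) auto
  then show ?case
    using propagator_linear[where c = c, OF \<beta> w, of "F i" "\<lambda>x. \<Sum>i\<in>A. a i * F i x" r "a i" 1 x] insert by simp
qed

text \<open>In matrices: if the Gram matrix of the new metric is the pullback of that of
  \<open>h\<close> by \<open>A\<close>, then its inverse is pushed forward to that of
  \<open>h\<close> by \<open>A\<close>. The vector \<open>At p\<close> is the transpose of
  \<open>A\<close> applied to \<open>p\<close>.\<close>

lemma cometric_transvected_sum:
  fixes \<omega> h :: "(real^'n::finite) tensor2"
  fixes w :: "real^'n" and t :: real
  assumes \<omega>: "symplectic_form \<omega>" and h: "flat_metric h"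
  defines "A \<equiv> transvection \<omega> w t"
  shows "(\<Sum>u\<in>Basis. \<Sum>v\<in>Basis. cometric (transvected \<omega> w h t) u v * ((A u \<bullet> p) * (A v \<bullet> q))) = cometric h p q"
proof -
  define At where "At p = (\<Sum>u\<in>Basis. (A u \<bullet> p) *\<^sub>R u)" for p
  have linA: "linear A" unfolding A_def by (rule linear_transvection[OF \<omega>])
  have At: "At p \<bullet> v = p \<bullet> A v" for p v
  proof -
    have "A v = A (\<Sum>u\<in>Basis. (v \<bullet> u) *\<^sub>R u)" by (simp add: euclidean_representation)
    then have "A v = (\<Sum>u\<in>Basis. (v \<bullet> u) *\<^sub>R A u)" by (simp add: linear_sum[OF linA] linear_cmul[OF linA])
    then have "p \<bullet> A v = (\<Sum>u\<in>Basis. (v \<bullet> u) * (p \<bullet> A u))" by (simp add: inner_sum_right)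
    also have "\<dots> = (\<Sum>u\<in>Basis. (A u \<bullet> p) * (u \<bullet> v))"
      by (intro sum.cong refl) (simp add: inner_commute mult.commute)
    finally show ?thesis by (simp add: At_def inner_sum_left)
  qed
  have e: "transvected \<omega> w h t = (\<lambda>u v. h (A u) (A v))" by (intro ext) (simp add: transvected_def A_def)
  have f: "flat_metric (transvected \<omega> w h t)" by (rule flat_metric_transvected[OF \<omega> h])
  have "cometric (transvected \<omega> w h t) (At p) (At q) = cometric h p q"
    unfolding e by (rule cometric_pullback[OF h f[unfolded e] _ At At]) (simp add: A_def surj_transvection[OF \<omega>])
  moreover have "cometric (transvected \<omega> w h t) (At p) (At q) =
      (\<Sum>u\<in>Basis. \<Sum>v\<in>Basis. cometric (transvected \<omega> w h t) u v * ((A u \<bullet> p) * (A v \<bullet> q)))"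
  proof -
    note b = bilinear_cometric[OF f]
    have l: "linear (\<lambda>u. cometric (transvected \<omega> w h t) u v)" "linear (cometric (transvected \<omega> w h t) u)" for u v
      using b by (simp_all add: bilinear_def)
    show ?thesis
      unfolding At_def by (simp add: linear_sum[OF l(1)] linear_sum[OF l(2)] bilinear_simps[OF b] sum_distrib_left mult_ac)
        (rule trans[OF sum.swap], intro sum.cong refl, simp add: mult_ac)
  qed
  ultimately show ?thesis by simp
qed

text \<open>The propagator turns basis derivatives into derivatives along the transvected basis.
  Contracting these with the cometric of the transvected metric gives back the contraction of basis
  derivatives with the cometric of \<open>h\<close>, so the propagator intertwines the two
  Hamiltonians.\<close>

lemma propagator_eigenspace:
  fixes \<omega> h :: "(real^'n::finite) tensor2"
  assumes \<omega>: "symplectic_form \<omega>" and h: "flat_metric h" and k: "k \<ge> 1"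
    and w: "w \<in> int_lattice" "c w = cis (2 * pi * \<gamma>)"
    and int: "\<And>z. z \<in> int_lattice \<Longrightarrow> scaled k \<omega> z w \<in> \<int>"
    and f: "f \<in> model_eigenspace k h (scaled k \<omega>) c E"
  shows "propagator (scaled k \<omega>) w \<gamma> (- (pi * t / k)) f \<in> model_eigenspace k (transvected \<omega> w h t) (scaled k \<omega>) c E"
proof -
  let ?\<beta> = "scaled k \<omega>" and ?T = "propagator (scaled k \<omega>) w \<gamma> (- (pi * t / k))"
  define A where "A = transvection \<omega> w t"
  have \<beta>: "bilinear ?\<beta>" "\<And>u. ?\<beta> u u = 0" using scaled_form[OF symplectic_formD(1,2)[OF \<omega>]] by auto
  note P = \<beta> w
  have fQ: "f \<in> quasi_periodic ?\<beta> c" and fE: "\<And>x. model_hamiltonian k h ?\<beta> f x = E * f x"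
    using f by (auto simp: model_eigenspace_def)
  note sm = quasi_periodic_smooth[OF \<beta> fQ]
  \<comment> \<open>The propagator for \<open>k \<omega>\<close> with parameter \<open>r\<close>
    induces the transvection with parameter \<open>- r / pi\<close> of \<open>k \<omega>\<close>.
    For \<open>r = - pi t / k\<close> the factors \<open>k\<close> cancel and this is the
    transvection of \<open>\<omega>\<close> with parameter \<open>t\<close>.\<close>
  have A: "transvection ?\<beta> w (- (- (pi * t / k) / pi)) v = A v" for v
    using k by (simp add: A_def transvection_def scaled_def)
  have dT: "mag_deriv ?\<beta> v (?T g) = ?T (mag_deriv ?\<beta> (A v) g)" if "g \<in> quasi_periodic ?\<beta> c" for v g
    using mag_deriv_propagator[where c = c, OF P that, of v "- (pi * t / k)"] by (simp only: A)
  define X where "X p q = ?T (mag_deriv ?\<beta> p (mag_deriv ?\<beta> q f))" for p q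
  have Q2: "mag_deriv ?\<beta> p (mag_deriv ?\<beta> q f) \<in> quasi_periodic ?\<beta> c" for p q
    by (intro mag_deriv_quasi_periodic[OF \<beta>] fQ)
  have Tsum: "?T (\<lambda>x. \<Sum>p\<in>Basis. \<Sum>q\<in>Basis. a p q * mag_deriv ?\<beta> p (mag_deriv ?\<beta> q f) x) x = (\<Sum>p\<in>Basis. \<Sum>q\<in>Basis. a p q * X p q x)" for a x
  proof -
    have "?T (\<lambda>x. \<Sum>p\<in>Basis. 1 * (\<Sum>q\<in>Basis. a p q * mag_deriv ?\<beta> p (mag_deriv ?\<beta> q f) x)) x =
        (\<Sum>p\<in>Basis. 1 * ?T (\<lambda>x. \<Sum>q\<in>Basis. a p q * mag_deriv ?\<beta> p (mag_deriv ?\<beta> q f) x) x)"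
      by (rule propagator_sum[where c = c, OF P finite_Basis]) (intro quasi_periodic_sum quasi_periodic_mult Q2)
    also have "\<dots> = (\<Sum>p\<in>Basis. 1 * (\<Sum>q\<in>Basis. a p q * X p q x))"
      unfolding X_def by (subst propagator_sum[where c = c, OF P finite_Basis]) (rule Q2, rule refl)
    finally show ?thesis by simp
  qed
  have dd: "mag_deriv ?\<beta> u (mag_deriv ?\<beta> v (?T f)) x = (\<Sum>p\<in>Basis. \<Sum>q\<in>Basis. of_real ((A u \<bullet> p) * (A v \<bullet> q)) * X p q x)" for u v x
  proof -
    have "mag_deriv ?\<beta> u (mag_deriv ?\<beta> v (?T f)) = ?T (mag_deriv ?\<beta> (A u) (mag_deriv ?\<beta> (A v) f))"
      by (simp only: dT[OF fQ] dT[OF mag_deriv_quasi_periodic[OF \<beta> fQ]])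
    also have "mag_deriv ?\<beta> (A u) (mag_deriv ?\<beta> (A v) f) =
        (\<lambda>x. \<Sum>p\<in>Basis. \<Sum>q\<in>Basis. of_real ((A u \<bullet> p) * (A v \<bullet> q)) * mag_deriv ?\<beta> p (mag_deriv ?\<beta> q f) x)"
      by (rule ext) (rule mag_deriv_expand2[OF \<beta> sm])
    finally show ?thesis using Tsum[of "\<lambda>p q. of_real ((A u \<bullet> p) * (A v \<bullet> q))" x] by simp
  qed
  let ?K = "complex_of_real ((1 / real k)\<^sup>2 / 2)" and ?h' = "transvected \<omega> w h t"
  have "model_hamiltonian k ?h' ?\<beta> (?T f) x = E * ?T f x" for x
  proof -
    have "(\<Sum>u\<in>Basis. \<Sum>v\<in>Basis. of_real (cometric ?h' u v) * mag_deriv ?\<beta> u (mag_deriv ?\<beta> v (?T f)) x)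
       = (\<Sum>u\<in>Basis. \<Sum>v\<in>Basis. \<Sum>p\<in>Basis. \<Sum>q\<in>Basis. of_real (cometric ?h' u v * ((A u \<bullet> p) * (A v \<bullet> q))) * X p q x)"
      unfolding dd by (simp add: sum_distrib_left mult_ac)
    also have "\<dots> = (\<Sum>p\<in>Basis. \<Sum>q\<in>Basis. \<Sum>u\<in>Basis. \<Sum>v\<in>Basis. of_real (cometric ?h' u v * ((A u \<bullet> p) * (A v \<bullet> q))) * X p q x)"
    proof -
      have "(\<Sum>u\<in>Basis. \<Sum>v\<in>Basis. \<Sum>p\<in>Basis. \<Sum>q\<in>Basis. F u v p q) = (\<Sum>p\<in>Basis. \<Sum>q\<in>Basis. \<Sum>u\<in>Basis. \<Sum>v\<in>Basis. F u v p q)"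
        for F :: "real^'n \<Rightarrow> real^'n \<Rightarrow> real^'n \<Rightarrow> real^'n \<Rightarrow> complex"
      proof -
        have "(\<Sum>u\<in>Basis. \<Sum>v\<in>Basis. \<Sum>p\<in>Basis. \<Sum>q\<in>Basis. F u v p q) = (\<Sum>u\<in>Basis. \<Sum>p\<in>Basis. \<Sum>v\<in>Basis. \<Sum>q\<in>Basis. F u v p q)"
          by (intro sum.cong refl sum.swap)
        also have "\<dots> = (\<Sum>p\<in>Basis. \<Sum>u\<in>Basis. \<Sum>v\<in>Basis. \<Sum>q\<in>Basis. F u v p q)" by (rule sum.swap)
        also have "\<dots> = (\<Sum>p\<in>Basis. \<Sum>u\<in>Basis. \<Sum>q\<in>Basis. \<Sum>v\<in>Basis. F u v p q)"
          by (intro sum.cong refl sum.swap)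
        also have "\<dots> = (\<Sum>p\<in>Basis. \<Sum>q\<in>Basis. \<Sum>u\<in>Basis. \<Sum>v\<in>Basis. F u v p q)"
          by (intro sum.cong refl sum.swap)
        finally show ?thesis .
      qed
      then show ?thesis .
    qed
    also have "\<dots> = (\<Sum>p\<in>Basis. \<Sum>q\<in>Basis. of_real (\<Sum>u\<in>Basis. \<Sum>v\<in>Basis. cometric ?h' u v * ((A u \<bullet> p) * (A v \<bullet> q))) * X p q x)"
      by (simp add: sum_distrib_right)
    also have "\<dots> = (\<Sum>p\<in>Basis. \<Sum>q\<in>Basis. of_real (cometric h p q) * X p q x)"
      unfolding A_def cometric_transvected_sum[OF \<omega> h] ..
    finally have "model_hamiltonian k ?h' ?\<beta> (?T f) x = (\<Sum>p\<in>Basis. \<Sum>q\<in>Basis. (- ?K * of_real (cometric h p q)) * X p q x)"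
      unfolding model_hamiltonian_def by (simp add: sum_distrib_left sum_negf mult_ac)
    also have "\<dots> = ?T (\<lambda>x. \<Sum>p\<in>Basis. \<Sum>q\<in>Basis. (- ?K * of_real (cometric h p q)) * mag_deriv ?\<beta> p (mag_deriv ?\<beta> q f) x) x"
      by (rule Tsum[symmetric])
    also have "(\<lambda>x. \<Sum>p\<in>Basis. \<Sum>q\<in>Basis. (- ?K * of_real (cometric h p q)) * mag_deriv ?\<beta> p (mag_deriv ?\<beta> q f) x) = (\<lambda>x. E * f x + 0 * f x)"
      using fE unfolding model_hamiltonian_def by (simp add: fun_eq_iff sum_distrib_left sum_negf mult_ac)
    also have "?T (\<lambda>x. E * f x + 0 * f x) x = E * ?T f x"
      using propagator_linear[where c = c, OF P fQ fQ, of _ E 0 x] by simp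
    finally show ?thesis .
  qed
  then show ?thesis
    using propagator_quasi_periodic[where c = c, OF P fQ int] by (simp add: model_eigenspace_def)
qed

lemma bij_betw_propagator:
  fixes \<omega> h :: "(real^'n::finite) tensor2"
  assumes \<omega>: "symplectic_form \<omega>" and h: "flat_metric h" and k: "k \<ge> 1"
    and w: "w \<in> int_lattice" "c w = cis (2 * pi * \<gamma>)"
    and int: "\<And>z. z \<in> int_lattice \<Longrightarrow> scaled k \<omega> z w \<in> \<int>"
  shows "bij_betw (propagator (scaled k \<omega>) w \<gamma> (- (pi * t / k)))
    (model_eigenspace k h (scaled k \<omega>) c E) (model_eigenspace k (transvected \<omega> w h t) (scaled k \<omega>) c E)"
proof (rule bij_betw_byWitness[where f' = "propagator (scaled k \<omega>) w \<gamma> (pi * t / k)"])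
  have \<beta>: "bilinear (scaled k \<omega>)" "\<And>u. scaled k \<omega> u u = 0" using scaled_form[OF symplectic_formD(1,2)[OF \<omega>]] by auto
  have Q: "f \<in> quasi_periodic (scaled k \<omega>) c" if "f \<in> model_eigenspace k h' (scaled k \<omega>) c E" for f h'
    using that by (simp add: model_eigenspace_def)
  note inv = propagator_inverse[where c = c, OF \<beta> w]
  show "\<forall>f\<in>model_eigenspace k h (scaled k \<omega>) c E.
      propagator (scaled k \<omega>) w \<gamma> (pi * t / k) (propagator (scaled k \<omega>) w \<gamma> (- (pi * t / k)) f) = f"
    using inv[OF Q, where r = "- (pi * t / k)"] by simp
  show "\<forall>f\<in>model_eigenspace k (transvected \<omega> w h t) (scaled k \<omega>) c E.
      propagator (scaled k \<omega>) w \<gamma> (- (pi * t / k)) (propagator (scaled k \<omega>) w \<gamma> (pi * t / k) f) = f"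
    using inv[OF Q] by blast
  show "propagator (scaled k \<omega>) w \<gamma> (- (pi * t / k)) ` model_eigenspace k h (scaled k \<omega>) c E
      \<subseteq> model_eigenspace k (transvected \<omega> w h t) (scaled k \<omega>) c E"
    using propagator_eigenspace[where c = c, OF \<omega> h k w int] by blast
  \<comment> \<open>The inverse propagator is the one with parameter \<open>- t\<close>, applied to
    the transvected metric as the initial one.\<close>
  have "transvected \<omega> w (transvected \<omega> w h t) (- t) = h"
    by (intro ext) (simp add: transvected_def transvection_inverse[OF \<omega>])
  then show "propagator (scaled k \<omega>) w \<gamma> (pi * t / k) ` model_eigenspace k (transvected \<omega> w h t) (scaled k \<omega>) c E
      \<subseteq> model_eigenspace k h (scaled k \<omega>) c E"
    using propagator_eigenspace[where c = c, OF \<omega> flat_metric_transvected[OF \<omega> h, of w t] k w int, where t = "- t"] by auto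
qed

section \<open>Characters of the lattice and the comparison of two bundles\<close>

lemma cis_Arg_unit:
  assumes "cmod z = 1" shows "cis (Arg z) = z"
proof -
  have "z \<noteq> 0" using assms by auto
  then show ?thesis using assms by (simp add: cis_Arg sgn_eq)
qed

text \<open>Phases of the character on the axis vectors prescribe the values of
  \<open>\<omega>(\<cdot>, a)\<close> there, and nondegeneracy provides such an \<open>a\<close>.
  Both sides are then characters that agree on generators of the lattice.\<close>

lemma lattice_character:
  fixes \<omega> :: "(real^'n::finite) tensor2"
  assumes \<omega>: "symplectic_form \<omega>"
    and mult: "\<And>z z'. z \<in> int_lattice \<Longrightarrow> z' \<in> int_lattice \<Longrightarrow> \<nu> (z + z') = \<nu> z * \<nu> z'"
    and unit: "\<And>z. z \<in> int_lattice \<Longrightarrow> cmod (\<nu> z) = 1"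
  obtains a where "\<And>z. z \<in> int_lattice \<Longrightarrow> \<nu> z = cis (2 * pi * \<omega> z a)"
proof -
  note b = symplectic_formD(1)[OF \<omega>]
  define \<tau> where "\<tau> i = Arg (\<nu> (axis i 1)) / (2 * pi)" for i
  have \<tau>: "\<nu> (axis i 1) = cis (2 * pi * \<tau> i)" for i
  proof -
    have "cis (Arg (\<nu> (axis i 1))) = \<nu> (axis i 1)"
      by (rule cis_Arg_unit[OF unit[OF axis_in_int_lattice]])
    then show ?thesis by (simp add: \<tau>_def)
  qed
  define M where "M a = (\<chi> i. \<omega> (axis i 1) a)" for a
  have linM: "linear M" by (intro linearI) (simp_all add: M_def vec_eq_iff bilinear_simps[OF b])
  have "inj M"
    unfolding linear_injective_0[OF linM]
  proof (intro allI impI)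
    fix a assume "M a = 0"
    then have "\<omega> (axis i 1) a = 0" for i by (simp add: M_def vec_eq_iff)
    then have "\<omega> a (axis i 1) = 0" for i using symplectic_formD(3)[OF \<omega>, of a "axis i 1"] by simp
    then show "a = 0" using symplectic_nonzero_axis[OF \<omega>, of a] by blast
  qed
  then have "surj M" using linM linear_injective_imp_surjective by blast
  then obtain a where a: "M a = (\<chi> i. \<tau> i)" by (metis surjD)
  then have a: "\<omega> (axis i 1) a = \<tau> i" for i by (simp add: M_def vec_eq_iff)
  \<comment> \<open>The set where the two characters agree is a subgroup; it contains the axis
    vectors, hence all their integer combinations.\<close>
  define G where "G = {z \<in> int_lattice. \<nu> z = cis (2 * pi * \<omega> z a)}"
  have "\<nu> (0 + 0) = \<nu> 0 * \<nu> 0" by (intro mult int_lattice_closed(1))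
  moreover have "\<nu> 0 \<noteq> 0" using unit[OF int_lattice_closed(1)] by auto
  ultimately have "\<nu> 0 = 1" by simp
  then have G0: "0 \<in> G" by (simp add: G_def int_lattice_closed(1) bilinear_simps[OF b])
  have Gadd: "x + y \<in> G" if "x \<in> G" "y \<in> G" for x y
    using that by (simp add: G_def int_lattice_closed(2) mult bilinear_simps[OF b] cis_mult ring_distribs)
  have Gneg: "- x \<in> G" if "x \<in> G" for x
  proof -
    have x: "x \<in> int_lattice" "\<nu> x = cis (2 * pi * \<omega> x a)" using that by (auto simp: G_def)
    have "\<nu> (- x) * \<nu> x = 1"
      using mult[OF int_lattice_closed(4)[OF x(1)] x(1)] \<open>\<nu> 0 = 1\<close> by simp
    then have "\<nu> (- x) * (cis (2 * pi * \<omega> x a) * cis (- (2 * pi * \<omega> x a))) = cis (- (2 * pi * \<omega> x a))"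
      by (simp add: x(2) mult.assoc[symmetric])
    then have "\<nu> (- x) = cis (- (2 * pi * \<omega> x a))" by (simp add: cis_mult)
    then show ?thesis using x(1) by (simp add: G_def int_lattice_closed(4) bilinear_simps[OF b])
  qed
  have Gaxis: "axis i 1 \<in> G" for i by (simp add: G_def axis_in_int_lattice \<tau> a)
  have Gnat: "real n *\<^sub>R axis i 1 \<in> G" for n i
  proof (induction n)
    case (Suc n)
    then show ?case using Gadd[OF Suc Gaxis[of i]] by (simp add: algebra_simps)
  qed (simp add: G0)
  have Gint: "real_of_int m *\<^sub>R axis i 1 \<in> G" for m i
  proof (cases m rule: int_cases2)
    case (nonneg n) then show ?thesis using Gnat[of n i] by simp
  next
    case (nonpos n) then show ?thesis using Gneg[OF Gnat[of n i]] by simp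
  qed
  have Gsum: "(\<Sum>i\<in>S. F i) \<in> G" if "\<And>i. i \<in> S \<Longrightarrow> F i \<in> G" for S :: "'n set" and F
    using that by (induction S rule: infinite_finite_induct) (auto simp: G0 Gadd)
  have "z \<in> G" if z: "z \<in> int_lattice" for z
  proof -
    have "z $ i *\<^sub>R axis i 1 \<in> G" for i
      using z Gint[of _ i] by (auto simp: int_lattice_def elim!: allE[of _ i] Ints_cases)
    then have "(\<Sum>i\<in>UNIV. z $ i *\<^sub>R axis i 1) \<in> G" by (intro Gsum)
    then show ?thesis using basis_expansion[of z] by (simp add: scalar_mult_eq_scaleR)
  qed
  then show ?thesis using that by (auto simp: G_def)
qed

text \<open>Both multipliers obey the same twisted identity, so their quotient is a character of the
  lattice and is realised by a magnetic translation. The eigenspaces for both bundles are linear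
  images of one model eigenspace, namely that of \<open>h\<close> with the multiplier of the second
  bundle.\<close>

lemma spectrum_transvected:
  fixes \<omega> h :: "(real^'n::finite) tensor2"
  assumes \<omega>: "symplectic_form \<omega>" and h: "flat_metric h" and k: "k \<ge> 1" and w: "w \<in> int_lattice"
    and pq1: "prequantum_bundle \<omega> U1 g1 \<theta>1" and pq2: "prequantum_bundle \<omega> U2 g2 \<theta>2"
  shows "spectrum k (transvected \<omega> w h t) U1 g1 \<theta>1 = spectrum k h U2 g2 \<theta>2"
proof -
  have ba: "bilinear \<omega>" "\<And>u. \<omega> u u = 0" using symplectic_formD(1,2)[OF \<omega>] by auto
  have \<beta>: "bilinear (scaled k \<omega>)" "\<And>u. scaled k \<omega> u u = 0" using scaled_form[OF ba] by auto
  obtain \<phi>1 where \<phi>1: "parallel_frame \<omega> U1 g1 \<theta>1 UNIV \<phi>1" using ex_parallel_frame[OF ba pq1] by blast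
  obtain c1 where c1: "\<And>z. z \<in> int_lattice \<Longrightarrow> cmod (c1 z) = 1"
    "\<And>z a y. z \<in> int_lattice \<Longrightarrow> proj y \<in> U1 a \<Longrightarrow> \<phi>1 a y = c1 z * cis (pi * \<omega> z y) * \<phi>1 a (y + z)"
    using ex_multiplier[OF ba pq1 \<phi>1] by blast
  obtain \<phi>2 where \<phi>2: "parallel_frame \<omega> U2 g2 \<theta>2 UNIV \<phi>2" using ex_parallel_frame[OF ba pq2] by blast
  obtain c2 where c2: "\<And>z. z \<in> int_lattice \<Longrightarrow> cmod (c2 z) = 1"
    "\<And>z a y. z \<in> int_lattice \<Longrightarrow> proj y \<in> U2 a \<Longrightarrow> \<phi>2 a y = c2 z * cis (pi * \<omega> z y) * \<phi>2 a (y + z)"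
    using ex_multiplier[OF ba pq2 \<phi>2] by blast
  note P1 = ba pq1 \<phi>1 c1 and P2 = ba pq2 \<phi>2 c2
  obtain a where a: "\<And>z. z \<in> int_lattice \<Longrightarrow> c1 z / c2 z = cis (2 * pi * \<omega> z a)"
  proof (rule lattice_character[OF \<omega>, of "\<lambda>z. c1 z / c2 z"])
    fix z z' :: "real^'n" assume z: "z \<in> int_lattice" "z' \<in> int_lattice"
    then show "c1 (z + z') / c2 (z + z') = c1 z / c2 z * (c1 z' / c2 z')"
      by (simp add: multiplier_add[OF P1] multiplier_add[OF P2])
  qed (use c1 c2 in \<open>auto simp: norm_divide\<close>)
  have c12: "c2 z ^ k * cis (2 * pi * scaled k \<omega> z a) = c1 z ^ k" if "z \<in> int_lattice" for z
  proof -
    have "c2 z \<noteq> 0" using c2(1)[OF that] by auto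
    then have "c2 z * cis (2 * pi * \<omega> z a) = c1 z" using a[OF that] by (simp add: field_simps)
    moreover have "cis (2 * pi * scaled k \<omega> z a) = cis (2 * pi * \<omega> z a) ^ k"
      unfolding scaled_def Complex.DeMoivre by (simp add: mult.left_commute)
    ultimately show ?thesis by (metis power_mult_distrib)
  qed
  \<comment> \<open>The phase of the multiplier along the loop in direction \<open>w\<close>, as the
    propagator requires; the power \<open>k\<close> belongs to the bundle power.\<close>
  define \<gamma> where "\<gamma> = Arg (c2 w ^ k) / (2 * pi)"
  have "cmod (c2 w ^ k) = 1" using c2(1)[OF w] by (simp add: norm_power)
  then have "cis (Arg (c2 w ^ k)) = c2 w ^ k" by (rule cis_Arg_unit)
  then have \<gamma>: "c2 w ^ k = cis (2 * pi * \<gamma>)" by (simp add: \<gamma>_def)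
  have int: "scaled k \<omega> z w \<in> \<int>" if "z \<in> int_lattice" for z
    unfolding scaled_def using integral_on_lattice[OF P2 that w] by (intro Ints_mult) auto
  let ?V = "\<lambda>E. model_eigenspace k h (scaled k \<omega>) (\<lambda>z. c2 z ^ k) E"
  let ?T = "propagator (scaled k \<omega>) w \<gamma> (- (pi * t / k))"
  \<comment> \<open>Three bijections of eigenspaces: the propagator changes the metric, the magnetic
    translation changes the multiplier, and the frame turns functions into sections of the first
    bundle.\<close>
  let ?S1 = "section_of U1 \<phi>1 k \<circ> (gauge_translation (scaled k \<omega>) a \<circ> ?T)" and ?S2 = "section_of U2 \<phi>2 k"
  let ?sF = "\<lambda>c (f :: real^'n \<Rightarrow> complex) x. c * f x" and ?sS = "\<lambda>c (s :: 'n lb_section) a x. c * s a x"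
  have vF: "vector_space ?sF" and vS: "vector_space ?sS"
    by (unfold_locales; simp add: fun_eq_iff algebra_simps)+
  have eq: "vector_space.dim ?sS (eigenspace k (transvected \<omega> w h t) U1 g1 \<theta>1 E) = vector_space.dim ?sS (eigenspace k h U2 g2 \<theta>2 E) \<and>
     (eigenspace k (transvected \<omega> w h t) U1 g1 \<theta>1 E = {0} \<longleftrightarrow> eigenspace k h U2 g2 \<theta>2 E = {0})" for E
  proof -
    have Vadd: "f + f' \<in> ?V E" if "f \<in> ?V E" "f' \<in> ?V E" for f f'
      using model_eigenspace_closed(1)[OF \<beta> that] by (simp add: plus_fun_def)
    have Vmult: "?sF b f \<in> ?V E" if "f \<in> ?V E" for b f
      by (rule model_eigenspace_closed(2)[OF \<beta> that])
    have V0: "0 \<in> ?V E"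
    proof -
      have "mag_deriv (scaled k \<omega>) v (\<lambda>x. 0) = (\<lambda>x. 0)" for v
        by (simp add: mag_deriv_def fun_eq_iff)
      then show ?thesis
        by (simp add: model_eigenspace_def quasi_periodic_def model_hamiltonian_def zero_fun_def smooth_on_const)
    qed
    have VQ: "f \<in> quasi_periodic (scaled k \<omega>) (\<lambda>z. c2 z ^ k)" if "f \<in> ?V E" for f
      using that by (simp add: model_eigenspace_def)
    have "bij_betw ?T (?V E) (model_eigenspace k (transvected \<omega> w h t) (scaled k \<omega>) (\<lambda>z. c2 z ^ k) E)"
      by (rule bij_betw_propagator[where c = "\<lambda>z. c2 z ^ k", OF \<omega> h k w \<gamma> int])
    moreover have "bij_betw (gauge_translation (scaled k \<omega>) a)
        (model_eigenspace k (transvected \<omega> w h t) (scaled k \<omega>) (\<lambda>z. c2 z ^ k) E)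
        (model_eigenspace k (transvected \<omega> w h t) (scaled k \<omega>) (\<lambda>z. c1 z ^ k) E)"
    proof -
      have "quasi_periodic (scaled k \<omega>) (\<lambda>z. c2 z ^ k * cis (2 * pi * scaled k \<omega> z a)) = quasi_periodic (scaled k \<omega>) (\<lambda>z. c1 z ^ k)"
        by (rule quasi_periodic_cong) (rule c12)
      then show ?thesis
        using bij_betw_gauge_translation[OF \<beta>, of a k "transvected \<omega> w h t" "\<lambda>z. c2 z ^ k" E]
        by (simp add: model_eigenspace_def)
    qed
    moreover have "bij_betw (section_of U1 \<phi>1 k) (model_eigenspace k (transvected \<omega> w h t) (scaled k \<omega>) (\<lambda>z. c1 z ^ k) E)
        (eigenspace k (transvected \<omega> w h t) U1 g1 \<theta>1 E)"
      by (rule bij_betw_section_of[OF P1])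
    ultimately have b1: "bij_betw ?S1 (?V E) (eigenspace k (transvected \<omega> w h t) U1 g1 \<theta>1 E)"
      by (intro bij_betw_trans)
    have b2: "bij_betw ?S2 (?V E) (eigenspace k h U2 g2 \<theta>2 E)" by (rule bij_betw_section_of[OF P2])
    have Tadd: "?T (f + f') x = ?T f x + ?T f' x" if "f \<in> ?V E" "f' \<in> ?V E" for f f' x
      using propagator_linear[where c = "\<lambda>z. c2 z ^ k", OF \<beta> w \<gamma> VQ[OF that(1)] VQ[OF that(2)], of "- (pi * t / k)" 1 1 x]
      by (simp add: plus_fun_def)
    have Tmult: "?T (?sF b f) x = b * ?T f x" if "f \<in> ?V E" for b f x
      using propagator_linear[where c = "\<lambda>z. c2 z ^ k", OF \<beta> w \<gamma> VQ[OF that] VQ[OF that], of "- (pi * t / k)" b 0 x]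
      by simp
    have S1add: "?S1 (f + f') = ?S1 f + ?S1 f'" if "f \<in> ?V E" "f' \<in> ?V E" for f f'
      by (intro ext) (simp add: section_of_def gauge_translation_def Tadd[OF that] distrib_left)
    have S1mult: "?S1 (?sF b f) = ?sS b (?S1 f)" if "f \<in> ?V E" for b f
      by (intro ext) (simp add: section_of_def gauge_translation_def Tmult[OF that])
    have S2add: "?S2 (f + f') = ?S2 f + ?S2 f'" for f f'
      by (intro ext) (simp add: section_of_def algebra_simps)
    have S2mult: "?S2 (?sF b f) = ?sS b (?S2 f)" for b f
      by (intro ext) (simp add: section_of_def)
    note dims = linear_bijection_dim[where ?s1.0 = ?sF and ?s2.0 = ?sS and V = "?V E"]
    have "vector_space.dim ?sS (eigenspace k (transvected \<omega> w h t) U1 g1 \<theta>1 E) = vector_space.dim ?sF (?V E)"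
      by (rule dims(1)[where T = ?S1]) (fact vF vS V0 Vadd Vmult b1 S1add S1mult)+
    moreover have "eigenspace k (transvected \<omega> w h t) U1 g1 \<theta>1 E = {0} \<longleftrightarrow> ?V E = {0}"
      by (rule dims(2)[where T = ?S1]) (fact vF vS V0 Vadd Vmult b1 S1add S1mult)+
    moreover have "vector_space.dim ?sS (eigenspace k h U2 g2 \<theta>2 E) = vector_space.dim ?sF (?V E)"
      by (rule dims(1)[where T = ?S2]) (fact vF vS V0 Vadd Vmult b2 | rule S2add S2mult)+
    moreover have "eigenspace k h U2 g2 \<theta>2 E = {0} \<longleftrightarrow> ?V E = {0}"
      by (rule dims(2)[where T = ?S2]) (fact vF vS V0 Vadd Vmult b2 | rule S2add S2mult)+
    ultimately show ?thesis by simp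
  qed
  then show ?thesis unfolding spectrum_def by auto
qed

lemma quantum_equivalent_transvected:
  "symplectic_form \<omega> \<Longrightarrow> flat_metric h \<Longrightarrow> w \<in> int_lattice \<Longrightarrow> quantum_equivalent (transvected \<omega> w h t) \<omega> h \<omega>"
  unfolding quantum_equivalent_def using spectrum_transvected by blast

theorem theorem1p1:
  fixes m :: nat and \<omega> h :: "(real^'n::finite) tensor2"
  assumes "m \<ge> 1" and "CARD('n) = 2 * m"
    and "symplectic_form \<omega>" and "flat_metric h"
  shows "\<exists>(I :: real set) (H :: real \<Rightarrow> (real^'n) tensor2).
     is_interval I \<and> (\<exists>s\<in>I. \<exists>t\<in>I. s < t) \<and>
     (\<forall>t\<in>I. flat_metric (H t)) \<and>
     (\<forall>u v. continuous_on I (\<lambda>t. H t u v)) \<and>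
     (\<exists>t\<in>I. H t = h) \<and>
     (\<forall>s\<in>I. \<forall>t\<in>I. s \<noteq> t \<longrightarrow> \<not> isometric (H s) (H t)) \<and>
     (\<forall>t\<in>I. classically_equivalent (H t) \<omega> h \<omega>) \<and>
     (integral_class \<omega> \<longrightarrow> (\<forall>t\<in>I. quantum_equivalent (H t) \<omega> h \<omega>))"
proof -
  note \<omega> = assms(3) and h = assms(4)
  obtain w e where w: "w \<in> int_lattice" and e: "(e::real) > 0"
    and dec: "\<And>s t. 0 \<le> s \<Longrightarrow> s < t \<Longrightarrow> t \<le> e \<Longrightarrow>
      \<exists>z\<in>int_lattice - {0}. \<forall>z'\<in>int_lattice - {0}. transvected \<omega> w h t z z < transvected \<omega> w h s z' z'"
    using systole_decreasing[OF \<omega> h] by blast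
  let ?H = "transvected \<omega> w h"
  have flat: "flat_metric (?H t)" for t by (rule flat_metric_transvected[OF \<omega> h])
  have "continuous_on {0..e} (\<lambda>t. ?H t u v)" for u v
    unfolding transvected_def transvection_def bilinear_simps[OF flat_metricD(1)[OF h]] real_scaleR_def
    by (intro continuous_intros)
  \<comment> \<open>The metric with the larger parameter has the shorter vector, so the two orders
    of \<open>s\<close> and \<open>t\<close> need the two directions of
    \<open>not_isometric_of_shorter_vector\<close>.\<close>
  moreover have "\<not> isometric (?H s) (?H t)" if "s \<in> {0..e}" "t \<in> {0..e}" "s \<noteq> t" for s t
  proof (cases "s < t")
    case True
    then show ?thesis using not_isometric_of_shorter_vector(1)[OF flat flat dec[of s t]] that by simp
  next
    case False
    then show ?thesis using not_isometric_of_shorter_vector(2)[OF flat flat dec[of t s]] that by simp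
  qed
  moreover have "?H 0 = h" by (intro ext) (simp add: transvected_def transvection_def)
  moreover have "is_interval {0..e}" by (rule is_interval_cc)
  moreover have "\<exists>s\<in>{0..e}. \<exists>t\<in>{0..e}. s < t" using e by (intro bexI[of _ 0] bexI[of _ e]) auto
  moreover have "\<exists>t\<in>{0..e}. ?H t = h" using e \<open>?H 0 = h\<close> by (intro bexI[of _ 0]) auto
  ultimately show ?thesis
    using flat classically_equivalent_transvected[OF \<omega> h] quantum_equivalent_transvected[OF \<omega> h w]
    by (intro exI[of _ "{0..e}"] exI[of _ ?H]) blast
qed

end
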